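(* Let $g(x)=\dfrac{x^2-1}{(x^2+1)(x^2+4)(x^2+9)}$ for $x\in\mathbb{R}$, and let $\alpha,\beta>0$. If $0<\alpha\beta<\frac13$, then the Gabor system $\mathcal G(g,\alpha,\beta)$ is a frame for $L^2(\mathbb{R})$.
   Context: For $g\in L^2(\mathbb{R})$ nonzero and $\alpha,\beta>0$, the Gabor system is $\mathcal G(g,\alpha,\beta)=\{x\mapsto e^{2\pi i\beta m x}g(x-\alpha k): k,m\in\mathbb{Z}\}$. It is a (Gabor) frame for $L^2(\mathbb{R})$ if there exist constants $A,B>0$ such that for every $f\in L^2(\mathbb{R})$, $A\|f\|^2\le\sum_{m,k\in\mathbb{Z}}|\langle f,e^{2\pi i\beta m\cdot}g(\cdot-\alpha k)\rangle|^2\le B\|f\|^2$. *)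

theory Defs
  imports "HOL-Analysis.Analysis"
begin

text \<open>Elements of \<open>L\<^sup>2(\<real>)\<close> are represented by Lebesgue measurable, square integrable
  functions; functions that agree almost everywhere are not identified.\<close>

definition L2_fun :: "(real \<Rightarrow> complex) set" where
  "L2_fun = {f. f \<in> borel_measurable lebesgue \<and> integrable lebesgue (\<lambda>x. (cmod (f x))\<^sup>2)}"

definition L2_norm :: "(real \<Rightarrow> complex) \<Rightarrow> real" where
  "L2_norm f = sqrt (LINT x|lebesgue. (cmod (f x))\<^sup>2)"

definition L2_inner :: "(real \<Rightarrow> complex) \<Rightarrow> (real \<Rightarrow> complex) \<Rightarrow> complex" where
  "L2_inner f h = (LINT x|lebesgue. f x * cnj (h x))"

text \<open>Summability is demanded explicitly because \<^const>\<open>infsum\<close> of a non-summable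
  real family is \<open>0\<close>, which would make the upper frame bound hold vacuously.\<close>

definition is_L2_frame :: "('i \<Rightarrow> real \<Rightarrow> complex) \<Rightarrow> bool" where
  "is_L2_frame e \<longleftrightarrow>
     (\<forall>i. e i \<in> L2_fun) \<and>
     (\<exists>A>0. \<exists>B>0. \<forall>f\<in>L2_fun.
        (\<lambda>i. (cmod (L2_inner f (e i)))\<^sup>2) summable_on UNIV \<and>
        A * (L2_norm f)\<^sup>2 \<le> (\<Sum>\<^sub>\<infinity>i\<in>UNIV. (cmod (L2_inner f (e i)))\<^sup>2) \<and>
        (\<Sum>\<^sub>\<infinity>i\<in>UNIV. (cmod (L2_inner f (e i)))\<^sup>2) \<le> B * (L2_norm f)\<^sup>2)"

text \<open>The Gabor system is a family indexed by \<open>(k, m)\<close>, not a set: coinciding members count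
  with multiplicity in the frame sum.\<close>

definition gabor_system ::
    "(real \<Rightarrow> complex) \<Rightarrow> real \<Rightarrow> real \<Rightarrow> int \<times> int \<Rightarrow> real \<Rightarrow> complex" where
  "gabor_system g \<alpha> \<beta> =
     (\<lambda>(k, m) x. exp (2 * of_real pi * \<i> * of_real (\<beta> * of_int m * x)) * g (x - \<alpha> * of_int k))"

end

theory Submission
  imports Defs "HOL-Real_Asymp.Real_Asymp"
begin

text \<open>The window \<open>g\<close> has an explicit Fourier transform. Partial fractions give
\<open>g(x) = -(\<pi>/12) \<integral> \<phi>(\<xi>) exp(2\<pi>ix\<xi>) d\<xi>\<close> with \<open>\<phi>(\<xi>) = exp(-w) (1 - exp(-w))\<^sup>2\<close> and
\<open>w = 2\<pi>\<bar>\<xi>\<bar>\<close> (\<open>window_eq_fourier_bump\<close>). For continuous \<open>f\<close> of compact support with Fourier transform \<open>F\<close>,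
the coefficient of \<open>f\<close> at \<open>(k, m)\<close> is, up to a factor of constant modulus, the \<open>k\<close>-th Fourier
coefficient of the \<open>1/\<alpha>\<close>-periodization of \<open>F \<phi>(\<cdot> - \<beta>m)\<close>. Parseval's identity in \<open>k\<close>
(\<open>parseval_periodization\<close>) and Plancherel's identity for \<open>f\<close> (\<open>plancherel\<close>) therefore
reduce the two frame inequalities to bounds, uniform in \<open>x\<close>, for the infinite matrices
\<open>c \<mapsto> (\<Sum>\<^sub>n c\<^sub>n \<phi>\<^sub>a(x + n - bm))\<^sub>m\<close> with \<open>a = 2\<pi>/\<alpha>\<close>, \<open>b = \<alpha>\<beta>\<close> and
\<open>\<phi>\<^sub>a(s) = exp(-a\<bar>s\<bar>) (1 - exp(-a\<bar>s\<bar>))\<^sup>2\<close>, called \<open>bump a s\<close> below.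

The upper bound is Schur's test. The lower bound is where \<open>b < 1/3\<close> enters. The function
\<open>\<Psi>(t) = \<Sum>\<^sub>n c\<^sub>n \<phi>\<^sub>a(t - n)\<close> is a spline with knots at the integers: on each unit interval it is a
combination of the six exponentials \<open>exp(\<plusminus>at), exp(\<plusminus>2at), exp(\<plusminus>3at)\<close>. Near \<open>0\<close> one has
\<open>\<phi>\<^sub>a(s) = a\<^sup>2s\<^sup>2 + O(\<bar>s\<bar>\<^sup>3)\<close>, so \<open>\<Psi>\<close> is of class \<open>C\<^sup>2\<close> and Rolle's theorem can be
applied twice, to the operators \<open>D - l\<^sub>1\<close> and \<open>D - l\<^sub>2\<close> that annihilate two of the exponentials.
What is left has four exponentials per interval, hence at most three zeros there unless it
vanishes identically. If \<open>\<Psi>\<close> vanishes at all points \<open>bm - x\<close>, there are on average \<open>1/b > 3\<close> zeros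
per interval, so it vanishes on a whole interval, and then \<open>c = 0\<close>
(\<open>exp_spline_vanishing\<close>, \<open>bump_uniqueness\<close>).

Counting zeros only requires the series to converge, so uniqueness covers all sequences with
\<open>c\<^sub>0 = 1\<close> and \<open>\<bar>c\<^sub>j\<bar> \<le> exp(a\<bar>j\<bar>/2)\<close>. These form a compact set in the product topology, and
compactness turns uniqueness into a local inequality with uniform constants
(\<open>bump_local_lower_bound\<close>). After rescaling and translation it applies at every index at which a bounded
sequence dominates all its other entries up to such weights, and these dominant indices carry a
fixed proportion of the \<open>\<ell>\<^sup>2\<close> norm (\<open>bump_lower_bound\<close>). Finally, continuous functions of
compact support are dense in \<open>L\<^sup>2\<close>, and frame bounds extend from a dense class with a loss in the
constants (\<open>is_L2_frame_of_dense\<close>).\<close>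

section \<open>Zeros of exponential splines\<close>

lemma rolle_count:
  fixes f f' :: "real \<Rightarrow> real"
  assumes f: "\<And>x. (f has_real_derivative f' x) (at x)"
    and Z: "finite Z" "\<And>z. z \<in> Z \<Longrightarrow> f z = 0"
  shows "\<exists>Z'. finite Z' \<and> card Z' = card Z - 1 \<and>
           (\<forall>z\<in>Z'. f' z = 0 \<and> (\<exists>x\<in>Z. \<exists>y\<in>Z. x < z \<and> z < y))"
  using Z
proof (induction Z rule: finite_linorder_max_induct)
  case empty
  then show ?case by (intro exI[of _ "{}"]) auto
next
  case (insert b Z)
  show ?case
  proof (cases "Z = {}")
    case True
    then show ?thesis by (intro exI[of _ "{}"]) auto
  next
    case False
    obtain Z' where Z': "finite Z'" "card Z' = card Z - 1"
      "\<forall>z\<in>Z'. f' z = 0 \<and> (\<exists>x\<in>Z. \<exists>y\<in>Z. x < z \<and> z < y)"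
      using insert by auto
    define m where "m = Max Z"
    have m: "m \<in> Z" "\<And>z. z \<in> Z \<Longrightarrow> z \<le> m"
      unfolding m_def using insert.hyps(1) False by auto
    have "m < b" using m insert by auto
    moreover have "f m = f b" using insert.prems m by auto
    moreover have "continuous_on {m..b} f"
      using f by (meson DERIV_isCont continuous_at_imp_continuous_on)
    ultimately obtain z where z: "m < z" "z < b" "(\<lambda>v. f' z * v) = (\<lambda>v. 0)"
      using Rolle_deriv[of m b f "\<lambda>x v. f' x * v"] f
      by (metis has_field_derivative_def)
    have fz: "f' z = 0" using fun_cong[OF z(3), of 1] by simp
    have nz: "z \<notin> Z'"
    proof
      assume "z \<in> Z'"
      then obtain y where "y \<in> Z" "z < y" using Z'(3) by blast
      with m(2)[of y] z(1) show False by simp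
    qed
    have "card Z > 0" using False insert.hyps(1) by (simp add: card_gt_0_iff)
    then have "card (insert z Z') = card (insert b Z) - 1"
      using Z' nz insert.hyps by (subst card_insert_disjoint; auto)+
    moreover have "\<forall>z\<in>insert z Z'. f' z = 0 \<and> (\<exists>x\<in>insert b Z. \<exists>y\<in>insert b Z. x < z \<and> z < y)"
      using Z'(3) fz z m(1) by blast
    ultimately show ?thesis using Z'(1) by (intro exI[of _ "insert z Z'"]) auto
  qed
qed

text \<open>Rolle's theorem for the operator \<open>D - \<mu>\<close>, which is \<open>exp(\<mu>x) D exp(-\<mu>x)\<close>; multiplying by an exponential
does not change the zeros.\<close>

lemma rolle_count_twisted:
  fixes f f' :: "real \<Rightarrow> real"
  assumes f: "\<And>x. (f has_real_derivative f' x) (at x)"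
    and Z: "finite Z" "\<And>z. z \<in> Z \<Longrightarrow> f z = 0"
  shows "\<exists>Z'. finite Z' \<and> card Z' = card Z - 1 \<and>
           (\<forall>z\<in>Z'. f' z - \<mu> * f z = 0 \<and> (\<exists>x\<in>Z. \<exists>y\<in>Z. x < z \<and> z < y))"
proof -
  define h where "h = (\<lambda>x. exp (- \<mu> * x) * f x)"
  define h' where "h' = (\<lambda>x. exp (- \<mu> * x) * (f' x - \<mu> * f x))"
  have "(h has_real_derivative h' x) (at x)" for x
    unfolding h_def h'_def
    by (auto intro!: derivative_eq_intros f simp: algebra_simps)
  from rolle_count[of h h', OF this Z(1)] Z(2)
  show ?thesis by (auto simp: h_def h'_def)
qed

text \<open>The classical Chebyshev property of real exponentials, in the form of a uniqueness statement: each
application of \<open>D - \<mu>\<close> costs one zero and removes the frequency \<open>\<mu>\<close>.\<close>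

lemma exp_sum_eq_0:
  fixes L Z :: "real set" and A :: "real \<Rightarrow> real"
  assumes "finite L" "finite Z" "card L \<le> card Z"
    and "\<And>z. z \<in> Z \<Longrightarrow> (\<Sum>l\<in>L. A l * exp (l * z)) = 0"
  shows "\<forall>l\<in>L. A l = 0"
  using assms
proof (induction L arbitrary: A Z rule: finite_induct)
  case empty
  then show ?case by simp
next
  case (insert \<mu> L)
  define f where "f = (\<lambda>t. \<Sum>l\<in>insert \<mu> L. A l * exp (l * t))"
  define f' where "f' = (\<lambda>t. \<Sum>l\<in>insert \<mu> L. A l * l * exp (l * t))"
  have D: "(f has_real_derivative f' x) (at x)" for x
    unfolding f_def f'_def
    by (auto intro!: derivative_eq_intros sum.cong simp: algebra_simps)
  have f0: "f z = 0" if "z \<in> Z" for z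
    using insert.prems(3)[OF that] by (simp add: f_def)
  obtain Z' where Z': "finite Z'" "card Z' = card Z - 1" "\<And>z. z \<in> Z' \<Longrightarrow> f' z - \<mu> * f z = 0"
    using rolle_count_twisted[of f f', OF D insert.prems(1) f0] by blast
  have comb: "f' z - \<mu> * f z = (\<Sum>l\<in>L. (A l * (l - \<mu>)) * exp (l * z))" for z
  proof -
    have "f' z - \<mu> * f z = (\<Sum>l\<in>insert \<mu> L. (A l * (l - \<mu>)) * exp (l * z))"
      unfolding f_def f'_def sum_distrib_left sum_subtractf[symmetric]
      by (intro sum.cong) (auto simp: algebra_simps)
    then show ?thesis using insert.hyps by simp
  qed
  have "\<forall>l\<in>L. A l * (l - \<mu>) = 0"
  proof (rule insert.IH[OF Z'(1)])
    show "card L \<le> card Z'" using insert.prems insert.hyps Z'(2) by simp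
    show "(\<Sum>l\<in>L. (A l * (l - \<mu>)) * exp (l * z)) = 0" if "z \<in> Z'" for z
      using Z'(3)[OF that] comb by simp
  qed
  then have AL: "\<forall>l\<in>L. A l = 0"
    using insert.hyps(2) by auto
  have "card Z > 0" using insert.prems insert.hyps by simp
  then obtain z where "z \<in> Z" by fastforce
  from insert.prems(3)[OF this] AL insert.hyps have "A \<mu> = 0" by simp
  with AL show ?case by simp
qed

lemma has_derivative_positive_part:
  fixes h h' :: "real \<Rightarrow> real"
  assumes h: "\<And>x. (h has_real_derivative h' x) (at x)" and 0: "h 0 = 0" "h' 0 = 0"
  shows "((\<lambda>x. if x \<ge> 0 then h x else 0) has_real_derivative (if x \<ge> 0 then h' x else 0)) (at x)"
proof -
  have "((\<lambda>x. if x \<in> {0..} then h x else 0) has_real_derivative (if x \<in> {0..} then h' x else 0))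
      (at x within ({0..} \<union> {..0}))"
    unfolding has_field_derivative_def
  proof -
    show "((\<lambda>x. if x \<in> {0..} then h x else 0) has_derivative (*) (if x \<in> {0..} then h' x else 0))
        (at x within ({0..} \<union> {..0}))"
    proof (rule has_derivative_eq_rhs)
      show "((\<lambda>x. if x \<in> {0..} then h x else (\<lambda>_. 0) x) has_derivative
         (if x \<in> {0..} then (*) (h' x) else (\<lambda>_. 0))) (at x within ({0..} \<union> {..0}))"
        using h[unfolded has_field_derivative_def] 0
        by (intro has_derivative_If_within_closures[where g="\<lambda>_. 0" and T="{..0}"
              and f'="\<lambda>x. (*) (h' x)" and g'="\<lambda>_ _. 0"])
           (auto simp: fun_eq_iff intro: has_derivative_at_withinI)
    qed (auto simp: fun_eq_iff)
  qed
  moreover have "({0..} \<union> {..0}) = (UNIV :: real set)" by auto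
  ultimately show ?thesis by simp
qed

text \<open>The first point of the progression in the interval lies within \<open>b\<close> of its left end, so \<open>j\<close>
consecutive points fit into length \<open>jb\<close>.\<close>

lemma arith_progression_in_interval:
  fixes \<xi> b u l :: real
  assumes "b > 0" "real j * b \<le> l"
  shows "\<exists>Z. finite Z \<and> card Z = j \<and> Z \<subseteq> {u..<u + l} \<inter> range (\<lambda>k::int. \<xi> + b * of_int k)"
proof -
  define k0 where "k0 = \<lceil>(u - \<xi>) / b\<rceil>"
  define p where "p = (\<lambda>i::nat. \<xi> + b * of_int (k0 + int i))"
  have inj: "inj p" using assms(1) by (auto simp: p_def inj_on_def)
  have "(u - \<xi>) / b \<le> k0" "k0 < (u - \<xi>) / b + 1"
    unfolding k0_def by linarith+
  then have lo: "u \<le> \<xi> + b * k0" and hi: "\<xi> + b * k0 < u + b"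
    using assms(1) by (simp_all add: field_simps)
  have "u \<le> p i \<and> p i < u + l" if "i < j" for i
  proof -
    have "real (Suc i) * b \<le> real j * b"
      using that assms(1) by (intro mult_right_mono) (auto simp del: of_nat_Suc)
    moreover have "p i = \<xi> + b * k0 + real i * b" by (simp add: p_def algebra_simps)
    moreover have "0 \<le> real i * b" using assms(1) by simp
    moreover have "real (Suc i) * b = b + real i * b" by (simp add: algebra_simps)
    ultimately show ?thesis using lo hi assms(2) by (intro conjI; linarith)
  qed
  moreover have "p i \<in> range (\<lambda>k::int. \<xi> + b * of_int k)" for i
    unfolding p_def by (rule rangeI)
  ultimately show ?thesis
    using inj by (intro exI[of _ "p ` {..<j}"]) (auto simp: card_image inj_on_subset)
qed

text \<open>The zero count behind the bound \<open>1/3\<close>. The three moment conditions say that \<open>\<sigma>\<close> vanishes to third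
order at \<open>0\<close>, so the truncated function has two derivatives and \<open>\<Psi>\<close> is a \<open>C\<^sup>2\<close> spline
with six exponentials per interval. Removing two exponentials by Rolle leaves a function with at most three zeros
per interval \<open>[i, i + 1)\<close> or vanishing there. The bound relating \<open>b\<close> and \<open>N\<close> makes the sampling
points in \<open>[0, N + 1)\<close> at least \<open>3(N + 1) + 3\<close> many: two zeros are lost to Rolle and one more is needed to
exceed three per interval. Hence \<open>\<Psi>\<close> vanishes on some interval \<open>[i, i + 1)\<close>. To the left of
the knot \<open>i\<close> it equals \<open>-c\<^sub>i \<sigma>(t - i)\<close>, where a single further zero gives \<open>c\<^sub>i = 0\<close>, and so on down
to \<open>c\<^sub>0 = 0\<close>.\<close>

lemma exp_spline_vanishing:
  fixes L :: "real set" and A w :: "real \<Rightarrow> real" and c :: "nat \<Rightarrow> real" and b \<xi> :: real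
  defines "\<sigma> \<equiv> \<lambda>s. \<Sum>l\<in>L. w l * exp (l * s)"
  defines "\<Psi> \<equiv> \<lambda>N t. (\<Sum>l\<in>L. A l * exp (l * t)) + (\<Sum>n\<le>N. c n * (if t \<ge> n then \<sigma> (t - n) else 0))"
  assumes L: "finite L" "card L = 6"
    and w: "(\<Sum>l\<in>L. w l) = 0" "(\<Sum>l\<in>L. w l * l) = 0" "(\<Sum>l\<in>L. w l * l\<^sup>2) = 0"
    and \<sigma>0: "\<And>s. s < 0 \<Longrightarrow> \<sigma> s \<noteq> 0"
    and b: "b > 0" "(3 * real N + 6) * b \<le> real N + 1"
    and zero: "\<And>k::int. -1 \<le> \<xi> + b * k \<Longrightarrow> \<xi> + b * k < real N + 1 \<Longrightarrow> \<Psi> N (\<xi> + b * k) = 0"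
  shows "c 0 = 0"
proof -
  \<comment> \<open>On \<open>[i - 1, i)\<close> the spline has the coefficients \<open>B i\<close>; the argument \<open>k\<close> of \<open>E k i\<close> and \<open>Ps k\<close>
    counts derivatives.\<close>
  define B where "B = (\<lambda>i l. A l + (\<Sum>n<i. c n * w l * exp (- l * real n)))"
  define E where "E = (\<lambda>k i t. \<Sum>l\<in>L. B i l * l ^ k * exp (l * t))"
  define sg where "sg = (\<lambda>k s. \<Sum>l\<in>L. w l * l ^ k * exp (l * s))"
  define Ps where "Ps = (\<lambda>k t. (\<Sum>l\<in>L. A l * l ^ k * exp (l * t))
      + (\<Sum>n\<le>N. c n * (if t - n \<ge> 0 then sg k (t - n) else 0)))"
  have sg0: "\<sigma> = sg 0" by (simp add: sg_def \<sigma>_def fun_eq_iff)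
  have \<Psi>: "\<Psi> N = Ps 0" 
    unfolding \<Psi>_def Ps_def sg0[symmetric] by (simp add: fun_eq_iff)
  have E_0: "E k 0 t = (\<Sum>l\<in>L. A l * l ^ k * exp (l * t))" for k t by (simp add: E_def B_def)
  have E_Suc: "E k (Suc i) t = E k i t + c i * sg k (t - i)" for k i t
  proof -
    have "exp (l * (t - real i)) = exp (- l * real i) * exp (l * t)" for l
      by (simp add: mult_exp_exp algebra_simps)
    then show ?thesis
      by (simp add: E_def B_def sg_def sum.distrib[symmetric] sum_distrib_left algebra_simps)
  qed
  have E_sum: "E k i t = E k 0 t + (\<Sum>n<i. c n * sg k (t - n))" for k i t
    by (induction i) (simp_all add: E_Suc)
  have piece: "Ps k t = E k i t" if "real i - 1 \<le> t" "t < real i" "i \<le> Suc N" for i t k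
  proof -
    have "(\<Sum>n\<le>N. c n * (if t - n \<ge> 0 then sg k (t - n) else 0)) = (\<Sum>n<i. c n * sg k (t - n))"
    proof (rule sum.mono_neutral_cong_right)
      show "\<forall>n\<in>{..N} - {..<i}. c n * (if 0 \<le> t - real n then sg k (t - real n) else 0) = 0"
        using that by auto
      fix n assume "n \<in> {..<i}"
      then have "real n + 1 \<le> real i" by auto
      with that show "c n * (if 0 \<le> t - real n then sg k (t - real n) else 0) = c n * sg k (t - real n)"
        by auto
    qed (use that in auto)
    then show ?thesis by (simp add: Ps_def E_sum[of k i] E_0)
  qed
  have sgd: "(sg k has_real_derivative sg (Suc k) x) (at x)" for k x
    unfolding sg_def by (auto intro!: derivative_eq_intros sum.cong simp: algebra_simps)
  have sgz: "sg k 0 = 0" if "k \<le> 2" for k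
  proof -
    have "k = 0 \<or> k = 1 \<or> k = 2" using that by auto
    then show ?thesis using w by (auto simp: sg_def)
  qed
  have Psd: "(Ps k has_real_derivative Ps (Suc k) x) (at x)" if "k \<le> 1" for k x
  proof -
    have "((\<lambda>t. if t - real n \<ge> 0 then sg k (t - n) else 0) has_real_derivative
          (if x - real n \<ge> 0 then sg (Suc k) (x - n) else 0)) (at x)" for n
      using DERIV_chain2[OF has_derivative_positive_part[of "sg k" "sg (Suc k)" "x - real n", OF sgd]
            DERIV_diff[OF DERIV_ident DERIV_const]] sgz[of k] sgz[of "Suc k"] that
      by simp
    then show ?thesis
      unfolding Ps_def
      by (auto intro!: derivative_eq_intros sum.cong simp: algebra_simps)
  qed
  \<comment> \<open>The two exponents that the two Rolle steps remove.\<close>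
  obtain l1 l2 M where M: "L = insert l1 (insert l2 M)" "l1 \<noteq> l2" "l1 \<notin> M" "l2 \<notin> M" "card M = 4" "finite M"
  proof -
    have "card L = Suc 5" using L by simp
    then obtain x L' where 1: "L = insert x L'" "x \<notin> L'" "card L' = 5"
      by (metis card_Suc_eq)
    then have "card L' = Suc 4" by simp
    then obtain y M where "L' = insert y M" "y \<notin> M" "card M = 4"
      by (metis card_Suc_eq)
    with 1 that[of x y M] L show thesis by auto
  qed
  obtain Z where Z: "finite Z" "card Z = 3 * N + 6"
      "Z \<subseteq> {0..<real N + 1} \<inter> range (\<lambda>k::int. \<xi> + b * of_int k)"
    using arith_progression_in_interval[of b "3 * N + 6" "real N + 1" 0 \<xi>] b by auto
  have Z0: "Ps 0 z = 0" if "z \<in> Z" for z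
    using Z(3) that zero \<Psi> by fastforce
  obtain Z1 where Z1: "finite Z1" "card Z1 = card Z - 1"
    "\<And>z. z \<in> Z1 \<Longrightarrow> Ps 1 z - l1 * Ps 0 z = 0"
    "\<And>z. z \<in> Z1 \<Longrightarrow> \<exists>x\<in>Z. \<exists>y\<in>Z. x < z \<and> z < y"
    using rolle_count_twisted[of "Ps 0" "Ps 1" Z l1] Psd[of 0] Z(1) Z0 by force
  have D1: "((\<lambda>z. Ps 1 z - l1 * Ps 0 z) has_real_derivative (Ps 2 x - l1 * Ps 1 x)) (at x)" for x
    using Psd[of 0 x] Psd[of 1 x] by (auto intro!: derivative_eq_intros simp: numeral_2_eq_2)
  obtain Z2 where Z2: "finite Z2" "card Z2 = card Z1 - 1"
    "\<And>z. z \<in> Z2 \<Longrightarrow> (Ps 2 z - l1 * Ps 1 z) - l2 * (Ps 1 z - l1 * Ps 0 z) = 0"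
    "\<And>z. z \<in> Z2 \<Longrightarrow> \<exists>x\<in>Z1. \<exists>y\<in>Z1. x < z \<and> z < y"
    using rolle_count_twisted[OF D1 Z1(1) Z1(3), of l2] by force
  have Z2_range: "0 \<le> z \<and> z < real N + 1" if z: "z \<in> Z2" for z
  proof -
    obtain x y where "x \<in> Z1" "x < z" "y \<in> Z1" "z < y" using Z2(4)[OF z] by auto
    moreover then obtain x' y' where "x' \<in> Z" "x' < x" "y' \<in> Z" "y < y'"
      using Z1(4) by meson
    ultimately show ?thesis using Z(3) by (auto simp: subset_iff)
  qed
  \<comment> \<open>There are \<open>3(N + 1) + 1\<close> zeros left for \<open>N + 1\<close> intervals.\<close>
  obtain i where i: "i \<le> N" "4 \<le> card {z \<in> Z2. nat \<lfloor>z\<rfloor> = i}"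
  proof (rule ccontr)
    assume "\<not> thesis"
    with that have *: "card {z \<in> Z2. nat \<lfloor>z\<rfloor> = i} \<le> 3" if "i \<le> N" for i
      using that by force
    have "Z2 \<subseteq> (\<Union>i\<le>N. {z \<in> Z2. nat \<lfloor>z\<rfloor> = i})"
    proof
      fix z assume "z \<in> Z2"
      moreover from Z2_range[OF this] have "nat \<lfloor>z\<rfloor> \<le> N" by linarith
      ultimately show "z \<in> (\<Union>i\<le>N. {z \<in> Z2. nat \<lfloor>z\<rfloor> = i})" by auto
    qed
    then have "card Z2 \<le> card (\<Union>i\<le>N. {z \<in> Z2. nat \<lfloor>z\<rfloor> = i})"
      using Z2(1) by (intro card_mono) auto
    also have "\<dots> \<le> (\<Sum>i\<le>N. card {z \<in> Z2. nat \<lfloor>z\<rfloor> = i})"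
      by (rule card_UN_le) auto
    also have "\<dots> \<le> (\<Sum>i\<le>N. 3)" using * by (intro sum_mono) auto
    finally show False using Z2(2) Z1(2) Z(2) by simp
  qed
  have in_piece: "real i \<le> z \<and> z < real (Suc i)" if "z \<in> Z2" "nat \<lfloor>z\<rfloor> = i" for z
    using Z2_range[OF that(1)] that(2) by (auto simp del: of_nat_Suc) linarith+
  have "\<forall>l\<in>M. B (Suc i) l * (l - l1) * (l - l2) = 0"
  proof (rule exp_sum_eq_0[OF M(6)])
    show "finite {z \<in> Z2. nat \<lfloor>z\<rfloor> = i}" using Z2(1) by simp
    show "card M \<le> card {z \<in> Z2. nat \<lfloor>z\<rfloor> = i}" using M i by simp
    fix z assume z: "z \<in> {z \<in> Z2. nat \<lfloor>z\<rfloor> = i}"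
    then have p: "Ps k z = E k (Suc i) z" for k
      using in_piece[of z] i(1) by (intro piece) auto
    have "(\<Sum>l\<in>L. B (Suc i) l * (l - l1) * (l - l2) * exp (l * z))
        = (E 2 (Suc i) z - l1 * E 1 (Suc i) z) - l2 * (E 1 (Suc i) z - l1 * E 0 (Suc i) z)"
      unfolding E_def sum_distrib_left sum_subtractf[symmetric]
      by (intro sum.cong) (auto simp: algebra_simps power2_eq_square)
    also have "\<dots> = 0" using Z2(3)[of z] z p by simp
    finally show "(\<Sum>l\<in>M. B (Suc i) l * (l - l1) * (l - l2) * exp (l * z)) = 0"
      using M by simp
  qed
  then have BM: "\<forall>l\<in>M. B (Suc i) l = 0" using M by auto
  have b3: "3 * b \<le> 1"
  proof -
    have "3 * b * (real N + 1) \<le> (3 * real N + 6) * b" using b(1) by (simp add: algebra_simps)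
    also have "\<dots> \<le> 1 * (real N + 1)" unfolding mult_1 by (rule b(2))
    finally show ?thesis by (rule mult_right_le_imp_le) simp
  qed
  have B12: "\<forall>l\<in>{l1, l2}. B (Suc i) l = 0"
  proof -
    obtain Y where Y: "finite Y" "card Y = 2" "Y \<subseteq> {real i..<real i + 1} \<inter> range (\<lambda>k::int. \<xi> + b * of_int k)"
      using arith_progression_in_interval[of b 2 1 "real i" \<xi>] b b3 by auto
    show ?thesis
    proof (rule exp_sum_eq_0[OF _ Y(1)])
      show "card {l1, l2} \<le> card Y" using Y by (simp add: card_insert_le_m1)
      fix z assume z: "z \<in> Y"
      with Y have zi: "real i \<le> z" "z < real i + 1" by auto
      then have "E 0 (Suc i) z = Ps 0 z" using i(1) by (intro piece[symmetric]) auto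
      also have "\<dots> = 0" using z Y zi i(1) zero \<Psi> by fastforce
      finally show "(\<Sum>l\<in>{l1, l2}. B (Suc i) l * exp (l * z)) = 0"
        using M BM by (simp add: E_def)
    qed simp
  qed
  have E_i: "E 0 (Suc i) t = 0" for t
    using BM B12 M by (simp add: E_def)
  \<comment> \<open>Once the piece to the right of the knot \<open>j\<close> vanishes, the piece to its left is a multiple of
    \<open>\<sigma>(t - j)\<close>, which has no zero there.\<close>
  have down: "c j = 0 \<and> E 0 j = (\<lambda>t. 0)" if j: "j \<le> N" and E: "E 0 (Suc j) = (\<lambda>t. 0)" for j
  proof -
    have eq: "E 0 j t = - c j * sg 0 (t - j)" for t
      using E_Suc[of 0 j t] fun_cong[OF E, of t] by simp
    obtain Y where Y: "card Y = 1" "Y \<subseteq> {real j - 1..<real j - 1 + 1} \<inter> range (\<lambda>k::int. \<xi> + b * of_int k)"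
      using arith_progression_in_interval[of b 1 1 "real j - 1" \<xi>] b b3 by auto
    then obtain y where y: "y \<in> Y" by fastforce
    with Y have yj: "real j - 1 \<le> y" "y < real j" by auto
    have "E 0 j y = Ps 0 y" using yj j by (intro piece[symmetric]) auto
    also have "\<dots> = 0" using y Y yj j zero \<Psi> by fastforce
    finally have "c j = 0" using eq[of y] \<sigma>0[of "y - j"] yj sg0 by simp
    with eq show ?thesis by auto
  qed
  have "E 0 (Suc j) = (\<lambda>t. 0)" if "j \<le> i" for j
    using that
  proof (induction rule: inc_induct)
    case base
    then show ?case using E_i by auto
  next
    case (step n)
    then show ?case using down[of "Suc n"] i by auto
  qed
  then show ?thesis using down[of 0] by auto
qed

section \<open>Uniqueness of sampling for the transformed window\<close>

lemma summable_on_exp_neg_abs_int: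
  assumes "r > 0"
  shows "(\<lambda>n::int. exp (- r * \<bar>real_of_int n\<bar>)) summable_on UNIV"
proof -
  have geo: "(\<lambda>n::nat. exp (- r * real n)) summable_on UNIV"
  proof -
    have "summable (\<lambda>n::nat. exp (- r) ^ n)"
      using assms by (intro summable_geometric) auto
    then have "(\<lambda>n::nat. exp (- r) ^ n) summable_on UNIV"
      by (subst summable_on_UNIV_nonneg_real_iff) auto
    then show ?thesis by (simp add: exp_of_nat_mult[symmetric] mult.commute)
  qed
  have "(\<lambda>n. exp (- r * \<bar>real_of_int n\<bar>)) summable_on (int ` UNIV)"
    by (subst summable_on_reindex) (use geo in \<open>auto simp: o_def\<close>)
  moreover have "(\<lambda>n. exp (- r * \<bar>real_of_int n\<bar>)) summable_on ((\<lambda>n. - int n) ` UNIV)"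
    by (subst summable_on_reindex) (use geo in \<open>auto simp: o_def inj_on_def\<close>)
  ultimately have "(\<lambda>n. exp (- r * \<bar>real_of_int n\<bar>)) summable_on (int ` UNIV \<union> (\<lambda>n. - int n) ` UNIV)"
    by (rule summable_on_union)
  moreover have "int ` UNIV \<union> (\<lambda>n. - int n) ` UNIV = UNIV"
    by (metis (no_types, lifting) UNIV_eq_I UnI1 UnI2 int_cases2 rangeI)
  ultimately show ?thesis by simp
qed

lemma exp_neg_abs_translate_le:
  fixes r t :: real and n :: int
  assumes "r > 0"
  shows "exp (- r * \<bar>t - n\<bar>) \<le> exp r * exp (- r * \<bar>real_of_int (n - \<lfloor>t\<rfloor>)\<bar>)"
proof -
  have "\<bar>real_of_int (n - \<lfloor>t\<rfloor>)\<bar> \<le> 1 + \<bar>t - n\<bar>" by linarith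
  then have "r * \<bar>real_of_int (n - \<lfloor>t\<rfloor>)\<bar> \<le> r * (1 + \<bar>t - n\<bar>)"
    using assms by (intro mult_left_mono) auto
  then show ?thesis by (simp add: mult_exp_exp algebra_simps)
qed

lemma
  assumes "r > 0"
  defines "C \<equiv> exp r * (\<Sum>\<^sub>\<infinity>n::int. exp (- r * \<bar>real_of_int n\<bar>))"
  shows summable_on_exp_neg_dist_int: "(\<lambda>n::int. exp (- r * \<bar>t - n\<bar>)) summable_on UNIV"
    and infsum_exp_neg_dist_int_le: "(\<Sum>\<^sub>\<infinity>n::int. exp (- r * \<bar>t - n\<bar>)) \<le> C"
proof -
  have bij: "bij_betw (\<lambda>n::int. n - \<lfloor>t\<rfloor>) UNIV UNIV"
    by (rule bij_betw_byWitness[where f' = "\<lambda>n. n + \<lfloor>t\<rfloor>"]) auto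
  have s: "(\<lambda>n::int. exp r * exp (- r * \<bar>real_of_int (n - \<lfloor>t\<rfloor>)\<bar>)) summable_on UNIV"
    using summable_on_reindex_bij_betw[OF bij, of "\<lambda>n. exp (- r * \<bar>real_of_int n\<bar>)"]
      summable_on_exp_neg_abs_int[OF assms(1)]
    by (intro summable_on_cmult_right) simp
  show s1: "(\<lambda>n::int. exp (- r * \<bar>t - n\<bar>)) summable_on UNIV"
    by (rule summable_on_comparison_test[OF s exp_neg_abs_translate_le[OF assms(1)]]) auto
  have "(\<Sum>\<^sub>\<infinity>n::int. exp (- r * \<bar>t - n\<bar>))
      \<le> (\<Sum>\<^sub>\<infinity>n::int. exp r * exp (- r * \<bar>real_of_int (n - \<lfloor>t\<rfloor>)\<bar>))"
    by (rule infsum_mono[OF s1 s exp_neg_abs_translate_le[OF assms(1)]])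
  also have "\<dots> = C"
    using infsum_reindex_bij_betw[OF bij, of "\<lambda>n. exp (- r * \<bar>real_of_int n\<bar>)"]
    by (simp add: C_def infsum_cmult_right')
  finally show "(\<Sum>\<^sub>\<infinity>n::int. exp (- r * \<bar>t - n\<bar>)) \<le> C" .
qed

text \<open>For \<open>a = 2\<pi>\<close> this is the Fourier transform of the window, up to a constant factor. The general rate
\<open>a\<close> appears after the period \<open>1/\<alpha>\<close> is scaled to \<open>1\<close>.\<close>

definition bump :: "real \<Rightarrow> real \<Rightarrow> real" where
  "bump a s = exp (- a * \<bar>s\<bar>) * (1 - exp (- a * \<bar>s\<bar>))\<^sup>2"

abbreviation nn_sum :: "('i \<Rightarrow> ennreal) \<Rightarrow> ennreal" (binder "\<Sum>\<^sup>+" 10) where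
  "nn_sum f \<equiv> nn_integral (count_space UNIV) f"

abbreviation bump_series :: "real \<Rightarrow> real \<Rightarrow> (int \<Rightarrow> real) \<Rightarrow> real \<Rightarrow> int \<Rightarrow> real" where
  "bump_series a b c x m \<equiv> \<Sum>\<^sub>\<infinity>n. c n * bump a (x + of_int n - b * of_int m)"

abbreviation cbump_series :: "real \<Rightarrow> real \<Rightarrow> (int \<Rightarrow> complex) \<Rightarrow> real \<Rightarrow> int \<Rightarrow> complex" where
  "cbump_series a b c x m \<equiv> \<Sum>\<^sub>\<infinity>n. c n * of_real (bump a (x + of_int n - b * of_int m))"

abbreviation square_sum :: "(int \<Rightarrow> real) \<Rightarrow> ennreal" where
  "square_sum c \<equiv> \<integral>\<^sup>+n. ennreal ((c n)\<^sup>2) \<partial>count_space UNIV"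

abbreviation csquare_sum :: "(int \<Rightarrow> complex) \<Rightarrow> ennreal" where
  "csquare_sum c \<equiv> \<integral>\<^sup>+n. ennreal ((cmod (c n))\<^sup>2) \<partial>count_space UNIV"

lemma bump_nonneg: "0 \<le> bump a s"
  by (simp add: bump_def)

lemma bump_le: "a > 0 \<Longrightarrow> bump a s \<le> exp (- a * \<bar>s\<bar>)"
  unfolding bump_def by (intro mult_left_le power_le_one) auto

lemma continuous_on_bump [continuous_intros]:
  "continuous_on S f \<Longrightarrow> continuous_on S (\<lambda>x. bump a (f x))"
  unfolding bump_def by (intro continuous_intros)

lemma bump_minus [simp]: "bump a (- s) = bump a s"
  by (simp add: bump_def)

lemma bump_translate_le:
  fixes a b x :: real and m n :: int
  assumes "a > 0"
  shows "bump a (x + n - b * m) \<le> exp (a * \<bar>x - b * m\<bar>) * exp (- a * \<bar>real_of_int n\<bar>)"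
proof -
  have "\<bar>real_of_int n\<bar> \<le> \<bar>x + n - b * m\<bar> + \<bar>x - b * m\<bar>" by linarith
  then have "a * \<bar>real_of_int n\<bar> \<le> a * (\<bar>x + n - b * m\<bar> + \<bar>x - b * m\<bar>)" using assms by (intro mult_left_mono) auto
  then have "exp (- a * \<bar>x + n - b * m\<bar>) \<le> exp (a * \<bar>x - b * m\<bar>) * exp (- a * \<bar>real_of_int n\<bar>)"
    by (simp add: mult_exp_exp algebra_simps)
  with bump_le[OF assms, of "x + n - b * m"] show ?thesis by linarith
qed

text \<open>The weights \<open>exp(a\<bar>n\<bar>/2)\<close> use up only half of the decay of the bump, so the sampled series still
converge geometrically, uniformly for bounded \<open>x\<close>.\<close>

lemma exp_weight_bound:
  fixes c :: "int \<Rightarrow> real" and a b x :: real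
  assumes "a > 0" "\<bar>c n\<bar> \<le> exp (a / 2 * \<bar>real_of_int n\<bar>)"
  shows "\<bar>c n * bump a (x + n - b * of_int m)\<bar> \<le> exp (a * \<bar>x - b * of_int m\<bar>) * exp (- (a / 2) * \<bar>real_of_int n\<bar>)"
proof -
  have "\<bar>c n * bump a (x + n - b * of_int m)\<bar>
      \<le> exp (a / 2 * \<bar>real_of_int n\<bar>) * (exp (a * \<bar>x - b * m\<bar>) * exp (- a * \<bar>real_of_int n\<bar>))"
    unfolding abs_mult abs_of_nonneg[OF bump_nonneg]
    by (intro mult_mono assms bump_translate_le) (auto simp: bump_nonneg)
  also have "\<dots> = exp (a * \<bar>x - b * of_int m\<bar>) * exp (- (a / 2) * \<bar>real_of_int n\<bar>)"
    by (simp add: mult_exp_exp algebra_simps) 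
  finally show ?thesis .
qed

lemma has_sum_sum:
  fixes f :: "'i \<Rightarrow> 'a \<Rightarrow> 'b::topological_comm_monoid_add"
  assumes "finite I" "\<And>i. i \<in> I \<Longrightarrow> (f i has_sum s i) A"
  shows "((\<lambda>x. \<Sum>i\<in>I. f i x) has_sum (\<Sum>i\<in>I. s i)) A"
  using assms by (induction I rule: finite_induct) (auto intro: has_sum_add)

text \<open>Reduction to \<open>exp_spline_vanishing\<close>. Write \<open>bump a s = \<Sum> al(l) exp(ls) + \<sigma>\<^sub>+(s)\<close>, where the sum is over
\<open>l = a, 2a, 3a\<close> and continues the formula for \<open>s \<le> 0\<close>, and \<open>\<sigma>\<^sub>+\<close> is the truncation to \<open>s \<ge> 0\<close> of the
difference \<open>\<sigma>\<close> of the two branches. On a window \<open>[-1, N + 1)\<close> all but the knots \<open>0, ..., N\<close> then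
contribute pure exponentials, so the infinite series becomes a finite exponential spline.\<close>

lemma bump_uniqueness:
  fixes c :: "int \<Rightarrow> real" and a b x :: real
  assumes a: "a > 0" and b: "0 < b" "b < 1 / 3"
    and c: "\<And>n. \<bar>c n\<bar> \<le> exp (a / 2 * \<bar>real_of_int n\<bar>)"
    and zero: "\<And>m::int. (bump_series a b c x m) = 0"
  shows "c 0 = 0"
proof -
  define P where "P = {a, 2 * a, 3 * a}"
  define L where "L = P \<union> uminus ` P"
  define al where "al = (\<lambda>l. if \<bar>l\<bar> = 2 * a then -2 else (1::real))"
  define w where "w = (\<lambda>l. if l > 0 then - al l else al l)"
  \<comment> \<open>Knots to the left of the window enter through the decaying branch, all others through the
    growing one, so the sign of \<open>l\<close> decides which \<open>n\<close> contribute to its coefficient.\<close>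
  define q where "q = (\<lambda>l n. if (l > 0) = (n \<ge> (0::int)) then c n * exp (- l * n) else 0)"
  define A where "A = (\<lambda>l. al l * (\<Sum>\<^sub>\<infinity>n. q l n))"
  define \<sigma> where "\<sigma> = (\<lambda>s. \<Sum>l\<in>L. w l * exp (l * s))"
  have P: "finite P" "\<And>l. l \<in> P \<Longrightarrow> l \<ge> a" using a by (auto simp: P_def)
  have sum_P: "(\<Sum>l\<in>P. f l) = f a + f (2 * a) + f (3 * a)" for f :: "real \<Rightarrow> real"
    using a by (simp add: P_def)
  have sum_nP: "(\<Sum>l\<in>uminus ` P. f l) = (\<Sum>l\<in>P. f (- l))" for f :: "real \<Rightarrow> real"
    by (subst sum.reindex) auto
  have disj: "P \<inter> uminus ` P = {}" using a by (auto simp: P_def)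
  have sum_L: "(\<Sum>l\<in>L. f l) = (\<Sum>l\<in>P. f l) + (\<Sum>l\<in>P. f (- l))" for f :: "real \<Rightarrow> real"
    unfolding L_def using P disj by (subst sum.union_disjoint) (auto simp: sum_nP)
  have L: "finite L" "card L = 6"
  proof -
    have "card P = 3" using a by (simp add: P_def)
    then show "finite L" "card L = 6"
      unfolding L_def using P disj by (auto simp: card_Un_disjoint card_image)
  qed
  have wm: "w (- l) = - w l" if "l \<in> P" for l
    using P(2)[OF that] a by (auto simp: w_def al_def)
  have al_a: "al a = 1" "al (2 * a) = -2" "al (3 * a) = 1" "al (- l) = al l" for l
    using a by (auto simp: al_def)
  have w_a: "w a = -1" "w (2 * a) = 2" "w (3 * a) = -1" using a al_a by (auto simp: w_def)
  have bump_pos: "bump a s = (\<Sum>l\<in>P. al l * exp (- l * s))" if "s \<ge> 0" for s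
  proof -
    have "exp (- (2 * a) * s) = exp (- a * s) ^ 2" "exp (- (3 * a) * s) = exp (- a * s) ^ 3"
      by (simp_all add: exp_of_nat_mult[symmetric])
    then show ?thesis unfolding bump_def sum_P al_a using that
      by (simp only: abs_of_nonneg) (simp add: power2_eq_square power3_eq_cube algebra_simps)
  qed
  have bump_neg: "bump a s = (\<Sum>l\<in>P. al l * exp (l * s))" if "s \<le> 0" for s
    using bump_pos[of "- s"] that by simp
  have \<sigma>: "\<sigma> s = (\<Sum>l\<in>P. al l * exp (- l * s)) - (\<Sum>l\<in>P. al l * exp (l * s))" for s
  proof -
    have "\<sigma> s = (\<Sum>l\<in>P. w l * exp (l * s)) + (\<Sum>l\<in>P. - w l * exp (- l * s))"
      unfolding \<sigma>_def sum_L using wm by simp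
    moreover have "w l = - al l" if "l \<in> P" for l
      using P(2)[OF that] a by (simp add: w_def)
    ultimately show ?thesis by (simp add: sum_negf)
  qed
  have \<sigma>0: "\<sigma> s \<noteq> 0" if "s < 0" for s
  proof -
    define y where "y = exp (a * s)"
    have y: "0 < y" "y < 1" using a that by (auto simp: y_def mult_pos_neg)
    have e: "exp (- a * s) = 1 / y" "exp (- (2 * a) * s) = (1 / y)^2" "exp (- (3 * a) * s) = (1 / y)^3"
       "exp (a * s) = y" "exp ((2 * a) * s) = y^2" "exp ((3 * a) * s) = y^3"
      by (simp_all add: y_def exp_minus[symmetric] exp_of_nat_mult[symmetric] inverse_eq_divide[symmetric])
    have "\<sigma> s = (1 / y - 2 * (1 / y)^2 + (1 / y)^3) - (y - 2 * y^2 + y^3)"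
      unfolding \<sigma> sum_P al_a e by simp
    also have "\<dots> = (1 - y)^2 * (1 - y^4) / y^3"
      using y by (simp add: divide_simps) (simp add: algebra_simps eval_nat_numeral)
    also have "\<dots> > 0"
    proof -
      have "y^4 < 1" using y by (simp add: power_less_one_iff)
      then show ?thesis using y by simp
    qed
    finally show ?thesis by simp
  qed
  have qP: "q l n = (if n \<ge> 0 then c n * exp (- l * n) else 0)"
      "q (- l) n = (if n \<ge> 0 then 0 else c n * exp (l * n))" if "l \<in> P" for l n
    using P(2)[OF that] a by (auto simp: q_def)
  have q_sum: "q l summable_on UNIV" if "l \<in> L" for l
  proof -
    have "\<bar>l\<bar> \<ge> a" using that P(2) a by (force simp: L_def)
    have "(\<lambda>n. norm (q l n)) summable_on UNIV"
    proof (rule Infinite_Sum.abs_summable_on_comparison_test'[OF summable_on_exp_neg_abs_int[of "a / 2"]])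
      fix n :: int
      show "norm (q l n) \<le> exp (- (a / 2) * \<bar>real_of_int n\<bar>)"
      proof (cases "(l > 0) = (n \<ge> 0)")
        case True
        then have "l * n = \<bar>l\<bar> * \<bar>real_of_int n\<bar>" by (auto simp: abs_if)
        moreover have "\<bar>l\<bar> * \<bar>real_of_int n\<bar> \<ge> a * \<bar>real_of_int n\<bar>"
          using \<open>\<bar>l\<bar> \<ge> a\<close> by (intro mult_right_mono) auto
        ultimately have "- l * n \<le> - a * \<bar>real_of_int n\<bar>" by simp
        then have "norm (q l n) \<le> exp (a / 2 * \<bar>real_of_int n\<bar>) * exp (- a * \<bar>real_of_int n\<bar>)"
          using True c[of n] by (auto simp: q_def abs_mult intro!: mult_mono)
        then show ?thesis by (simp add: mult_exp_exp algebra_simps)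
      qed (auto simp: q_def)
    qed (use a in auto)
    then show ?thesis by (rule abs_summable_summable)
  qed
  \<comment> \<open>The excess \<open>1 - 3b > 0\<close> per unit length has to pay for a fixed loss of zeros.\<close>
  obtain N :: nat where N: "(3 * real N + 6) * b \<le> real N + 1"
  proof -
    obtain N :: nat where N: "real N \<ge> 6 * b / (1 - 3 * b)" using real_arch_simple by blast
    then have "real N * (1 - 3 * b) \<ge> 6 * b" using b by (simp add: pos_divide_le_eq)
    then show thesis using that[of N] by (simp add: algebra_simps)
  qed
  have expand: "(\<Sum>\<^sub>\<infinity>n::int. c n * bump a (t - n))
      = (\<Sum>l\<in>L. A l * exp (l * t)) + (\<Sum>n\<le>N. c (int n) * (if t \<ge> n then \<sigma> (t - n) else 0))"
    if t: "-1 \<le> t" "t < real N + 1" for t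
  proof -
    define p where "p = (\<lambda>n::int. c n * (if n \<le> t then \<sigma> (t - n) else 0))"
    have 1: "((\<lambda>n. \<Sum>l\<in>L. al l * exp (l * t) * q l n) has_sum (\<Sum>l\<in>L. al l * exp (l * t) * (\<Sum>\<^sub>\<infinity>n. q l n))) UNIV"
      using L q_sum by (intro has_sum_sum has_sum_cmult_right has_sum_infsum) auto
    have "(p has_sum (\<Sum>n\<in>int ` {..N}. p n)) (int ` {..N})"
      by (rule has_sum_finite) auto
    then have 2: "((\<lambda>n. if n \<in> int ` {..N} then p n else 0) has_sum (\<Sum>n\<le>N. p (int n))) UNIV"
      by (subst (asm) has_sum_cong_neutral[where T = UNIV and g = "\<lambda>n. if n \<in> int ` {..N} then p n else 0"])
         (auto simp: sum.reindex)
    have eq: "c n * bump a (t - n) = (\<Sum>l\<in>L. al l * exp (l * t) * q l n) + (if n \<in> int ` {..N} then p n else 0)"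
      for n
    proof -
      have e: "exp (l * t) * exp (- l * n) = exp (l * (t - n))" for l
        by (simp add: mult_exp_exp algebra_simps)
      have range: "n \<in> int ` {..N} \<longleftrightarrow> 0 \<le> n \<and> n \<le> int N"
        by (auto simp: image_iff intro!: bexI[of _ "nat n"])
      show ?thesis
      proof (cases "n \<ge> 0")
        case True
        have "(\<Sum>l\<in>L. al l * exp (l * t) * q l n) = (\<Sum>l\<in>P. al l * exp (l * t) * (c n * exp (- l * n)))"
          unfolding sum_L using True by (simp add: qP cong: sum.cong)
        also have "\<dots> = c n * (\<Sum>l\<in>P. al l * exp (l * (t - n)))"
          unfolding sum_distrib_left e[symmetric] by (intro sum.cong) (auto simp: algebra_simps)
        finally have main: "(\<Sum>l\<in>L. al l * exp (l * t) * q l n) = c n * (\<Sum>l\<in>P. al l * exp (l * (t - n)))" .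
        show ?thesis
        proof (cases "n \<le> t")
          case True
          then have "n \<le> int N" using t by linarith
          then show ?thesis using True \<open>n \<ge> 0\<close> bump_pos[of "t - n"]
            unfolding main range p_def \<sigma> by (simp add: algebra_simps)
        next
          case False
          then show ?thesis using bump_neg[of "t - n"]
            unfolding main range p_def by simp
        qed
      next
        case False
        then have "t - n \<ge> 0" using t by linarith
        have "(\<Sum>l\<in>L. al l * exp (l * t) * q l n) = (\<Sum>l\<in>P. al l * exp (- l * t) * (c n * exp (l * n)))"
          unfolding sum_L using False by (simp add: qP al_a cong: sum.cong)
        also have "\<dots> = c n * (\<Sum>l\<in>P. al l * exp (- l * (t - n)))"
          unfolding sum_distrib_left e[symmetric] by (intro sum.cong) (auto simp: algebra_simps)
        finally show ?thesis using bump_pos[OF \<open>t - n \<ge> 0\<close>] False range by simp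
      qed
    qed
    show ?thesis
      unfolding eq infsumI[OF has_sum_add[OF 1 2]] unfolding p_def A_def
      by (intro arg_cong2[where f = "(+)"] sum.cong) (auto simp: algebra_simps)
  qed
  have zero': "(\<Sum>l\<in>L. A l * exp (l * (- x + b * k))) +
         (\<Sum>n\<le>N. c (int n) * (if real n \<le> - x + b * k then \<sigma> (- x + b * k - real n) else 0)) = 0"
    if k: "- 1 \<le> - x + b * k" "- x + b * k < real N + 1" for k :: int
  proof -
    have "x + real_of_int n - b * k = - (- x + b * k - n)" for n by simp
    then have "(\<Sum>\<^sub>\<infinity>n::int. c n * bump a (- x + b * k - n)) = 0"
      using zero[of k] by (simp only: bump_minus)
    then show ?thesis using expand[OF k] by simp
  qed
  have ws: "(\<Sum>l\<in>L. w l) = 0" "(\<Sum>l\<in>L. w l * l) = 0" "(\<Sum>l\<in>L. w l * l\<^sup>2) = 0"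
    using wm w_a by (simp_all add: sum_L sum_P)
  have "c (int 0) = 0"
    by (rule exp_spline_vanishing[OF L ws, of b N "- x" A "\<lambda>n. c (int n)"])
       (use \<sigma>0[unfolded \<sigma>_def] b N zero'[unfolded \<sigma>_def] in simp_all)
  then show ?thesis by simp
qed

section \<open>Stability of the sampling problem\<close>

text \<open>If no \<open>K\<close> and \<open>\<kappa>\<close> worked, a limit point of counterexamples in the compact set
of pairs \<open>(x, c)\<close> would contradict \<open>bump_uniqueness\<close>. Finitely many samples suffice because each
sample is continuous on that set.\<close>

lemma bump_local_lower_bound:
  fixes a b :: real
  assumes a: "a > 0" and b: "0 < b" "b < 1 / 3"
  shows "\<exists>(K::nat) \<kappa>. \<kappa> > 0 \<and> (\<forall>x c. 0 \<le> x \<longrightarrow> x \<le> b \<longrightarrow> c 0 = 1 \<longrightarrow> (\<forall>n. \<bar>c n\<bar> \<le> exp (a / 2 * \<bar>real_of_int n\<bar>)) \<longrightarrow>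
       (\<exists>m::int. \<bar>m\<bar> \<le> int K \<and> \<kappa> \<le> \<bar>bump_series a b c x m\<bar>))"
proof -
  define Phi where "Phi = (\<lambda>(m::int) (p :: real \<times> (int \<Rightarrow> real)). \<Sum>\<^sub>\<infinity>n::int. snd p n * bump a (fst p + n - b * m))"
  define T where "T = (\<lambda>n::int. if n = 0 then {1} else {- exp (a / 2 * \<bar>real_of_int n\<bar>) .. exp (a / 2 * \<bar>real_of_int n\<bar>)})"
  define S where "S = {0..b} \<times> (PiE UNIV T)"
  have "compact (PiE UNIV T)"
  proof -
    have "compactin (product_topology (\<lambda>i. euclidean) UNIV) (PiE UNIV T)"
      unfolding compactin_PiE by (auto simp: T_def)
    then show ?thesis by (simp add: euclidean_product_topology)
  qed
  then have "compact S" unfolding S_def by (intro compact_Times) auto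
  have mem: "(x, c) \<in> S \<longleftrightarrow> 0 \<le> x \<and> x \<le> b \<and> c 0 = 1 \<and> (\<forall>n. \<bar>c n\<bar> \<le> exp (a / 2 * \<bar>real_of_int n\<bar>))" for x c
  proof -
    have "c \<in> PiE UNIV T \<longleftrightarrow> c 0 = 1 \<and> (\<forall>n. \<bar>c n\<bar> \<le> exp (a / 2 * \<bar>real_of_int n\<bar>))"
    proof -
      have "c n \<in> T n \<longleftrightarrow> (n = 0 \<longrightarrow> c n = 1) \<and> \<bar>c n\<bar> \<le> exp (a / 2 * \<bar>real_of_int n\<bar>)" for n
        by (cases "n = 0") (auto simp: T_def)
      then show ?thesis unfolding PiE_UNIV_domain Pi_iff by auto
    qed
    then show ?thesis by (auto simp: S_def)
  qed
  have cont: "continuous_on S (Phi m)" for m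
  proof -
    have "uniform_limit S (\<lambda>X p. \<Sum>n\<in>X. snd p n * bump a (fst p + n - b * m)) (Phi m) (finite_subsets_at_top UNIV)"
      unfolding Phi_def
    proof (rule Weierstrass_m_test_general)
      show "(\<lambda>n. exp (a * (b + b * \<bar>m\<bar>)) * exp (- (a / 2) * \<bar>real_of_int n\<bar>)) summable_on UNIV"
        using a by (intro summable_on_cmult_right summable_on_exp_neg_abs_int) auto
      fix n p assume p: "p \<in> S"
      obtain x c where p': "p = (x, c)" by (cases p)
      with p mem have x: "0 \<le> x" "x \<le> b" and c: "\<bar>c n\<bar> \<le> exp (a / 2 * \<bar>real_of_int n\<bar>)" by auto
      have "\<bar>x - b * m\<bar> \<le> \<bar>x\<bar> + \<bar>b * m\<bar>" by (rule abs_triangle_ineq4)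
      also have "\<dots> \<le> b + b * \<bar>m\<bar>" using x b by (simp add: abs_mult)
      finally have "a * \<bar>x - b * m\<bar> \<le> a * (b + b * \<bar>m\<bar>)"
        using a by (intro mult_left_mono) auto
      then have "exp (a * \<bar>x - b * m\<bar>) * exp (- (a / 2) * \<bar>real_of_int n\<bar>)
          \<le> exp (a * (b + b * \<bar>m\<bar>)) * exp (- (a / 2) * \<bar>real_of_int n\<bar>)"
        by (intro mult_right_mono) auto
      with exp_weight_bound[of a c n x b m, OF a c]
      show "norm (snd p n * bump a (fst p + n - b * m)) \<le> exp (a * (b + b * \<bar>m\<bar>)) * exp (- (a / 2) * \<bar>real_of_int n\<bar>)"
        unfolding p' fst_conv snd_conv real_norm_def by (rule order_trans)
    qed
    then have ul: "uniform_limit S (\<lambda>X p. \<Sum>n\<in>X. snd p n * bump a (fst p + n - b * m)) (Phi m) (finite_subsets_at_top UNIV)" .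
    have "continuous_on S (\<lambda>p. snd p n)" for n :: int
      by (rule continuous_on_subset[OF continuous_on_product_then_coordinatewise[OF continuous_on_snd[OF continuous_on_id]]]) auto
    then have "continuous_on S (\<lambda>p. \<Sum>n\<in>X. snd p n * bump a (fst p + n - b * m))" for X
      by (intro continuous_intros)
    then show ?thesis
      by (intro uniform_limit_theorem[OF _ ul] always_eventually allI) auto
  qed
  have "\<exists>K::nat. \<forall>p\<in>S. \<exists>m::int. \<bar>m\<bar> \<le> int K \<and> 1 / real (Suc K) \<le> \<bar>Phi m p\<bar>"
  proof (rule ccontr)
    assume "\<not> ?thesis"
    then have "\<forall>K::nat. \<exists>p. p \<in> S \<and> (\<forall>m::int. \<bar>m\<bar> \<le> int K \<longrightarrow> \<bar>Phi m p\<bar> < 1 / real (Suc K))"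
      by (meson not_le)
    then obtain p where p: "\<And>K. p K \<in> S" "\<And>K m. \<bar>m\<bar> \<le> int K \<Longrightarrow> \<bar>Phi m (p K)\<bar> < 1 / real (Suc K)"
      by metis
    have "seq_compact S" using \<open>compact S\<close> by (rule compact_imp_seq_compact)
    then have "\<exists>l\<in>S. \<exists>r. strict_mono r \<and> (p \<circ> r) \<longlonglongrightarrow> l"
      unfolding seq_compact_def using p(1) by simp
    then obtain l r where l: "l \<in> S" "strict_mono r" "(p \<circ> r) \<longlonglongrightarrow> l" by blast
    have "Phi m l = 0" for m
    proof -
      have "(\<lambda>i. Phi m ((p \<circ> r) i)) \<longlonglongrightarrow> Phi m l"
        by (rule continuous_on_tendsto_compose[OF cont l(3) l(1)]) (simp add: p(1))
      moreover have "(\<lambda>i. Phi m ((p \<circ> r) i)) \<longlonglongrightarrow> 0"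
      proof (rule Lim_null_comparison[OF _ LIMSEQ_inverse_real_of_nat])
        show "\<forall>\<^sub>F i in sequentially. norm (Phi m ((p \<circ> r) i)) \<le> inverse (real (Suc i))"
        proof (rule eventually_sequentiallyI[of "nat \<bar>m\<bar>"])
          fix i assume "nat \<bar>m\<bar> \<le> i"
          moreover have "i \<le> r i" using l(2) by (rule seq_suble)
          ultimately have "\<bar>Phi m (p (r i))\<bar> < 1 / real (Suc (r i))" by (intro p(2)) auto
          also have "\<dots> \<le> 1 / real (Suc i)" using \<open>i \<le> r i\<close> by (intro divide_left_mono) auto
          finally show "norm (Phi m ((p \<circ> r) i)) \<le> inverse (real (Suc i))" by (simp add: inverse_eq_divide)
        qed
      qed
      ultimately show ?thesis by (rule LIMSEQ_unique)
    qed
    then have zero: "(\<Sum>\<^sub>\<infinity>n::int. snd l n * bump a (fst l + n - b * m)) = 0" for m :: int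
      by (simp add: Phi_def)
    have l': "snd l 0 = 1" "\<And>n. \<bar>snd l n\<bar> \<le> exp (a / 2 * \<bar>real_of_int n\<bar>)"
      using l(1) mem[of "fst l" "snd l"] by simp_all
    have "snd l 0 = 0" by (rule bump_uniqueness[OF a b l'(2) zero])
    then show False using l'(1) by simp
  qed
  then obtain K :: nat where K: "\<forall>p\<in>S. \<exists>m::int. \<bar>m\<bar> \<le> int K \<and> 1 / real (Suc K) \<le> \<bar>Phi m p\<bar>" by blast
  show ?thesis
  proof (intro exI[of _ K] exI[of _ "1 / real (Suc K)"] conjI allI impI)
    fix x and c :: "int \<Rightarrow> real"
    assume "0 \<le> x" "x \<le> b" "c 0 = 1" "\<forall>n. \<bar>c n\<bar> \<le> exp (a / 2 * \<bar>real_of_int n\<bar>)"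
    then have "(x, c) \<in> S" using mem by blast
    with K have "\<exists>m::int. \<bar>m\<bar> \<le> int K \<and> 1 / real (Suc K) \<le> \<bar>Phi m (x, c)\<bar>" by blast
    then show "\<exists>m::int. \<bar>m\<bar> \<le> int K \<and> 1 / real (Suc K) \<le> \<bar>bump_series a b c x m\<bar>"
      by (simp only: Phi_def split_beta fst_conv snd_conv)
  qed simp
qed

lemma nn_integral_count_space_inj_le:
  fixes f :: "'b \<Rightarrow> ennreal"
  assumes "inj_on g A"
  shows "(\<integral>\<^sup>+x. f (g x) \<partial>count_space A) \<le> (\<Sum>\<^sup>+y. f y)"
proof -
  have "(\<integral>\<^sup>+x. f (g x) \<partial>count_space A) = (\<integral>\<^sup>+y. f y \<partial>count_space (g ` A))"
    using assms by (intro nn_integral_bij_count_space) (simp add: bij_betw_def)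
  also have "\<dots> = (\<Sum>\<^sup>+y. f y * indicator (g ` A) y)"
    by (rule nn_integral_count_space_indicator) auto
  also have "\<dots> \<le> (\<Sum>\<^sup>+y. f y)"
    by (intro nn_integral_mono) (auto split: split_indicator)
  finally show ?thesis .
qed

lemma nn_integral_count_space_infsum:
  fixes f :: "'a \<Rightarrow> real"
  assumes "f summable_on UNIV" "\<And>x. f x \<ge> 0"
  shows "(\<Sum>\<^sup>+x. ennreal (f x)) = ennreal (\<Sum>\<^sub>\<infinity>x. f x)"
proof -
  have s: "Infinite_Set_Sum.abs_summable_on f UNIV"
    using assms by (simp flip: abs_summable_equivalent)
  then have "integrable (count_space UNIV) f" by (simp add: Infinite_Set_Sum.abs_summable_on_def)
  then show ?thesis
    using assms(2) infsetsum_infsum[OF s]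
    by (simp add: nn_integral_eq_integral infsetsum_def)
qed

text \<open>Only finitely many weighted entries of a bounded sequence exceed a given positive one, so the
maximum is attained.\<close>

lemma exists_weighted_peak:
  fixes c :: "int \<Rightarrow> real"
  assumes \<delta>: "\<delta> > 0" and bdd: "\<And>n. \<bar>c n\<bar> \<le> M"
  obtains p where "\<And>m. \<bar>c m\<bar> * exp (- \<delta> * \<bar>real_of_int (m - n)\<bar>) \<le> \<bar>c p\<bar> * exp (- \<delta> * \<bar>real_of_int (p - n)\<bar>)"
proof (cases "c n = 0 \<and> (\<forall>m. c m = 0)")
  case True
  then show ?thesis using that[of n] by simp
next
  case False
  define h where "h = (\<lambda>m. \<bar>c m\<bar> * exp (- \<delta> * \<bar>real_of_int (m - n)\<bar>))"
  obtain m0 where m0: "c m0 \<noteq> 0" using False by auto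
  then have h0: "h m0 > 0" by (simp add: h_def)
  define F where "F = {m. h m0 \<le> h m}"
  have "finite F"
  proof (rule finite_subset)
    have "M > 0" using bdd[of m0] m0 by linarith
    define R where "R = ln (M / h m0) / \<delta>"
    show "F \<subseteq> {n - \<lceil>R\<rceil>..n + \<lceil>R\<rceil>}"
    proof
      fix m assume "m \<in> F"
      then have "h m0 \<le> h m" by (simp add: F_def)
      also have "h m \<le> M * exp (- \<delta> * \<bar>real_of_int (m - n)\<bar>)"
        unfolding h_def using bdd by (intro mult_right_mono) auto
      finally have "exp (\<delta> * \<bar>real_of_int (m - n)\<bar>) \<le> M / h m0"
        using h0 by (simp add: field_simps exp_minus)
      then have "\<delta> * \<bar>real_of_int (m - n)\<bar> \<le> ln (M / h m0)"
        using \<open>M > 0\<close> h0 by (subst ln_ge_iff) auto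
      then have "\<bar>real_of_int (m - n)\<bar> \<le> R" using \<delta> by (simp add: R_def field_simps)
      then show "m \<in> {n - \<lceil>R\<rceil>..n + \<lceil>R\<rceil>}" by simp linarith
    qed
  qed auto
  have m0F: "m0 \<in> F" by (simp add: F_def)
  have "Max (h ` F) \<in> h ` F" using \<open>finite F\<close> m0F by (intro Max_in) auto
  then obtain p where p: "p \<in> F" "h p = Max (h ` F)" by auto
  have hp: "h m \<le> h p" if "m \<in> F" for m
    unfolding p(2) using \<open>finite F\<close> that by (intro Max_ge) auto
  have "h m \<le> h p" for m
    using hp[of m] p(1) by (cases "m \<in> F") (auto simp: F_def)
  then show ?thesis using that[of p] by (simp add: h_def)
qed

text \<open>A weighted maximum seen from \<open>n\<close> dominates as seen from itself, by the triangle inequality in the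
exponent. This makes the local inequality applicable at \<open>p\<close>.\<close>

lemma weighted_peak_dominates:
  fixes c :: "int \<Rightarrow> real"
  assumes \<delta>: "\<delta> > 0"
    and p: "\<And>m. \<bar>c m\<bar> * exp (- \<delta> * \<bar>real_of_int (m - n)\<bar>) \<le> \<bar>c p\<bar> * exp (- \<delta> * \<bar>real_of_int (p - n)\<bar>)"
  shows "\<bar>c m\<bar> \<le> \<bar>c p\<bar> * exp (\<delta> * \<bar>real_of_int (m - p)\<bar>)"
proof -
  have "\<bar>c m\<bar> = (\<bar>c m\<bar> * exp (- \<delta> * \<bar>real_of_int (m - n)\<bar>)) * exp (\<delta> * \<bar>real_of_int (m - n)\<bar>)"
    by (simp add: mult_exp_exp)
  also have "\<dots> \<le> (\<bar>c p\<bar> * exp (- \<delta> * \<bar>real_of_int (p - n)\<bar>)) * exp (\<delta> * \<bar>real_of_int (m - n)\<bar>)"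
    by (intro mult_right_mono p) auto
  also have "\<dots> = \<bar>c p\<bar> * exp (\<delta> * (\<bar>real_of_int (m - n)\<bar> - \<bar>real_of_int (p - n)\<bar>))"
    by (simp add: mult_exp_exp algebra_simps)
  also have "\<dots> \<le> \<bar>c p\<bar> * exp (\<delta> * \<bar>real_of_int (m - p)\<bar>)"
    using \<delta> by (intro mult_left_mono iffD2[OF exp_le_cancel_iff]) auto
  finally show ?thesis .
qed

text \<open>At a dominant index \<open>n\<close> the local inequality, applied to the sequence translated by \<open>n\<close> and divided by
\<open>c\<^sub>n\<close>, bounds \<open>\<bar>c\<^sub>n\<bar>\<close> by one of the \<open>2K + 1\<close> samples around \<open>f n = \<lfloor>(x + n)/b\<rfloor>\<close>. Since \<open>b < 1\<close>, the map
\<open>f\<close> is injective and every sample is used at most \<open>2K + 1\<close> times. The other entries are bounded by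
their weighted peaks, and the sum of the weights is a finite constant \<open>S\<close>.\<close>

lemma bump_lower_bound:
  fixes a b :: real
  assumes a: "a > 0" and b: "0 < b" "b < 1 / 3"
  shows "\<exists>A>0. \<forall>(x::real) (c :: int \<Rightarrow> real) M. (\<forall>n. \<bar>c n\<bar> \<le> M) \<longrightarrow>
       ennreal A * square_sum c
         \<le> (\<Sum>\<^sup>+m. ennreal ((bump_series a b c x m)\<^sup>2))"
proof -
  obtain K :: nat and \<kappa> :: real where \<kappa>: "\<kappa> > 0" and local:
    "\<forall>x c. 0 \<le> x \<longrightarrow> x \<le> b \<longrightarrow> c 0 = 1 \<longrightarrow> (\<forall>n. \<bar>c n\<bar> \<le> exp (a / 2 * \<bar>real_of_int n\<bar>)) \<longrightarrow>
       (\<exists>m::int. \<bar>m\<bar> \<le> int K \<and> \<kappa> \<le> \<bar>bump_series a b c x m\<bar>)"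
    using bump_local_lower_bound[OF a b] by blast
  define S where "S = (\<Sum>\<^sub>\<infinity>n::int. exp (- a * \<bar>real_of_int n\<bar>))"
  have S_sum: "(\<lambda>n::int. exp (- a * \<bar>real_of_int n\<bar>)) summable_on UNIV"
    using a by (rule summable_on_exp_neg_abs_int)
  have "S > 0"
  proof -
    have "exp (- a * \<bar>real_of_int 0\<bar>) \<le> S"
      unfolding S_def using infsum_mono_neutral[of "\<lambda>n. exp (- a * \<bar>real_of_int n\<bar>)" "{0}" "\<lambda>n. exp (- a * \<bar>real_of_int n\<bar>)" UNIV]
         S_sum by simp
    then show ?thesis by simp
  qed
  define D where "D = S * real (2 * K + 1) / \<kappa>\<^sup>2"
  have D: "D > 0" using \<open>S > 0\<close> \<kappa> by (simp add: D_def)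
  have main: "square_sum c
      \<le> ennreal D * (\<Sum>\<^sup>+m. ennreal ((bump_series a b c x m)\<^sup>2))"
    (is "?c \<le> _ * ?Phi")
    if bdd: "\<And>n. \<bar>c n\<bar> \<le> M" for c :: "int \<Rightarrow> real" and x M :: real
  proof -
    define \<Phi> where "\<Phi> = (\<lambda>m::int. \<Sum>\<^sub>\<infinity>n::int. c n * bump a (x + n - b * m))"
    define dom where "dom = {n. \<forall>m. \<bar>c m\<bar> \<le> \<bar>c n\<bar> * exp (a / 2 * \<bar>real_of_int (m - n)\<bar>)}"
    define f where "f = (\<lambda>n. \<lfloor>(x + real_of_int n) / b\<rfloor>)"
    have f_inj: "inj f"
    proof (rule linorder_injI)
      fix n m :: int assume "n < m"
      then have "(x + real_of_int n) / b + 1 \<le> (x + real_of_int m) / b"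
      proof -
        have "real_of_int n + 1 \<le> real_of_int m" using \<open>n < m\<close> by linarith
        then have "(x + n + b) / b \<le> (x + m) / b" using b by (intro divide_right_mono) linarith+
        then show ?thesis using b by (simp add: add_divide_distrib)
      qed
      then show "f n \<noteq> f m" unfolding f_def by linarith
    qed
    have dom_le: "\<exists>j\<in>{- int K..int K}. \<kappa>\<^sup>2 * (c n)\<^sup>2 \<le> (\<Phi> (f n + j))\<^sup>2" if n: "n \<in> dom" for n
    proof (cases "c n = 0")
      case True
      then show ?thesis by (intro bexI[of _ 0]) auto
    next
      case False
      define y where "y = x + n - b * f n"
      have "real_of_int (f n) \<le> (x + n) / b" "(x + n) / b < f n + 1" unfolding f_def by linarith+
      then have y: "0 \<le> y" "y \<le> b" using b by (simp_all add: y_def field_simps)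
      have "\<bar>c (n + m) / c n\<bar> \<le> exp (a / 2 * \<bar>real_of_int m\<bar>)" for m
      proof -
        have "\<bar>c (n + m)\<bar> \<le> \<bar>c n\<bar> * exp (a / 2 * \<bar>real_of_int ((n + m) - n)\<bar>)"
          using n unfolding dom_def by blast
        then show ?thesis using False by (simp add: abs_divide pos_divide_le_eq mult.commute)
      qed
      then obtain m where m: "\<bar>m\<bar> \<le> int K"
          "\<kappa> \<le> \<bar>\<Sum>\<^sub>\<infinity>j::int. c (n + j) / c n * bump a (y + j - b * m)\<bar>"
        using local[rule_format, of y "\<lambda>j. c (n + j) / c n"] y False by auto
      have "(\<Sum>\<^sub>\<infinity>j::int. c (n + j) / c n * bump a (y + j - b * m))
          = (\<Sum>\<^sub>\<infinity>j::int. (1 / c n) * (c (n + j) * bump a (x + (n + j) - b * (f n + m))))"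
        by (intro infsum_cong) (simp add: y_def algebra_simps)
      also have "\<dots> = (1 / c n) * (\<Sum>\<^sub>\<infinity>j::int. c (n + j) * bump a (x + (n + j) - b * (f n + m)))"
        by (rule infsum_cmult_right')
      also have "(\<Sum>\<^sub>\<infinity>j::int. c (n + j) * bump a (x + (n + j) - b * (f n + m))) = \<Phi> (f n + m)"
        unfolding \<Phi>_def
        by (subst infsum_reindex_bij_betw[where g = "\<lambda>j. n + j" and A = UNIV and B = UNIV, symmetric])
           (auto intro!: bij_betw_byWitness[where f' = "\<lambda>j. j - n"])
      finally have "\<kappa> \<le> \<bar>1 / c n * \<Phi> (f n + m)\<bar>" using m(2) by simp
      also have "\<dots> = \<bar>\<Phi> (f n + m)\<bar> / \<bar>c n\<bar>" by (simp add: abs_mult)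
      finally have "\<kappa> * \<bar>c n\<bar> \<le> \<bar>\<Phi> (f n + m)\<bar>" using False by (simp add: pos_le_divide_eq)
      then have "(\<kappa> * \<bar>c n\<bar>)\<^sup>2 \<le> \<bar>\<Phi> (f n + m)\<bar>\<^sup>2" using \<kappa> by (intro power_mono) auto
      then show ?thesis using m(1) by (intro bexI[of _ m]) (auto simp: power_mult_distrib)
    qed
    let ?dom = "\<Sum>\<^sup>+n. ennreal ((c n)\<^sup>2) * indicator dom n"
    have "?dom
        \<le> (\<Sum>\<^sup>+n. (\<Sum>j\<in>{- int K..int K}. ennreal (1 / \<kappa>\<^sup>2) * ennreal ((\<Phi> (f n + j))\<^sup>2)))"
    proof (rule nn_integral_mono)
      fix n :: int
      show "ennreal ((c n)\<^sup>2) * indicator dom n \<le> (\<Sum>j\<in>{- int K..int K}. ennreal (1 / \<kappa>\<^sup>2) * ennreal ((\<Phi> (f n + j))\<^sup>2))"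
      proof (cases "n \<in> dom")
        case True
        from dom_le[OF True] obtain j where j: "j \<in> {- int K..int K}" "\<kappa>\<^sup>2 * (c n)\<^sup>2 \<le> (\<Phi> (f n + j))\<^sup>2" by auto
        have "ennreal ((c n)\<^sup>2) \<le> ennreal (1 / \<kappa>\<^sup>2) * ennreal ((\<Phi> (f n + j))\<^sup>2)"
          using j(2) \<kappa> by (simp add: ennreal_mult'[symmetric] field_simps)
        also have "\<dots> \<le> (\<Sum>j\<in>{- int K..int K}. ennreal (1 / \<kappa>\<^sup>2) * ennreal ((\<Phi> (f n + j))\<^sup>2))"
          by (rule member_le_sum[OF j(1)]) auto
        finally show ?thesis using True by simp
      qed auto
    qed
    also have "\<dots> = (\<Sum>j\<in>{- int K..int K}. ennreal (1 / \<kappa>\<^sup>2) * (\<Sum>\<^sup>+n. ennreal ((\<Phi> (f n + j))\<^sup>2)))"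
      by (simp add: nn_integral_sum nn_integral_cmult)
    also have "\<dots> \<le> (\<Sum>j\<in>{- int K..int K}. ennreal (1 / \<kappa>\<^sup>2) * (\<Sum>\<^sup>+n. ennreal ((\<Phi> n)\<^sup>2)))"
    proof (intro sum_mono mult_left_mono)
      fix j
      show "(\<Sum>\<^sup>+n. ennreal ((\<Phi> (f n + j))\<^sup>2)) \<le> (\<Sum>\<^sup>+n. ennreal ((\<Phi> n)\<^sup>2))"
        using f_inj by (intro nn_integral_count_space_inj_le[where g = "\<lambda>n. f n + j" and f = "\<lambda>n. ennreal ((\<Phi> n)\<^sup>2)"])
          (auto simp: inj_on_def)
    qed auto
    also have "\<dots> = ennreal (real (2 * K + 1) / \<kappa>\<^sup>2) * (\<Sum>\<^sup>+n. ennreal ((\<Phi> n)\<^sup>2))"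
    proof -
      have "card {- int K..int K} = 2 * K + 1" by simp
      moreover have "of_nat (2 * K + 1) * ennreal (1 / \<kappa>\<^sup>2) = ennreal (real (2 * K + 1) / \<kappa>\<^sup>2)"
        by (simp only: ennreal_of_nat_eq_real_of_nat ennreal_mult'[symmetric] of_nat_0_le_iff) simp
      ultimately show ?thesis by (simp only: sum_constant mult.assoc[symmetric])
    qed
    finally have dom_sum: "?dom
        \<le> ennreal (real (2 * K + 1) / \<kappa>\<^sup>2) * ?Phi" unfolding \<Phi>_def .
    have "?c \<le> (\<Sum>\<^sup>+n. (\<Sum>\<^sup>+p. ennreal ((c p)\<^sup>2) * indicator dom p * ennreal (exp (- a * \<bar>real_of_int (p - n)\<bar>))))"
    proof (rule nn_integral_mono)
      fix n :: int
      obtain p where p: "\<And>m. \<bar>c m\<bar> * exp (- (a / 2) * \<bar>real_of_int (m - n)\<bar>) \<le> \<bar>c p\<bar> * exp (- (a / 2) * \<bar>real_of_int (p - n)\<bar>)"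
        using exists_weighted_peak[of "a / 2" c M n] a bdd by auto
      have "p \<in> dom" unfolding dom_def using weighted_peak_dominates[of "a / 2" c n p] p a by auto
      have "\<bar>c n\<bar> \<le> \<bar>c p\<bar> * exp (- (a / 2) * \<bar>real_of_int (p - n)\<bar>)" using p[of n] by simp
      then have "\<bar>c n\<bar>\<^sup>2 \<le> (\<bar>c p\<bar> * exp (- (a / 2) * \<bar>real_of_int (p - n)\<bar>))\<^sup>2" by (intro power_mono) auto
      also have "\<dots> = (c p)\<^sup>2 * exp (- a * \<bar>real_of_int (p - n)\<bar>)"
        by (simp add: power_mult_distrib exp_of_nat_mult[symmetric])
      finally have "ennreal ((c n)\<^sup>2) \<le> ennreal ((c p)\<^sup>2) * indicator dom p * ennreal (exp (- a * \<bar>real_of_int (p - n)\<bar>))"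
        using \<open>p \<in> dom\<close> by (simp add: ennreal_mult'[symmetric])
      also have "\<dots> \<le> (\<Sum>\<^sup>+p. ennreal ((c p)\<^sup>2) * indicator dom p * ennreal (exp (- a * \<bar>real_of_int (p - n)\<bar>)))"
        by (rule nn_integral_ge_point) auto
      finally show "ennreal ((c n)\<^sup>2) \<le> \<dots>" .
    qed
    also have "\<dots> = (\<Sum>\<^sup>+p. (\<Sum>\<^sup>+n. ennreal ((c p)\<^sup>2) * indicator dom p * ennreal (exp (- a * \<bar>real_of_int (p - n)\<bar>))))"
      by (rule nn_integral_count_space_nn_integral) auto
    also have "\<dots> = (\<Sum>\<^sup>+p. ennreal ((c p)\<^sup>2) * indicator dom p * ennreal S)"
    proof (rule nn_integral_cong)
      fix p :: int
      have "(\<Sum>\<^sup>+n. ennreal (exp (- a * \<bar>real_of_int (p - n)\<bar>)))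
          = (\<integral>\<^sup>+n. ennreal (exp (- a * \<bar>real_of_int n\<bar>)) \<partial>count_space (UNIV :: int set))"
        by (rule nn_integral_bij_count_space) (rule bij_betw_byWitness[where f' = "\<lambda>n. p - n"], auto)
      also have "\<dots> = ennreal S" unfolding S_def using S_sum by (intro nn_integral_count_space_infsum) auto
      finally show "(\<Sum>\<^sup>+n. ennreal ((c p)\<^sup>2) * indicator dom p * ennreal (exp (- a * \<bar>real_of_int (p - n)\<bar>)))
           = ennreal ((c p)\<^sup>2) * indicator dom p * ennreal S"
        by (simp add: nn_integral_cmult)
    qed
    also have "\<dots> = ennreal S * (\<Sum>\<^sup>+p. ennreal ((c p)\<^sup>2) * indicator dom p)"
      unfolding mult.commute[of "ennreal S"] by (rule nn_integral_multc) auto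
    also have "\<dots> \<le> ennreal S * (ennreal (real (2 * K + 1) / \<kappa>\<^sup>2) * ?Phi)"
      by (intro mult_left_mono dom_sum) auto
    also have "\<dots> = ennreal D * ?Phi"
    proof -
      have "ennreal S * ennreal (real (2 * K + 1) / \<kappa>\<^sup>2) = ennreal D"
        using \<open>S > 0\<close> unfolding D_def by (subst ennreal_mult'[symmetric]) auto
      then show ?thesis by (simp only: mult.assoc[symmetric])
    qed
    finally show ?thesis .
  qed
  have inv: "ennreal (1 / D) * ennreal D = 1"
    using D by (subst ennreal_mult'[symmetric]) auto
  show ?thesis
  proof (intro exI[of _ "1 / D"] conjI allI impI)
    fix x M :: real and c :: "int \<Rightarrow> real" assume "\<forall>n. \<bar>c n\<bar> \<le> M"
    then have "ennreal (1 / D) * square_sum c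
      \<le> ennreal (1 / D) * (ennreal D * (\<Sum>\<^sup>+m. ennreal ((bump_series a b c x m)\<^sup>2)))"
      by (intro mult_left_mono main[of c M]) auto
    then show "ennreal (1 / D) * square_sum c
      \<le> (\<Sum>\<^sup>+m. ennreal ((bump_series a b c x m)\<^sup>2))"
      by (simp only: mult.assoc[symmetric] inv mult_1)
  qed (use D in simp)
qed

lemma bump_bounded_summable:
  fixes c :: "int \<Rightarrow> complex" and x b :: real and m :: int
  assumes a: "a > 0" and c: "\<And>n. cmod (c n) \<le> M"
  shows "(\<lambda>n. cmod (c n) * bump a (x + n - b * m)) summable_on UNIV"
proof (rule summable_on_comparison_test)
  have "M \<ge> 0" using order_trans[OF norm_ge_zero c] .
  show "(\<lambda>n::int. M * exp (- a * \<bar>(b * m - x) - n\<bar>)) summable_on UNIV"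
    by (intro summable_on_cmult_right summable_on_exp_neg_dist_int a)
  show "cmod (c n) * bump a (x + n - b * m) \<le> M * exp (- a * \<bar>(b * m - x) - n\<bar>)" for n
  proof (rule mult_mono[OF c])
    have "\<bar>x + n - b * m\<bar> = \<bar>(b * m - x) - n\<bar>" by simp
    then show "bump a (x + n - b * m) \<le> exp (- a * \<bar>(b * m - x) - n\<bar>)"
      using bump_le[OF a, of "x + n - b * m"] by simp
  qed (use \<open>M \<ge> 0\<close> in \<open>auto simp: bump_nonneg\<close>)
qed (auto simp: bump_nonneg)

lemma bump_summable_complex:
  fixes c :: "int \<Rightarrow> complex" and x b :: real and m :: int
  assumes a: "a > 0" and c: "\<And>n. cmod (c n) \<le> M"
  shows "(\<lambda>n. c n * of_real (bump a (x + n - b * m))) summable_on UNIV"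
proof (rule abs_summable_summable)
  show "(\<lambda>n. cmod (c n * of_real (bump a (x + n - b * m)))) summable_on UNIV"
    using bump_bounded_summable[of a c M x b m, OF assms] by (simp add: norm_mult bump_nonneg)
qed

text \<open>Schur's test: the rows and the columns of the nonnegative matrix have uniformly bounded sums.\<close>

lemma bump_upper_bound:
  fixes a b :: real
  assumes a: "a > 0" and b: "0 < b"
  shows "\<exists>B>0. \<forall>(x::real) (c :: int \<Rightarrow> complex) M. (\<forall>n. cmod (c n) \<le> M) \<longrightarrow>
     (\<Sum>\<^sup>+m. ennreal ((cmod (cbump_series a b c x m))\<^sup>2))
       \<le> ennreal B * csquare_sum c"
proof -
  define C where "C = (\<lambda>r. exp r * (\<Sum>\<^sub>\<infinity>n::int. exp (- r * \<bar>real_of_int n\<bar>)))"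
  have C0: "C r \<ge> 0" for r unfolding C_def by (intro mult_nonneg_nonneg infsum_nonneg) auto
  have bump_int: "(\<Sum>\<^sup>+n. ennreal (exp (- r * \<bar>t - of_int n\<bar>))) \<le> ennreal (C r)"
    if "r > 0" for r t :: real
    using infsum_exp_neg_dist_int_le[OF that, of t] summable_on_exp_neg_dist_int[OF that, of t]
    by (subst nn_integral_count_space_infsum) (auto simp: C_def ennreal_leI)
  have row: "(\<Sum>\<^sup>+n. ennreal (bump a (x + of_int n - b * of_int m))) \<le> ennreal (C a)" for x :: real and m :: int
  proof (rule order_trans[OF nn_integral_mono bump_int[OF a, of "b * of_int m - x"]])
    fix n :: int
    have "\<bar>x + n - b * of_int m\<bar> = \<bar>(b * of_int m - x) - n\<bar>" by simp
    then show "ennreal (bump a (x + of_int n - b * of_int m)) \<le> ennreal (exp (- a * \<bar>b * of_int m - x - of_int n\<bar>))"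
      using bump_le[OF a, of "x + n - b * of_int m"] by (simp add: ennreal_leI)
  qed
  have col: "(\<Sum>\<^sup>+m. ennreal (bump a (x + of_int n - b * of_int m))) \<le> ennreal (C (a * b))" for x :: real and n :: int
  proof (rule order_trans[OF nn_integral_mono bump_int[of "a * b" "(x + of_int n) / b"]])
    fix m :: int
    have "x + n - b * m = b * ((x + n) / b - m)" using b by (simp add: field_simps)
    then have "\<bar>x + n - b * of_int m\<bar> = b * \<bar>(x + of_int n) / b - m\<bar>" using b by (simp add: abs_mult)
    then show "ennreal (bump a (x + of_int n - b * of_int m)) \<le> ennreal (exp (- (a * b) * \<bar>(x + of_int n) / b - of_int m\<bar>))"
      using bump_le[OF a, of "x + n - b * of_int m"] by (simp add: ennreal_leI mult.assoc)
  qed (use a b in simp)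
  have main: "(\<Sum>\<^sup>+m. ennreal ((cmod (cbump_series a b c x m))\<^sup>2))
       \<le> ennreal (C a * C (a * b)) * csquare_sum c"
    if c: "\<And>n. cmod (c n) \<le> M" for x :: real and c :: "int \<Rightarrow> complex" and M
  proof -
    define k where "k = (\<lambda>m n. bump a (x + of_int n - b * of_int m))"
    have k0: "k m n \<ge> 0" for m n by (simp add: k_def bump_nonneg)
    have point: "ennreal ((cmod (\<Sum>\<^sub>\<infinity>n. c n * of_real (k m n)))\<^sup>2)
        \<le> ennreal (C a) * (\<Sum>\<^sup>+n. ennreal (k m n) * ennreal ((cmod (c n))\<^sup>2))" for m
    proof -
      have sm: "(\<lambda>n. cmod (c n) * k m n) summable_on UNIV"
        unfolding k_def using a c by (rule bump_bounded_summable)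
      then have sm': "(\<lambda>n. cmod (c n * of_real (k m n))) summable_on UNIV"
        using k0 by (simp add: norm_mult)
      have "cmod (\<Sum>\<^sub>\<infinity>n. c n * of_real (k m n)) \<le> (\<Sum>\<^sub>\<infinity>n. cmod (c n) * k m n)"
        using norm_infsum_bound[OF sm'] k0 by (simp add: norm_mult)
      then have "ennreal (cmod (\<Sum>\<^sub>\<infinity>n. c n * of_real (k m n))) \<le> (\<Sum>\<^sup>+n. ennreal (cmod (c n) * k m n))"
        using sm k0 by (subst nn_integral_count_space_infsum) (auto intro!: ennreal_leI)
      also have "\<dots> = (\<Sum>\<^sup>+n. ennreal (sqrt (k m n)) * ennreal (sqrt (k m n) * cmod (c n)))"
      proof (intro nn_integral_cong)
        fix n
        have "cmod (c n) * k m n = sqrt (k m n) * (sqrt (k m n) * cmod (c n))"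
          using k0[of m n] by (simp add: mult.assoc[symmetric])
        then show "ennreal (cmod (c n) * k m n) = ennreal (sqrt (k m n)) * ennreal (sqrt (k m n) * cmod (c n))"
          by (subst ennreal_mult'[symmetric]) (simp_all add: k0)
      qed
      finally have le: "ennreal (cmod (\<Sum>\<^sub>\<infinity>n. c n * of_real (k m n))) \<le> \<dots>" .
      have "ennreal ((cmod (\<Sum>\<^sub>\<infinity>n. c n * of_real (k m n)))\<^sup>2) = (ennreal (cmod (\<Sum>\<^sub>\<infinity>n. c n * of_real (k m n))))\<^sup>2"
        by (simp add: ennreal_power)
      also have "\<dots> \<le> (\<Sum>\<^sup>+n. ennreal (sqrt (k m n)) * ennreal (sqrt (k m n) * cmod (c n)))\<^sup>2"
        using le by (rule power_mono) simp
      also have "\<dots> \<le> (\<Sum>\<^sup>+n. (ennreal (sqrt (k m n)))\<^sup>2) *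
          (\<Sum>\<^sup>+n. (ennreal (sqrt (k m n) * cmod (c n)))\<^sup>2)"
        by (rule Cauchy_Schwarz_nn_integral) auto
      also have "(\<Sum>\<^sup>+n. (ennreal (sqrt (k m n)))\<^sup>2) = (\<Sum>\<^sup>+n. ennreal (k m n))"
        using k0 by (intro nn_integral_cong) (simp add: ennreal_power)
      also have "(\<Sum>\<^sup>+n. (ennreal (sqrt (k m n) * cmod (c n)))\<^sup>2) = (\<Sum>\<^sup>+n. ennreal (k m n) * ennreal ((cmod (c n))\<^sup>2))"
        using k0 by (intro nn_integral_cong) (simp add: ennreal_power power_mult_distrib ennreal_mult'[symmetric])
      also have "(\<Sum>\<^sup>+n. ennreal (k m n)) \<le> ennreal (C a)"
        unfolding k_def by (rule row)
      finally show ?thesis by (simp add: mult_right_mono)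
    qed
    have "(\<Sum>\<^sup>+m. ennreal ((cmod (\<Sum>\<^sub>\<infinity>n. c n * of_real (k m n)))\<^sup>2))
        \<le> (\<Sum>\<^sup>+m. ennreal (C a) * (\<Sum>\<^sup>+n. ennreal (k m n) * ennreal ((cmod (c n))\<^sup>2)))"
      by (intro nn_integral_mono point)
    also have "\<dots> = ennreal (C a) * (\<Sum>\<^sup>+m. (\<Sum>\<^sup>+n. ennreal (k m n) * ennreal ((cmod (c n))\<^sup>2)))"
      by (rule nn_integral_cmult) auto
    also have "(\<Sum>\<^sup>+m. (\<Sum>\<^sup>+n. ennreal (k m n) * ennreal ((cmod (c n))\<^sup>2)))
       = (\<Sum>\<^sup>+n. (\<Sum>\<^sup>+m. ennreal (k m n) * ennreal ((cmod (c n))\<^sup>2)))"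
      by (rule nn_integral_count_space_nn_integral) auto
    also have "\<dots> = (\<Sum>\<^sup>+n. (\<Sum>\<^sup>+m. ennreal (k m n)) * ennreal ((cmod (c n))\<^sup>2))"
      by (intro nn_integral_cong nn_integral_multc) auto
    also have "\<dots> \<le> (\<Sum>\<^sup>+n. ennreal (C (a * b)) * ennreal ((cmod (c n))\<^sup>2))"
      unfolding k_def by (intro nn_integral_mono mult_right_mono col) auto
    also have "\<dots> = ennreal (C (a * b)) * csquare_sum c"
      by (rule nn_integral_cmult) auto
    finally show ?thesis
      using C0 by (simp add: k_def mult_left_mono mult.assoc ennreal_mult')
  qed
  show ?thesis
  proof (intro exI[of _ "C a * C (a * b) + 1"] conjI allI impI)
    show "C a * C (a * b) + 1 > 0" using mult_nonneg_nonneg[OF C0 C0, of a "a * b"] by linarith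
    fix x M :: real and c :: "int \<Rightarrow> complex"
    assume "\<forall>n. cmod (c n) \<le> M"
    then have "(\<Sum>\<^sup>+m. ennreal ((cmod (cbump_series a b c x m))\<^sup>2))
       \<le> ennreal (C a * C (a * b)) * csquare_sum c"
      by (intro main) blast
    also have "\<dots> \<le> ennreal (C a * C (a * b) + 1) * csquare_sum c"
      by (intro mult_right_mono ennreal_leI) simp_all
    finally show "(\<Sum>\<^sup>+m. ennreal ((cmod (cbump_series a b c x m))\<^sup>2))
       \<le> ennreal (C a * C (a * b) + 1) * csquare_sum c" .
  qed
qed

text \<open>The matrix is real, so the lower bound passes to complex sequences through real and imaginary parts.\<close>

lemma bump_frame_bounds:
  fixes a b :: real
  assumes a: "a > 0" and b: "0 < b" "b < 1 / 3"
  shows "\<exists>A>0. \<exists>B>0. \<forall>(x::real) (c :: int \<Rightarrow> complex) M. (\<forall>n. cmod (c n) \<le> M) \<longrightarrow>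
     ennreal A * csquare_sum c \<le>
       (\<Sum>\<^sup>+m. ennreal ((cmod (cbump_series a b c x m))\<^sup>2)) \<and>
     (\<Sum>\<^sup>+m. ennreal ((cmod (cbump_series a b c x m))\<^sup>2))
       \<le> ennreal B * csquare_sum c"
proof -
  obtain A :: real where A: "A > 0" and low: "\<forall>(x::real) (c :: int \<Rightarrow> real) M. (\<forall>n. \<bar>c n\<bar> \<le> M) \<longrightarrow>
       ennreal A * square_sum c
         \<le> (\<Sum>\<^sup>+m. ennreal ((bump_series a b c x m)\<^sup>2))"
    using bump_lower_bound[OF a b] by blast
  have lowc: "ennreal A * csquare_sum c \<le>
       (\<Sum>\<^sup>+m. ennreal ((cmod (cbump_series a b c x m))\<^sup>2))"
    if c: "\<And>n. cmod (c n) \<le> M" for x :: real and c :: "int \<Rightarrow> complex" and M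
  proof -
    let ?S = "\<lambda>m. \<Sum>\<^sub>\<infinity>n. c n * of_real (bump a (x + of_int n - b * of_int m))"
    have re: "(\<Sum>\<^sub>\<infinity>n. Re (c n) * bump a (x + of_int n - b * of_int m)) = Re (?S m)" for m
      using infsum_Re[OF bump_summable_complex[of a c M x b m, OF a c]] by simp
    have im: "(\<Sum>\<^sub>\<infinity>n. Im (c n) * bump a (x + of_int n - b * of_int m)) = Im (?S m)" for m
      using infsum_Im[OF bump_summable_complex[of a c M x b m, OF a c]] by simp
    have split: "ennreal ((cmod z)\<^sup>2) = ennreal ((Re z)\<^sup>2) + ennreal ((Im z)\<^sup>2)" for z
      by (simp add: cmod_power2 ennreal_plus)
    have "ennreal A * csquare_sum c
       = ennreal A * (\<Sum>\<^sup>+n. ennreal ((Re (c n))\<^sup>2)) + ennreal A * (\<Sum>\<^sup>+n. ennreal ((Im (c n))\<^sup>2))"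
      unfolding split by (subst nn_integral_add) (auto simp: distrib_left)
    also have "\<dots> \<le> (\<Sum>\<^sup>+m. ennreal ((Re (?S m))\<^sup>2)) + (\<Sum>\<^sup>+m. ennreal ((Im (?S m))\<^sup>2))"
      unfolding re[symmetric] im[symmetric]
      by (intro add_mono low[rule_format, where M = M] order_trans[OF abs_Re_le_cmod c] order_trans[OF abs_Im_le_cmod c])
    also have "\<dots> = (\<Sum>\<^sup>+m. ennreal ((cmod (?S m))\<^sup>2))"
      unfolding split by (subst nn_integral_add) auto
    finally show ?thesis .
  qed
  obtain B where "B > 0" and "\<forall>(x::real) (c :: int \<Rightarrow> complex) M. (\<forall>n. cmod (c n) \<le> M) \<longrightarrow>
     (\<Sum>\<^sup>+m. ennreal ((cmod (cbump_series a b c x m))\<^sup>2))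
       \<le> ennreal B * csquare_sum c"
    using bump_upper_bound[OF a b(1)] by blast
  then show ?thesis using A lowc by blast
qed

section \<open>Parseval's identity on an interval\<close>

definition trig_char :: "real \<Rightarrow> int \<Rightarrow> real \<Rightarrow> complex" where
  "trig_char T k x = cis (2 * pi * of_int k * x / T)"

lemma cmod_trig_char [simp]: "cmod (trig_char T k x) = 1"
  by (simp add: trig_char_def)

lemma trig_char_add: "trig_char T k x * trig_char T l x = trig_char T (k + l) x"
  by (simp add: trig_char_def cis_mult algebra_simps add_divide_distrib)

lemma cnj_trig_char: "cnj (trig_char T k x) = trig_char T (- k) x"
  by (simp add: trig_char_def cis_cnj)

lemma continuous_on_trig_char [continuous_intros]:
  "continuous_on S g \<Longrightarrow> continuous_on S (\<lambda>x. trig_char T k (g x))"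
  unfolding trig_char_def divide_inverse by (intro continuous_intros)

lemma trig_char_period:
  assumes "T \<noteq> 0"
  shows "trig_char T k (x + T * of_int n) = trig_char T k x"
proof -
  have "2 * pi * of_int k * (x + T * of_int n) / T = 2 * pi * of_int k * x / T + 2 * pi * of_int (k * n)"
    using assms by (simp add: field_simps)
  moreover have "cis (2 * pi * of_int (k * n)) = 1"
    by (simp add: cis_multiple_2pi)
  ultimately show ?thesis by (simp add: trig_char_def cis_mult[symmetric])
qed

lemma trig_char_orthogonal:
  assumes T: "T > 0"
  shows "((\<lambda>x. trig_char T k x * cnj (trig_char T l x)) has_integral (if k = l then of_real T else 0)) {u..u + T}"
proof (cases "k = l")
  case True
  have "trig_char T l x * cnj (trig_char T l x) = 1" for x
    by (simp add: complex_norm_square[symmetric])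
  moreover have "((\<lambda>x. 1 :: complex) has_integral of_real T) {u..u + T}"
    using has_integral_const_real[of "1 :: complex" u "u + T"] T by (simp add: scaleR_conv_of_real)
  ultimately show ?thesis using True by simp
next
  case False
  define w where "w = 2 * pi * of_int (k - l) / T"
  have w: "w \<noteq> 0" using False T by (simp add: w_def)
  have eq: "trig_char T k x * cnj (trig_char T l x) = exp (\<i> * of_real w * of_real x)" for x
    unfolding cnj_trig_char trig_char_add unfolding trig_char_def cis_conv_exp w_def by (simp add: field_simps)
  have "((\<lambda>x. exp (\<i> * of_real w * of_real x)) has_integral
     (exp (\<i> * of_real w * of_real (u + T)) / (\<i> * of_real w) - exp (\<i> * of_real w * of_real u) / (\<i> * of_real w))) {u..u + T}"
  proof (rule fundamental_theorem_of_calculus)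
    fix x assume "x \<in> {u..u + T}"
    have "((\<lambda>z. exp (\<i> * of_real w * z) / (\<i> * of_real w)) has_field_derivative exp (\<i> * of_real w * of_real x)) (at (of_real x))"
      using w by (auto intro!: derivative_eq_intros simp: field_simps)
    then show "((\<lambda>x. exp (\<i> * of_real w * of_real x) / (\<i> * of_real w)) has_vector_derivative
       exp (\<i> * of_real w * of_real x)) (at x within {u..u + T})"
      by (rule has_vector_derivative_real_field)
  qed (use T in simp)
  moreover have "exp (\<i> * of_real w * of_real (u + T)) = exp (\<i> * of_real w * of_real u)"
  proof -
    have "\<i> * of_real w * of_real (u + T) = \<i> * of_real w * of_real u + 2 * of_real pi * of_int (k - l) * \<i>"
      using T by (simp add: w_def field_simps)
    moreover have "exp (2 * of_real pi * of_int (k - l) * \<i>) = 1"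
      using exp_integer_2pi[of "of_int (k - l)"] by (simp add: mult.commute mult.left_commute)
    ultimately show ?thesis by (simp only: exp_add mult_1_right)
  qed
  ultimately show ?thesis using False eq by simp
qed

text \<open>Completing the square in every coefficient. The choice \<open>a\<^sub>k = c\<^sub>k/T\<close> yields Bessel's inequality, and
dropping the squares for general \<open>a\<close> yields the optimality of the Fourier partial sums.\<close>

lemma trig_sum_error:
  fixes f :: "real \<Rightarrow> complex"
  assumes T: "T > 0" and f: "continuous_on {u..u + T} f" and S: "finite S"
    and c: "\<And>k. c k = integral {u..u + T} (\<lambda>x. f x * cnj (trig_char T k x))"
  shows "((\<lambda>x. (cmod (f x - (\<Sum>k\<in>S. a k * trig_char T k x)))\<^sup>2) has_integral
     (integral {u..u + T} (\<lambda>x. (cmod (f x))\<^sup>2) + (\<Sum>k\<in>S. T * (cmod (a k - c k / of_real T))\<^sup>2 - (cmod (c k))\<^sup>2 / T))) {u..u + T}"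
proof -
  define h where "h = (\<lambda>x. \<Sum>k\<in>S. a k * trig_char T k x)"
  have ff: "((\<lambda>x. (cmod (f x))\<^sup>2) has_integral integral {u..u + T} (\<lambda>x. (cmod (f x))\<^sup>2)) {u..u + T}"
    by (intro integrable_integral integrable_continuous_real continuous_intros f)
  have ck: "((\<lambda>x. f x * cnj (trig_char T k x)) has_integral c k) {u..u + T}" for k
    unfolding c by (intro integrable_integral integrable_continuous_real continuous_intros f)
  have "((\<lambda>x. \<Sum>k\<in>S. cnj (a k) * (f x * cnj (trig_char T k x))) has_integral (\<Sum>k\<in>S. cnj (a k) * c k)) {u..u + T}"
    by (intro has_integral_sum S has_integral_mult_right ck)
  then have fh: "((\<lambda>x. f x * cnj (h x)) has_integral (\<Sum>k\<in>S. cnj (a k) * c k)) {u..u + T}"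
    by (simp add: h_def sum_distrib_left algebra_simps)
  have "((\<lambda>x. \<Sum>k\<in>S. \<Sum>l\<in>S. a k * cnj (a l) * (trig_char T k x * cnj (trig_char T l x))) has_integral
     (\<Sum>k\<in>S. \<Sum>l\<in>S. a k * cnj (a l) * (if k = l then of_real T else 0))) {u..u + T}"
    by (intro has_integral_sum S has_integral_mult_right trig_char_orthogonal T)
  moreover have "(\<Sum>k\<in>S. \<Sum>l\<in>S. a k * cnj (a l) * (if k = l then of_real T else 0)) = (\<Sum>k\<in>S. a k * cnj (a k) * of_real T)"
    using S by (intro sum.cong refl) (simp add: if_distrib sum.delta cong: if_cong)
  ultimately have hh: "((\<lambda>x. h x * cnj (h x)) has_integral (\<Sum>k\<in>S. a k * cnj (a k) * of_real T)) {u..u + T}"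
    by (simp add: h_def sum_product algebra_simps)
  have 1: "((\<lambda>x. (cmod (f x))\<^sup>2 - 2 * Re (f x * cnj (h x)) + Re (h x * cnj (h x))) has_integral
      (integral {u..u + T} (\<lambda>x. (cmod (f x))\<^sup>2) - 2 * Re (\<Sum>k\<in>S. cnj (a k) * c k) + Re (\<Sum>k\<in>S. a k * cnj (a k) * of_real T))) {u..u + T}"
    by (intro has_integral_add has_integral_diff ff has_integral_mult_right has_integral_Re fh hh)
  have 2: "(cmod (f x))\<^sup>2 - 2 * Re (f x * cnj (h x)) + Re (h x * cnj (h x)) = (cmod (f x - h x))\<^sup>2" for x
    unfolding cmod_power2 by (simp add: power2_eq_square algebra_simps)
  have 3: "integral {u..u + T} (\<lambda>x. (cmod (f x))\<^sup>2) - 2 * Re (\<Sum>k\<in>S. cnj (a k) * c k) + Re (\<Sum>k\<in>S. a k * cnj (a k) * of_real T)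
     = integral {u..u + T} (\<lambda>x. (cmod (f x))\<^sup>2) + (\<Sum>k\<in>S. T * (cmod (a k - c k / of_real T))\<^sup>2 - (cmod (c k))\<^sup>2 / T)"
  proof -
    have "T * (cmod (a k - c k / of_real T))\<^sup>2 - (cmod (c k))\<^sup>2 / T = Re (a k * cnj (a k) * of_real T) - 2 * Re (cnj (a k) * c k)" for k
      using T unfolding cmod_power2 by (simp add: power2_eq_square field_simps)
    then show ?thesis by (simp add: sum_subtractf sum_distrib_left)
  qed
  show ?thesis using 1 unfolding 2 3 unfolding h_def .
qed

text \<open>Characters are added one at a time and may repeat, which keeps the closure under products simple;
distinct frequencies are recovered in \<open>trig_poly_repr\<close>.\<close>

inductive trig_poly :: "real \<Rightarrow> (real \<Rightarrow> complex) \<Rightarrow> bool" for T where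
  zero: "trig_poly T (\<lambda>x. 0)"
| add_char: "trig_poly T h \<Longrightarrow> trig_poly T (\<lambda>x. h x + a * trig_char T k x)"

lemma trig_poly_add:
  assumes g: "trig_poly T g" and h: "trig_poly T h"
  shows "trig_poly T (\<lambda>x. g x + h x)"
  using h
proof (induction h rule: trig_poly.induct)
  case zero
  then show ?case using g by simp
next
  case (add_char h a k)
  then show ?case using trig_poly.add_char[OF add_char.IH, of a k] by (simp add: add.assoc)
qed

lemma trig_poly_mult_char: "trig_poly T g \<Longrightarrow> trig_poly T (\<lambda>x. g x * (a * trig_char T k x))"
proof (induction g rule: trig_poly.induct)
  case (add_char h b l)
  have "(h x + b * trig_char T l x) * (a * trig_char T k x) = h x * (a * trig_char T k x) + (b * a) * trig_char T (l + k) x" for x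
    by (simp add: trig_char_add[symmetric] algebra_simps)
  then show ?case using trig_poly.add_char[OF add_char.IH, of "b * a" "l + k"] by simp
qed (auto intro: trig_poly.intros)

lemma trig_poly_mult: "trig_poly T h \<Longrightarrow> trig_poly T g \<Longrightarrow> trig_poly T (\<lambda>x. g x * h x)"
proof (induction h rule: trig_poly.induct)
  case (add_char h a k)
  then show ?case using trig_poly_add[OF add_char.IH trig_poly_mult_char[of T g a k]]
    by (simp add: distrib_left)
qed (auto intro: trig_poly.intros)

lemma trig_poly_const: "trig_poly T (\<lambda>x. a)"
  using trig_poly.add_char[OF trig_poly.zero, of T a 0] by (simp add: trig_char_def)

lemma trig_poly_repr: "trig_poly T h \<Longrightarrow> \<exists>S a. finite S \<and> h = (\<lambda>x. \<Sum>k\<in>S. a k * trig_char T k x)"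
proof (induction h rule: trig_poly.induct)
  case zero
  then show ?case by (intro exI[of _ "{}"]) auto
next
  case (add_char h b l)
  then obtain S a where S: "finite S" "h = (\<lambda>x. \<Sum>k\<in>S. a k * trig_char T k x)" by auto
  define a' where "a' = (\<lambda>k. (if k \<in> S then a k else 0) + (if k = l then b else 0))"
  have "(\<Sum>k\<in>insert l S. a' k * trig_char T k x) = h x + b * trig_char T l x" for x
  proof -
    have "(\<Sum>k\<in>insert l S. a' k * trig_char T k x) =
       (\<Sum>k\<in>insert l S. (if k \<in> S then a k else 0) * trig_char T k x) + (\<Sum>k\<in>insert l S. if k = l then b * trig_char T k x else 0)"
      unfolding a'_def sum.distrib[symmetric] by (intro sum.cong) (auto simp: distrib_right)
    also have "(\<Sum>k\<in>insert l S. if k = l then b * trig_char T k x else 0) = b * trig_char T l x"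
      using S(1) by (subst sum.delta) auto
    also have "(\<Sum>k\<in>insert l S. (if k \<in> S then a k else 0) * trig_char T k x) = h x"
      unfolding S(2) using S(1) by (intro sum.mono_neutral_cong_right) auto
    finally show ?thesis .
  qed
  then show ?case using S(1) by (intro exI[of _ "insert l S"] exI[of _ a']) auto
qed

text \<open>Polynomials in the real and imaginary part of a point of the unit circle are trigonometric
polynomials, because \<open>Re z\<close> and \<open>Im z\<close> are combinations of \<open>z\<close> and \<open>cnj z\<close>.\<close>

lemma trig_poly_real_polynomial:
  assumes "real_polynomial_function q"
  shows "trig_poly T (\<lambda>x. of_real (q (trig_char T 1 x)))"
  using assms
proof (induction q rule: real_polynomial_function.induct)
  case (linear f)
  then interpret bounded_linear f .
  let ?e = "\<lambda>x. trig_char T 1 x"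
  have "of_real (f (?e x)) = (of_real (f 1) / 2 - \<i> * of_real (f \<i>) / 2) * trig_char T 1 x + (of_real (f 1) / 2 + \<i> * of_real (f \<i>) / 2) * trig_char T (-1) x" for x
  proof -
    have "?e x = Re (?e x) *\<^sub>R 1 + Im (?e x) *\<^sub>R \<i>" by (simp add: complex_eq_iff)
    then have "f (?e x) = Re (?e x) * f 1 + Im (?e x) * f \<i>" by (metis add scaleR real_scaleR_def)
    moreover have "trig_char T (-1) x = cnj (?e x)" by (simp add: cnj_trig_char)
    ultimately show ?thesis by (simp add: complex_eq_iff algebra_simps)
  qed
  then show ?case
    using trig_poly.add_char[OF trig_poly.add_char[OF trig_poly.zero], of T] by simp
next
  case (const c)
  then show ?case by (rule trig_poly_const)
next
  case (add f g)
  then show ?case using trig_poly_add by (simp add: trig_poly_add)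
next
  case (mult f g)
  then show ?case by (simp add: trig_poly_mult)
qed

text \<open>A continuous function with equal end values factors through the quotient map onto the circle, where
the Stone--Weierstrass theorem applies. The factor \<open>F\<close> is continuous because the
quotient map sends the compact set \<open>f\<^sup>-\<^sup>1(B)\<close> to a compact, hence closed set.\<close>

lemma trig_poly_approx:
  fixes f :: "real \<Rightarrow> complex"
  assumes T: "T > 0" and f: "continuous_on {u..u + T} f" and per: "f u = f (u + T)" and e: "e > 0"
  obtains h where "trig_poly T h" "\<And>x. x \<in> {u..u + T} \<Longrightarrow> cmod (f x - h x) \<le> e"
proof -
  define p where "p = trig_char T 1"
  define I where "I = {u..u + T}"
  have p_cont: "continuous_on A p" for A
    using continuous_on_trig_char[OF continuous_on_id, of A T 1] by (simp add: p_def)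
  have p_inj: "f x = f y" if "x \<in> I" "y \<in> I" "p x = p y" for x y
  proof -
    have "cis (2 * pi * (x - y) / T) = 1"
    proof -
      have "cis (2 * pi * (x - y) / T) = p x / p y"
        by (simp add: p_def trig_char_def cis_divide algebra_simps diff_divide_distrib)
      also have "\<dots> = 1" using that(3) norm_eq_zero[of "p y"] by (simp add: p_def)
      finally show ?thesis .
    qed
    then have "cos (2 * pi * (x - y) / T) = 1" by (simp add: complex_eq_iff)
    then obtain n :: int where "2 * pi * (x - y) / T = of_int n * 2 * pi"
      unfolding cos_one_2pi_int by auto
    then have "2 * pi * (x - y) = 2 * pi * (T * n)" using T by (simp add: field_simps)
    then have n: "x - y = T * n" by (simp only: mult_cancel_left) simp
    have "\<bar>T * n\<bar> \<le> T" using that(1,2) n by (auto simp: I_def)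
    then have "\<bar>real_of_int n\<bar> \<le> 1" using T by (simp add: abs_mult)
    then have "n = 0 \<or> n = 1 \<or> n = -1" by linarith
    then have "x = y \<or> x = u + T \<and> y = u \<or> x = u \<and> y = u + T"
      using n that(1,2) by (auto simp: I_def)
    then show ?thesis using per by (elim disjE conjE) simp_all
  qed
  define F where "F = (\<lambda>z. f (SOME x. x \<in> I \<and> p x = z))"
  have Fp: "F (p x) = f x" if "x \<in> I" for x
  proof -
    have "(SOME y. y \<in> I \<and> p y = p x) \<in> I \<and> p (SOME y. y \<in> I \<and> p y = p x) = p x"
      using that by (intro someI_ex[of "\<lambda>y. y \<in> I \<and> p y = p x"]) auto
    then show ?thesis unfolding F_def using p_inj that by blast
  qed
  have "compact I" by (simp add: I_def)
  have "continuous_on (p ` I) F"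
    unfolding continuous_on_closed_invariant
  proof (intro allI impI)
    fix B :: "complex set" assume "closed B"
    have "closed (I \<inter> f -` B)"
      using f \<open>closed B\<close> by (intro continuous_closed_preimage) (auto simp: I_def)
    then have "compact (I \<inter> f -` B)" using \<open>compact I\<close> by (metis compact_Int_closed inf.left_idem)
    then have "compact (p ` (I \<inter> f -` B))" by (intro compact_continuous_image p_cont)
    moreover have "p ` (I \<inter> f -` B) \<inter> p ` I = F -` B \<inter> p ` I"
      using Fp by auto
    ultimately show "\<exists>A. closed A \<and> A \<inter> p ` I = F -` B \<inter> p ` I"
      by (meson compact_imp_closed)
  qed
  moreover have "compact (p ` I)" using \<open>compact I\<close> by (intro compact_continuous_image p_cont)
  ultimately obtain g where g: "polynomial_function g" "\<And>z. z \<in> p ` I \<Longrightarrow> norm (F z - g z) < e"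
    using Stone_Weierstrass_polynomial_function[of "p ` I" F e] e by blast
  have Re_g: "real_polynomial_function (\<lambda>z. Re (g z))" and Im_g: "real_polynomial_function (\<lambda>z. Im (g z))"
    using g(1) bounded_linear_Re bounded_linear_Im unfolding polynomial_function_def o_def by blast+
  have "trig_poly T (\<lambda>x. of_real (Re (g (p x))) + \<i> * of_real (Im (g (p x))))"
    unfolding p_def by (intro trig_poly_add trig_poly_mult trig_poly_const trig_poly_real_polynomial[OF Re_g] trig_poly_real_polynomial[OF Im_g])
  then have "trig_poly T (\<lambda>x. g (p x))" by (simp add: complex_eq[symmetric])
  moreover have "cmod (f x - g (p x)) \<le> e" if "x \<in> {u..u + T}" for x
    using g(2)[of "p x"] Fp[of x] that by (simp add: I_def less_imp_le)
  ultimately show thesis by (rule that)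
qed

theorem parseval:
  fixes f :: "real \<Rightarrow> complex"
  assumes T: "T > 0" and f: "continuous_on {u..u + T} f" and per: "f u = f (u + T)"
  shows "((\<lambda>k. (cmod (integral {u..u + T} (\<lambda>x. f x * cnj (trig_char T k x))))\<^sup>2) has_sum
            T * integral {u..u + T} (\<lambda>x. (cmod (f x))\<^sup>2)) UNIV"
proof -
  define c where "c = (\<lambda>k. integral {u..u + T} (\<lambda>x. f x * cnj (trig_char T k x)))"
  define N where "N = integral {u..u + T} (\<lambda>x. (cmod (f x))\<^sup>2)"
  have err: "((\<lambda>x. (cmod (f x - (\<Sum>k\<in>S. a k * trig_char T k x)))\<^sup>2) has_integral
     (N + (\<Sum>k\<in>S. T * (cmod (a k - c k / of_real T))\<^sup>2 - (cmod (c k))\<^sup>2 / T))) {u..u + T}"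
    if "finite S" for S a
    unfolding N_def by (rule trig_sum_error[OF T f that]) (simp add: c_def)
  have bessel: "(\<Sum>k\<in>S. (cmod (c k))\<^sup>2) \<le> T * N" if S: "finite S" for S
  proof -
    have "0 \<le> N + (\<Sum>k\<in>S. T * (cmod (c k / of_real T - c k / of_real T))\<^sup>2 - (cmod (c k))\<^sup>2 / T)"
      by (rule has_integral_nonneg[OF err[OF S, of "\<lambda>k. c k / of_real T"]]) auto
    then have "(\<Sum>k\<in>S. (cmod (c k))\<^sup>2) / T \<le> N" by (simp add: sum_negf sum_divide_distrib)
    then show ?thesis using T by (simp add: pos_divide_le_eq mult.commute)
  qed
  have approx: "\<exists>S. finite S \<and> T * N - \<epsilon> \<le> (\<Sum>k\<in>S. (cmod (c k))\<^sup>2)" if \<epsilon>: "\<epsilon> > 0" for \<epsilon>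
  proof -
    define e where "e = sqrt \<epsilon> / T"
    have e: "e > 0" using \<epsilon> T by (simp add: e_def)
    obtain h where h: "trig_poly T h" "\<And>x. x \<in> {u..u + T} \<Longrightarrow> cmod (f x - h x) \<le> e"
      using trig_poly_approx[OF T f per e] by blast
    obtain S a where S: "finite S" "h = (\<lambda>x. \<Sum>k\<in>S. a k * trig_char T k x)"
      using trig_poly_repr[OF h(1)] by auto
    have "N - (\<Sum>k\<in>S. (cmod (c k))\<^sup>2) / T \<le> N + (\<Sum>k\<in>S. T * (cmod (a k - c k / of_real T))\<^sup>2 - (cmod (c k))\<^sup>2 / T)"
      using T by (simp add: sum_subtractf sum_divide_distrib sum_nonneg)
    also have "\<dots> \<le> e\<^sup>2 * T"
    proof (rule has_integral_le[OF err[OF S(1), of a]])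
      show "((\<lambda>x. e\<^sup>2) has_integral e\<^sup>2 * T) {u..u + T}"
        using has_integral_const_real[of "e\<^sup>2" u "u + T"] T by (simp add: mult.commute)
      fix x assume "x \<in> {u..u + T}"
      then show "(cmod (f x - (\<Sum>k\<in>S. a k * trig_char T k x)))\<^sup>2 \<le> e\<^sup>2"
        using h(2) S(2) by (intro power_mono) auto
    qed
    finally have "T * (N - (\<Sum>k\<in>S. (cmod (c k))\<^sup>2) / T) \<le> T * (e\<^sup>2 * T)" using T by simp
    also have "\<dots> = \<epsilon>" using T \<epsilon> by (simp add: e_def power_divide power2_eq_square field_simps)
    finally show ?thesis using T S(1) by (intro exI[of _ S]) (simp add: right_diff_distrib)
  qed
  let ?sup = "SUP S\<in>{S. finite S \<and> S \<subseteq> UNIV}. \<Sum>k\<in>S. (cmod (c k))\<^sup>2"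
  have "((\<lambda>k. (cmod (c k))\<^sup>2) has_sum ?sup) UNIV"
    using bessel by (intro nonneg_bdd_above_has_sum) (auto intro!: bdd_aboveI2)
  moreover have "?sup = T * N"
  proof (rule antisym)
    show "?sup \<le> T * N"
      using bessel by (intro cSUP_least) auto
    show "T * N \<le> ?sup"
    proof (rule field_le_epsilon)
      fix \<epsilon> :: real assume "\<epsilon> > 0"
      from approx[OF this] obtain S where S: "finite S" "T * N - \<epsilon> \<le> (\<Sum>k\<in>S. (cmod (c k))\<^sup>2)" by auto
      moreover have "(\<Sum>k\<in>S. (cmod (c k))\<^sup>2) \<le> ?sup"
        using bessel S(1) by (intro cSUP_upper) (auto intro!: bdd_aboveI2)
      ultimately show "T * N \<le> ?sup + \<epsilon>" by linarith
    qed
  qed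
  ultimately show ?thesis by (simp add: c_def N_def)
qed

section \<open>Periodization\<close>

abbreviation periodization :: "real \<Rightarrow> (real \<Rightarrow> complex) \<Rightarrow> real \<Rightarrow> complex" where
  "periodization p h x \<equiv> \<Sum>\<^sub>\<infinity>n. h (x + p * of_int n)"

lemma exp_neg_abs_period_le:
  fixes a p \<xi> :: real and n :: int
  assumes "a > 0" "0 \<le> \<xi>" "\<xi> \<le> p"
  shows "exp (- a * \<bar>\<xi> + p * n\<bar>) \<le> exp (a * p) * exp (- (a * p) * \<bar>real_of_int n\<bar>)"
proof -
  have "p * \<bar>real_of_int n\<bar> - p \<le> \<bar>\<xi> + p * n\<bar>"
  proof -
    have "p * \<bar>real_of_int n\<bar> = \<bar>p * n\<bar>" using assms by (simp add: abs_mult)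
    also have "\<dots> \<le> \<bar>\<xi> + p * n\<bar> + \<bar>\<xi>\<bar>" by linarith
    finally show ?thesis using assms by linarith
  qed
  then have "a * (p * \<bar>real_of_int n\<bar> - p) \<le> a * \<bar>\<xi> + p * n\<bar>"
    using assms(1) by (intro mult_left_mono) auto
  then show ?thesis by (simp add: mult_exp_exp algebra_simps)
qed

lemma integral_infsum_int:
  fixes f :: "int \<Rightarrow> 'a \<Rightarrow> complex"
  assumes int: "\<And>n. integrable M (f n)"
    and sum_int: "(\<lambda>n. \<integral>x. cmod (f n x) \<partial>M) summable_on UNIV"
    and sum: "\<And>x. (\<lambda>n. cmod (f n x)) summable_on UNIV"
  shows "(\<integral>x. (\<Sum>\<^sub>\<infinity>n. f n x) \<partial>M) = (\<Sum>\<^sub>\<infinity>n. \<integral>x. f n x \<partial>M)"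
proof -
  have nat_sum: "(\<lambda>i. g (int_decode i)) summable_on UNIV \<longleftrightarrow> g summable_on UNIV" for g :: "int \<Rightarrow> 'b::topological_comm_monoid_add"
    by (rule summable_on_reindex_bij_betw[OF bij_int_decode])
  have suminf: "(\<Sum>i. g (int_decode i)) = (\<Sum>\<^sub>\<infinity>n. g n)" if "(\<lambda>n. cmod (g n)) summable_on UNIV" for g :: "int \<Rightarrow> complex"
  proof -
    have "g summable_on UNIV" using that by (rule abs_summable_summable)
    then have "(\<lambda>i. g (int_decode i)) summable_on UNIV" by (simp add: nat_sum)
    then have "(\<Sum>i. g (int_decode i)) = (\<Sum>\<^sub>\<infinity>i. g (int_decode i))"
      by (intro sums_unique[symmetric] has_sum_imp_sums has_sum_infsum)
    also have "\<dots> = (\<Sum>\<^sub>\<infinity>n. g n)" by (rule infsum_reindex_bij_betw[OF bij_int_decode])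
    finally show ?thesis .
  qed
  have abs: "(\<lambda>n. cmod (\<integral>x. f n x \<partial>M)) summable_on UNIV"
    by (rule summable_on_comparison_test[OF sum_int integral_norm_bound]) auto
  have "(\<integral>x. (\<Sum>\<^sub>\<infinity>n. f n x) \<partial>M) = (\<integral>x. (\<Sum>i. f (int_decode i) x) \<partial>M)"
    by (intro Bochner_Integration.integral_cong refl suminf[symmetric] sum)
  also have "\<dots> = (\<Sum>i. \<integral>x. f (int_decode i) x \<partial>M)"
  proof (rule integral_suminf)
    show "AE x in M. summable (\<lambda>i. norm (f (int_decode i) x))"
      using sum nat_sum[of "\<lambda>n. cmod (f n _)"] by (intro AE_I2) (simp add: summable_on_imp_summable)
    show "summable (\<lambda>i. \<integral>x. norm (f (int_decode i) x) \<partial>M)"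
      using sum_int nat_sum[of "\<lambda>n. \<integral>x. cmod (f n x) \<partial>M"] by (simp add: summable_on_imp_summable)
  qed (rule int)
  also have "\<dots> = (\<Sum>\<^sub>\<infinity>n. \<integral>x. f n x \<partial>M)" by (rule suminf[OF abs])
  finally show ?thesis .
qed

lemma indicator_translates:
  fixes p x :: real
  assumes "p > 0"
  shows "indicator {p * of_int n..<p * of_int n + p} x = (if n = \<lfloor>x / p\<rfloor> then 1 else (0 :: 'a :: zero_neq_one))"
proof -
  have "x \<in> {p * of_int n..<p * of_int n + p} \<longleftrightarrow> of_int n \<le> x / p \<and> x / p < of_int n + 1"
    using assms by (simp add: field_simps)
  also have "\<dots> \<longleftrightarrow> n = \<lfloor>x / p\<rfloor>" by (subst eq_commute) (simp add: floor_eq_iff)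
  finally show ?thesis by (simp add: indicator_def)
qed

text \<open>The line is the disjoint union of the translates of \<open>[0, p)\<close>.\<close>

lemma nn_integral_periodization:
  fixes h :: "real \<Rightarrow> ennreal"
  assumes p: "p > 0" and [measurable]: "h \<in> borel_measurable borel"
  shows "(\<integral>\<^sup>+x. h x \<partial>lborel) = (\<integral>\<^sup>+x. (\<Sum>\<^sup>+n. h (x + p * of_int n)) * indicator {0..<p} x \<partial>lborel)"
proof -
  have "(\<integral>\<^sup>+x. h x \<partial>lborel) = (\<integral>\<^sup>+x. (\<integral>\<^sup>+n. h x * indicator {p * of_int n..<p * of_int n + p} x \<partial>count_space (UNIV :: int set)) \<partial>lborel)"
  proof (rule nn_integral_cong)
    fix x
    have "(\<Sum>\<^sup>+n. h x * indicator {p * of_int n..<p * of_int n + p} x)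
        = (\<Sum>\<^sup>+n. h x * indicator {\<lfloor>x / p\<rfloor>} n)"
      unfolding indicator_translates[OF p] by (intro nn_integral_cong) (simp add: indicator_def)
    also have "\<dots> = h x" by (subst nn_integral_cmult_indicator) auto
    finally show "h x = (\<Sum>\<^sup>+n. h x * indicator {p * of_int n..<p * of_int n + p} x)" ..
  qed
  also have "\<dots> = (\<Sum>\<^sup>+n. (\<integral>\<^sup>+x. h x * indicator {p * of_int n..<p * of_int n + p} x \<partial>lborel))"
    by (rule nn_integral_count_space_nn_integral) auto
  also have "\<dots> = (\<integral>\<^sup>+n. (\<integral>\<^sup>+x. h (x + p * of_int n) * indicator {0..<p} x \<partial>lborel) \<partial>count_space (UNIV :: int set))"
  proof (rule nn_integral_cong)
    fix n :: int
    show "(\<integral>\<^sup>+x. h x * indicator {p * of_int n..<p * of_int n + p} x \<partial>lborel) = (\<integral>\<^sup>+x. h (x + p * of_int n) * indicator {0..<p} x \<partial>lborel)"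
      by (subst nn_integral_real_affine[where c = 1 and t = "p * of_int n"])
         (auto intro!: nn_integral_cong simp: add.commute split: split_indicator)
  qed
  also have "\<dots> = (\<integral>\<^sup>+x. (\<Sum>\<^sup>+n. h (x + p * of_int n) * indicator {0..<p} x) \<partial>lborel)"
    by (rule nn_integral_count_space_nn_integral[symmetric]) auto
  also have "\<dots> = (\<integral>\<^sup>+x. (\<Sum>\<^sup>+n. h (x + p * of_int n)) * indicator {0..<p} x \<partial>lborel)"
    by (intro nn_integral_cong nn_integral_multc) auto
  finally show ?thesis .
qed

context
  fixes h :: "real \<Rightarrow> complex" and a p C :: real
  assumes p: "p > 0" and a: "a > 0" and h: "continuous_on UNIV h" and decay: "\<And>x. cmod (h x) \<le> C * exp (- a * \<bar>x\<bar>)"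
begin

lemma decay_constant_nonneg: "C \<ge> 0"
  using order_trans[OF norm_ge_zero decay[of 0]] by simp

definition "majorant n = C * exp (a * p) * exp (- (a * p) * \<bar>real_of_int n\<bar>)"

lemma majorant_nonneg: "0 \<le> majorant n"
  by (simp add: majorant_def decay_constant_nonneg)

lemma majorant_summable: "majorant summable_on UNIV"
  unfolding majorant_def[abs_def] using a p
  by (intro summable_on_cmult_right summable_on_exp_neg_abs_int) auto

lemma translate_le_majorant: "0 \<le> x \<Longrightarrow> x \<le> p \<Longrightarrow> cmod (h (x + p * of_int n)) \<le> majorant n"
  unfolding majorant_def mult.assoc
  by (rule order_trans[OF decay mult_left_mono[OF exp_neg_abs_period_le[OF a] decay_constant_nonneg]])

lemma continuous_on_periodization: "continuous_on {0..p} (\<lambda>x. periodization p h x)"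
proof -
  have ul: "uniform_limit {0..p} (\<lambda>X x. \<Sum>n\<in>X. h (x + p * of_int n)) (\<lambda>x. periodization p h x) (finite_subsets_at_top UNIV)"
    by (rule Weierstrass_m_test_general[OF _ majorant_summable]) (simp add: translate_le_majorant)
  have "continuous_on {0..p} (\<lambda>x. \<Sum>n\<in>X. h (x + p * of_int n))" for X
    by (intro continuous_intros continuous_on_compose2[OF h]) auto
  then show ?thesis
    by (intro uniform_limit_theorem[OF _ ul] always_eventually allI) simp_all
qed

text \<open>The same decomposition of the line for complex functions. The exponential decay justifies both
exchanges of sum and integral.\<close>

lemma integral_trig_char_periodization:
  "(LINT x|lborel. h x * cnj (trig_char p k x))
     = integral {0..p} (\<lambda>x. (periodization p h x) * cnj (trig_char p k x))"
proof -
  define H where "H = (\<lambda>x. h x * cnj (trig_char p k x))"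
  define f1 where "f1 = (\<lambda>(n::int) x. indicator {p * of_int n..<p * of_int n + p} x *\<^sub>R H x)"
  define f2 where "f2 = (\<lambda>(n::int) x. indicator {0..<p} x *\<^sub>R H (x + p * of_int n))"
  have H_cont: "continuous_on UNIV H" unfolding H_def by (intro continuous_intros h)
  have [measurable]: "H \<in> borel_measurable borel" by (rule borel_measurable_continuous_onI[OF H_cont])
  have cmod_H: "cmod (H x) = cmod (h x)" for x by (simp add: H_def norm_mult)
  have f2_le: "cmod (f2 n x) \<le> indicator {0..p} x *\<^sub>R majorant n" for n x
    using translate_le_majorant[of x n] majorant_nonneg[of n] by (auto simp: f2_def cmod_H split: split_indicator)
  have ind_int: "integrable lborel (\<lambda>x. indicator {0..p} x *\<^sub>R majorant n)" for n
    using p by (intro integrable_scaleR_left impI integrable_real_indicator) (auto simp: emeasure_lborel_Icc)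
  have f2_int: "integrable lborel (f2 n)" for n
  proof (rule Bochner_Integration.integrable_bound[OF ind_int[of n]])
    show "f2 n \<in> borel_measurable lborel" unfolding f2_def by measurable
    show "AE x in lborel. norm (f2 n x) \<le> norm (indicator {0..p} x *\<^sub>R majorant n)"
      using f2_le[of n] majorant_nonneg[of n] by (intro AE_I2) (simp add: abs_mult)
  qed
  have f2_norm: "(\<integral>x. cmod (f2 n x) \<partial>lborel) \<le> p * majorant n" for n
  proof -
    have "(\<integral>x. cmod (f2 n x) \<partial>lborel) \<le> (\<integral>x. indicator {0..p} x *\<^sub>R majorant n \<partial>lborel)"
      using f2_int ind_int f2_le by (intro integral_mono) auto
    then show ?thesis using p by simp
  qed
  have shift: "f1 n (p * of_int n + 1 * x) = f2 n x" for n x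
    by (auto simp: f1_def f2_def add.commute split: split_indicator)
  have f1_int: "integrable lborel (f1 n)" for n
    using f2_int[of n] lborel_integrable_real_affine_iff[of 1 "f1 n" "p * of_int n"] by (simp only: shift)
  have f12: "(\<integral>x. f1 n x \<partial>lborel) = (\<integral>x. f2 n x \<partial>lborel)" for n
    using lborel_integral_real_affine[of 1 "f1 n" "p * of_int n"] by (simp only: shift) simp
  have f12n: "(\<integral>x. cmod (f1 n x) \<partial>lborel) = (\<integral>x. cmod (f2 n x) \<partial>lborel)" for n
    using lborel_integral_real_affine[of 1 "\<lambda>x. cmod (f1 n x)" "p * of_int n"] by (simp only: shift) simp
  have sum2: "(\<lambda>n. \<integral>x. cmod (f2 n x) \<partial>lborel) summable_on UNIV"
    by (rule summable_on_comparison_test[OF summable_on_cmult_right[OF majorant_summable] f2_norm]) auto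
  have f1_eq: "f1 n x = (if n = \<lfloor>x / p\<rfloor> then H x else 0)" for n x
    unfolding f1_def indicator_translates[OF p] by simp
  have f1_has: "((\<lambda>n. f1 n x) has_sum H x) UNIV" for x
    unfolding f1_eq using has_sum_finite_neutralI[of "{\<lfloor>x / p\<rfloor>}" UNIV "\<lambda>n. if n = \<lfloor>x / p\<rfloor> then H x else 0"] by simp
  have f1_abs: "(\<lambda>n. cmod (f1 n x)) summable_on UNIV" for x
    by (rule has_sum_imp_summable[OF has_sum_finite_neutralI[of "{\<lfloor>x / p\<rfloor>}"]]) (auto simp: f1_eq)
  have f2_abs: "(\<lambda>n. cmod (f2 n x)) summable_on UNIV" for x
    by (rule summable_on_comparison_test[OF summable_on_cmult_right[OF majorant_summable, of "indicator {0..p} x"]])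
       (use f2_le in auto)
  have "(LINT x|lborel. H x) = (\<integral>x. (\<Sum>\<^sub>\<infinity>n. f1 n x) \<partial>lborel)"
    by (simp only: infsumI[OF f1_has])
  also have "\<dots> = (\<Sum>\<^sub>\<infinity>n. \<integral>x. f1 n x \<partial>lborel)"
    by (rule integral_infsum_int[OF f1_int _ f1_abs]) (simp add: f12n sum2)
  also have "\<dots> = (\<Sum>\<^sub>\<infinity>n. \<integral>x. f2 n x \<partial>lborel)" by (simp add: f12)
  also have "\<dots> = (\<integral>x. (\<Sum>\<^sub>\<infinity>n. f2 n x) \<partial>lborel)"
    by (rule integral_infsum_int[symmetric, OF f2_int sum2 f2_abs])
  also have "\<dots> = (\<integral>x. indicator {0..<p} x *\<^sub>R ((periodization p h x) * cnj (trig_char p k x)) \<partial>lborel)"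
    using p by (intro Bochner_Integration.integral_cong refl)
      (auto simp: f2_def H_def trig_char_period infsum_cmult_left' split: split_indicator)
  also have "\<dots> = (LINT x:{0..p}|lborel. (periodization p h x) * cnj (trig_char p k x))"
    unfolding set_lebesgue_integral_def
  proof (rule integral_cong_AE)
    have "AE x in lborel. x \<noteq> p" by (rule AE_lborel_singleton)
    then show "AE x in lborel. indicator {0..<p} x *\<^sub>R ((periodization p h x) * cnj (trig_char p k x))
        = indicator {0..p} x *\<^sub>R ((periodization p h x) * cnj (trig_char p k x))"
      by eventually_elim (auto split: split_indicator)
    have c: "continuous_on {0..p} (\<lambda>x. (periodization p h x) * cnj (trig_char p k x))"
      by (intro continuous_intros continuous_on_periodization)
    show "(\<lambda>x. indicator {0..p} x *\<^sub>R ((periodization p h x) * cnj (trig_char p k x))) \<in> borel_measurable lborel"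
      using borel_measurable_continuous_on_indicator[OF _ c] by simp
    show "(\<lambda>x. indicator {0..<p} x *\<^sub>R ((periodization p h x) * cnj (trig_char p k x))) \<in> borel_measurable lborel"
      using borel_measurable_continuous_on_indicator[OF _ continuous_on_subset[OF c], of "{0..<p}"] by (simp add: atLeastLessThan_subseteq_atLeastAtMost_iff)
  qed
  also have "\<dots> = integral {0..p} (\<lambda>x. (periodization p h x) * cnj (trig_char p k x))"
    by (intro set_borel_integral_eq_integral borel_integrable_atLeastAtMost' continuous_intros continuous_on_periodization)
  finally show ?thesis by (simp add: H_def)
qed

lemma parseval_periodization:
  "((\<lambda>k. (cmod (LINT x|lborel. h x * cnj (trig_char p k x)))\<^sup>2) has_sum
      p * integral {0..p} (\<lambda>x. (cmod (periodization p h x))\<^sup>2)) UNIV"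
proof -
  have "(\<Sum>\<^sub>\<infinity>n. h (0 + p * of_int n)) = (\<Sum>\<^sub>\<infinity>n. h (p + p * of_int n))"
  proof -
    have "bij (\<lambda>n::int. n + 1)" by (rule bij_betw_byWitness[where f' = "\<lambda>n. n - 1"]) auto
    from infsum_reindex_bij_betw[OF this, of "\<lambda>n. h (p * of_int n)"] show ?thesis
      by (simp add: algebra_simps)
  qed
  then show ?thesis
    unfolding integral_trig_char_periodization
    using parseval[OF p, of 0 "\<lambda>x. periodization p h x"] continuous_on_periodization by simp
qed

end

section \<open>The Fourier transform of the window\<close>

lemma integrable_even:
  fixes h :: "real \<Rightarrow> real"
  assumes half: "set_integrable lborel {0..} h" and even: "\<And>x. h (- x) = h x"
  shows "integrable lborel h"
proof -
  have "integrable lborel (\<lambda>x. indicator {0..} (0 + - 1 * x) *\<^sub>R h (0 + - 1 * x))"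
    using half unfolding set_integrable_def by (rule lborel_integrable_real_affine) simp
  moreover have "(\<lambda>x. indicator {0..} (0 + - 1 * x) *\<^sub>R h (0 + - 1 * x)) = (\<lambda>x. indicator {..0} x *\<^sub>R h x)"
    by (auto simp: even fun_eq_iff split: split_indicator)
  ultimately have "set_integrable lborel {..0} h" by (simp add: set_integrable_def)
  with half have "set_integrable lborel ({0..} \<union> {..0}) h"
    by (rule set_integrable_Un) auto
  moreover have "{0..} \<union> {..0} = (UNIV :: real set)" by auto
  ultimately show ?thesis by (simp add: set_integrable_def)
qed

lemma integrable_exp_neg_abs:
  assumes "c > 0"
  shows "integrable lborel (\<lambda>x::real. exp (- c * \<bar>x\<bar>))"
proof (rule integrable_even)
  have "(\<integral>\<^sup>+x. ennreal (exp (- c * x)) * indicator {0..} x \<partial>lborel) = 0 - (- (1 / c) * exp (- c * 0))"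
  proof (rule nn_integral_FTC_atLeast)
    show "((\<lambda>x. - (1 / c) * exp (- c * x)) \<longlongrightarrow> 0) at_top"
      using assms by real_asymp
  qed (use assms in \<open>auto intro!: derivative_eq_intros\<close>)
  then have "(\<integral>\<^sup>+x. ennreal (norm (indicator {0..} x *\<^sub>R exp (- c * \<bar>x\<bar>))) \<partial>lborel) < \<infinity>"
    by (subst nn_integral_cong[where v = "\<lambda>x. ennreal (exp (- c * x)) * indicator {0..} x"])
       (auto split: split_indicator)
  then show "set_integrable lborel {0..} (\<lambda>x::real. exp (- c * \<bar>x\<bar>))"
    unfolding set_integrable_def by (intro integrableI_bounded) auto
qed simp

text \<open>On each half line the integrand is an exponential with complex rate \<open>\<plusminus>c + iy\<close>, so the two halves
contribute \<open>1/(c + iy)\<close> and \<open>1/(c - iy)\<close>.\<close>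

lemma fourier_exp_neg_abs:
  fixes c y :: real
  assumes c: "c > 0"
  shows "(LINT x|lborel. of_real (exp (- c * \<bar>x\<bar>)) * cis (y * x)) = of_real (2 * c / (c\<^sup>2 + y\<^sup>2))"
proof -
  define f where "f = (\<lambda>x. of_real (exp (- c * \<bar>x\<bar>)) * cis (y * x))"
  have "continuous_on UNIV f" unfolding f_def by (intro continuous_intros)
  then have "f \<in> borel_measurable lborel" by (simp add: borel_measurable_continuous_onI)
  then have f_int: "integrable lborel f"
    by (rule Bochner_Integration.integrable_bound[OF integrable_exp_neg_abs[OF c]]) (simp add: f_def norm_mult)
  then have f_set: "set_integrable lborel A f" if "A \<in> sets borel" for A
    using that unfolding set_integrable_def by (intro integrable_mult_indicator) auto
  have tendsto_cis: "((\<lambda>x. g x *\<^sub>R (cis (y * x) / z)) \<longlongrightarrow> 0) F" if "(g \<longlongrightarrow> 0) F" for g z and F :: "real filter"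
  proof (rule Lim_null_comparison[OF always_eventually])
    show "\<forall>x. norm (g x *\<^sub>R (cis (y * x) / z)) \<le> \<bar>g x\<bar> * (1 / norm z)"
      by (simp add: norm_divide)
    show "((\<lambda>x. \<bar>g x\<bar> * (1 / norm z)) \<longlongrightarrow> 0) F"
      using tendsto_mult_left_zero[OF tendsto_rabs_zero[OF that]] .
  qed
  define zp where "zp = - of_real c + \<i> * of_real y"
  define zm where "zm = of_real c + \<i> * of_real y"
  have z: "zp \<noteq> 0" "zm \<noteq> 0" using c by (auto simp: zp_def zm_def complex_eq_iff)
  have deriv: "((\<lambda>x. exp (z * of_real x) / z) has_vector_derivative exp (z * of_real x)) (at x)" if "z \<noteq> 0" for z :: complex and x :: real
  proof (rule has_vector_derivative_real_field)
    show "((\<lambda>x. exp (z * x) / z) has_field_derivative exp (z * of_real x)) (at (of_real x))"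
      using that by (auto intro!: derivative_eq_intros)
  qed
  have cont: "isCont (\<lambda>x. exp (z * of_real x)) x" for z :: complex and x :: real
    by (intro continuous_intros)
  have fp: "f x = exp (zp * of_real x)" if "x \<ge> 0" for x
    using that by (simp add: f_def zp_def cis_conv_exp exp_of_real[symmetric] mult_exp_exp algebra_simps)
  have fm: "f x = exp (zm * of_real x)" if "x \<le> 0" for x
    using that by (simp add: f_def zm_def cis_conv_exp exp_of_real[symmetric] mult_exp_exp algebra_simps)
  have ep: "exp (zp * of_real x) / zp = exp (- c * x) *\<^sub>R (cis (y * x) / zp)" for x
    by (simp add: zp_def cis_conv_exp scaleR_conv_of_real exp_of_real[symmetric] mult_exp_exp algebra_simps)
  have em: "exp (zm * of_real x) / zm = exp (c * x) *\<^sub>R (cis (y * x) / zm)" for x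
    by (simp add: zm_def cis_conv_exp scaleR_conv_of_real exp_of_real[symmetric] mult_exp_exp algebra_simps)
  have p_int: "set_integrable lborel (einterval 0 \<infinity>) (\<lambda>x. exp (zp * of_real x))"
    using f_set[of "einterval 0 \<infinity>"] by (subst set_integrable_cong[where f' = f]) (auto simp: fp einterval_iff)
  have m_int: "set_integrable lborel (einterval (-\<infinity>) 0) (\<lambda>x. exp (zm * of_real x))"
    using f_set[of "einterval (-\<infinity>) 0"] by (subst set_integrable_cong[where f' = f]) (auto simp: fm einterval_iff)
  have right: "(LBINT x=0..\<infinity>. exp (zp * of_real x)) = 0 - 1 / zp"
  proof (rule interval_integral_FTC_integrable[where F = "\<lambda>x. exp (zp * of_real x) / zp"])
    have "((\<lambda>x. exp (- c * x) *\<^sub>R (cis (y * x) / zp)) \<longlongrightarrow> 0) at_top"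
      by (rule tendsto_cis) (use c in real_asymp)
    then show "(((\<lambda>x. exp (zp * of_real x) / zp) \<circ> real_of_ereal) \<longlongrightarrow> 0) (at_left \<infinity>)"
      unfolding ep by (simp add: ereal_tendsto_simps)
    have "((\<lambda>x. exp (zp * of_real x) / zp) \<longlongrightarrow> exp (zp * of_real 0) / zp) (at_right (0::real))"
      using z by (intro tendsto_intros)
    then show "(((\<lambda>x. exp (zp * of_real x) / zp) \<circ> real_of_ereal) \<longlongrightarrow> 1 / zp) (at_right 0)"
      by (simp add: zero_ereal_def ereal_tendsto_simps del: ereal_eq_0)
  qed (use deriv z cont p_int in auto)
  have left: "(LBINT x=-\<infinity>..0. exp (zm * of_real x)) = 1 / zm - 0"
  proof (rule interval_integral_FTC_integrable[where F = "\<lambda>x. exp (zm * of_real x) / zm"])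
    have "((\<lambda>x. exp (c * x) *\<^sub>R (cis (y * x) / zm)) \<longlongrightarrow> 0) at_bot"
      by (rule tendsto_cis) (use c in real_asymp)
    then show "(((\<lambda>x. exp (zm * of_real x) / zm) \<circ> real_of_ereal) \<longlongrightarrow> 0) (at_right (-\<infinity>))"
      unfolding em by (simp add: ereal_tendsto_simps)
    have "((\<lambda>x. exp (zm * of_real x) / zm) \<longlongrightarrow> exp (zm * of_real 0) / zm) (at_left (0::real))"
      using z by (intro tendsto_intros)
    then show "(((\<lambda>x. exp (zm * of_real x) / zm) \<circ> real_of_ereal) \<longlongrightarrow> 1 / zm) (at_left 0)"
      by (simp add: zero_ereal_def ereal_tendsto_simps del: ereal_eq_0)
  qed (use deriv z cont m_int in auto)
  have "(LINT x|lborel. f x) = (LBINT x=-\<infinity>..\<infinity>. f x)"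
    by (simp add: interval_integral_to_infinity_eq interval_lebesgue_integral_def set_lebesgue_integral_def)
  also have "\<dots> = (LBINT x=-\<infinity>..0. f x) + (LBINT x=0..\<infinity>. f x)"
    using f_set by (intro interval_integral_sum[symmetric]) (auto simp: interval_lebesgue_integrable_def min_def max_def)
  also have "(LBINT x=-\<infinity>..0. f x) = (LBINT x=-\<infinity>..0. exp (zm * of_real x))"
    by (intro interval_integral_cong) (auto simp: fm einterval_iff min_def max_def)
  also have "(LBINT x=0..\<infinity>. f x) = (LBINT x=0..\<infinity>. exp (zp * of_real x))"
    by (intro interval_integral_cong) (auto simp: fp einterval_iff)
  also have "(LBINT x=-\<infinity>..0. exp (zm * of_real x)) + (LBINT x=0..\<infinity>. exp (zp * of_real x)) = 1 / zm - 1 / zp"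
    unfolding left right by simp
  also have "\<dots> = (zp - zm) / (zm * zp)" using z by (simp add: field_simps)
  also have "zp - zm = of_real (- 2 * c)" by (simp add: zp_def zm_def)
  also have "zm * zp = of_real (- (c\<^sup>2 + y\<^sup>2))" by (simp add: zp_def zm_def complex_eq_iff power2_eq_square)
  also have "complex_of_real (- 2 * c) / of_real (- (c\<^sup>2 + y\<^sup>2)) = of_real (2 * c / (c\<^sup>2 + y\<^sup>2))"
  proof -
    have "(- 2 * c) / (- (c\<^sup>2 + y\<^sup>2)) = 2 * c / (c\<^sup>2 + y\<^sup>2)"
      unfolding minus_divide_right[symmetric] by simp
    then show ?thesis by (simp only: of_real_divide[symmetric])
  qed
  finally show ?thesis by (simp only: f_def)
qed

lemma bump_scale: "p > 0 \<Longrightarrow> bump a (p * s) = bump (a * p) s"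
  by (simp add: bump_def abs_mult mult.assoc)

lemma bump_eq_exp: "bump a s = exp (- a * \<bar>s\<bar>) - 2 * exp (- (2 * a) * \<bar>s\<bar>) + exp (- (3 * a) * \<bar>s\<bar>)"
proof -
  have "exp (- (2 * a) * \<bar>s\<bar>) = exp (- a * \<bar>s\<bar>) ^ 2" "exp (- (3 * a) * \<bar>s\<bar>) = exp (- a * \<bar>s\<bar>) ^ 3"
    by (simp_all add: exp_of_nat_mult[symmetric])
  then show ?thesis unfolding bump_def
    by (simp add: power2_eq_square power3_eq_cube algebra_simps)
qed

lemma integrable_bump: "a > 0 \<Longrightarrow> integrable lborel (bump a)"
  unfolding bump_eq_exp[abs_def]
  by (intro Bochner_Integration.integrable_add Bochner_Integration.integrable_diff integrable_mult_right integrable_exp_neg_abs) auto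

text \<open>The partial fraction expansion of the window, term by term.\<close>

lemma fourier_bump:
  fixes y :: real
  shows "(LINT x|lborel. of_real (bump (2 * pi) x) * cis (- (2 * pi * y) * x))
     = of_real (- (12 / pi) * ((y\<^sup>2 - 1) / ((y\<^sup>2 + 1) * (y\<^sup>2 + 4) * (y\<^sup>2 + 9))))"
proof -
  define e where "e = (\<lambda>c x. complex_of_real (exp (- c * \<bar>x\<bar>)) * cis (- (2 * pi * y) * x))"
  have e_int: "integrable lborel (e c)" if "c > 0" for c
  proof (rule Bochner_Integration.integrable_bound[OF integrable_exp_neg_abs[OF that]])
    have "continuous_on UNIV (e c)" unfolding e_def by (intro continuous_intros)
    then show "e c \<in> borel_measurable lborel" by (simp add: borel_measurable_continuous_onI)
  qed (simp add: e_def norm_mult)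
  have e_val: "(LINT x|lborel. e (2 * pi * j) x) = of_real (j / (pi * (j\<^sup>2 + y\<^sup>2)))" if "j > 0" for j
  proof -
    have "(LINT x|lborel. e (2 * pi * j) x) = of_real (2 * (2 * pi * j) / ((2 * pi * j)\<^sup>2 + (- (2 * pi * y))\<^sup>2))"
      unfolding e_def by (rule fourier_exp_neg_abs) (use that in simp)
    also have "2 * (2 * pi * j) / ((2 * pi * j)\<^sup>2 + (- (2 * pi * y))\<^sup>2) = j / (pi * (j\<^sup>2 + y\<^sup>2))"
    proof -
      have "(2 * pi * j)\<^sup>2 + (- (2 * pi * y))\<^sup>2 = (4 * pi) * (pi * (j\<^sup>2 + y\<^sup>2))"
        by (simp add: power2_eq_square algebra_simps)
      moreover have "2 * (2 * pi * j) = (4 * pi) * j" by simp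
      ultimately show ?thesis using pi_gt_zero by (simp only: mult_divide_mult_cancel_left)
    qed
    finally show ?thesis .
  qed
  have comb: "(LINT x|lborel. g1 x - 2 * g2 x + g3 x) = (LINT x|lborel. g1 x) - 2 * (LINT x|lborel. g2 x) + (LINT x|lborel. g3 x)"
    if "integrable lborel g1" "integrable lborel g2" "integrable lborel g3" for g1 g2 g3 :: "real \<Rightarrow> complex"
    using that by simp
  have "(LINT x|lborel. of_real (bump (2 * pi) x) * cis (- (2 * pi * y) * x))
      = (LINT x|lborel. e (2 * pi * 1) x - 2 * e (2 * pi * 2) x + e (2 * pi * 3) x)"
    by (intro Bochner_Integration.integral_cong refl) (simp add: e_def bump_eq_exp algebra_simps)
  also have "\<dots> = (LINT x|lborel. e (2 * pi * 1) x) - 2 * (LINT x|lborel. e (2 * pi * 2) x) + (LINT x|lborel. e (2 * pi * 3) x)"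
    by (intro comb e_int) auto
  also have "\<dots> = of_real (1 / (pi * (1\<^sup>2 + y\<^sup>2)) - 2 * (2 / (pi * (2\<^sup>2 + y\<^sup>2))) + 3 / (pi * (3\<^sup>2 + y\<^sup>2)))"
    by (simp only: e_val zero_less_numeral zero_less_one of_real_add of_real_diff of_real_mult of_real_numeral)
  also have "1 / (pi * (1\<^sup>2 + y\<^sup>2)) - 2 * (2 / (pi * (2\<^sup>2 + y\<^sup>2))) + 3 / (pi * (3\<^sup>2 + y\<^sup>2))
      = - (12 / pi) * ((y\<^sup>2 - 1) / ((y\<^sup>2 + 1) * (y\<^sup>2 + 4) * (y\<^sup>2 + 9)))"
  proof -
    define Y where "Y = y\<^sup>2"
    have "Y \<ge> 0" by (simp add: Y_def)
    then have nz: "1 + Y \<noteq> 0" "4 + Y \<noteq> 0" "9 + Y \<noteq> 0" "Y + 1 \<noteq> 0" "Y + 4 \<noteq> 0" "Y + 9 \<noteq> 0" by linarith+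
    have "1 / (pi * (1 + Y)) - 2 * (2 / (pi * (4 + Y))) + 3 / (pi * (9 + Y))
      = - (12 / pi) * ((Y - 1) / ((Y + 1) * (Y + 4) * (Y + 9)))"
      using nz pi_neq_zero by (simp add: divide_simps) (simp add: algebra_simps)
    then show ?thesis by (simp add: Y_def)
  qed
  finally show ?thesis .
qed

section \<open>Plancherel's identity for continuous functions of compact support\<close>

context
  fixes f :: "real \<Rightarrow> complex" and R :: real
  assumes R: "R > 0" and f: "continuous_on UNIV f" and supp: "\<forall>x. \<bar>x\<bar> \<ge> R \<longrightarrow> f x = 0"
begin

lemma vanishes_outside: "\<bar>x\<bar> \<ge> R \<Longrightarrow> f x = 0"
  using supp by blast

definition "fourier \<xi> = (LINT x|lborel. f x * cis (- (2 * pi * x * \<xi>)))"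

lemma integrable_cutoff:
  fixes h :: "real \<Rightarrow> 'b::euclidean_space"
  assumes "continuous_on UNIV h" "\<And>x. \<bar>x\<bar> \<ge> R \<Longrightarrow> h x = 0"
  shows "integrable lborel h" "(LINT x|lborel. h x) = integral {- R..R} h"
proof -
  have s: "set_integrable lborel {- R..R} h"
    by (rule borel_integrable_atLeastAtMost'[OF continuous_on_subset[OF assms(1)]]) simp
  have eq: "indicator {- R..R} x *\<^sub>R h x = h x" for x
    using assms(2)[of x] by (auto split: split_indicator)
  show "integrable lborel h" using s unfolding set_integrable_def eq .
  show "(LINT x|lborel. h x) = integral {- R..R} h"
    using set_borel_integral_eq_integral(2)[OF s] unfolding set_lebesgue_integral_def eq .
qed

lemma integrable_if_cutoff: "integrable lborel f"
  by (rule integrable_cutoff(1)[OF f vanishes_outside])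

lemma fourier_eq: "fourier \<xi> = integral {- R..R} (\<lambda>x. f x * cis (- (2 * pi * x * \<xi>)))"
  unfolding fourier_def by (rule integrable_cutoff(2)) (auto intro!: continuous_intros f simp: vanishes_outside)

lemma fourier_bounded: "cmod (fourier \<xi>) \<le> (LINT x|lborel. cmod (f x))"
proof -
  have "cmod (fourier \<xi>) \<le> (LINT x|lborel. cmod (f x * cis (- (2 * pi * x * \<xi>))))"
    unfolding fourier_def by (rule integral_norm_bound)
  then show ?thesis by (simp add: norm_mult)
qed

lemma continuous_on_fourier: "continuous_on UNIV fourier"
proof -
  have "continuous_on UNIV (\<lambda>\<xi>. integral (cbox (- R) R) (\<lambda>x. f x * cis (- (2 * pi * x * \<xi>))))"
  proof (rule integral_continuous_on_param)
    show "continuous_on (UNIV \<times> cbox (- R) R) (\<lambda>(\<xi>, x). f x * cis (- (2 * pi * x * \<xi>)))"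
      unfolding split_beta by (intro continuous_intros continuous_on_compose2[OF f]) auto
  qed
  then show ?thesis unfolding fourier_eq[abs_def] by simp
qed

text \<open>The values of the Fourier transform on a coset of \<open>\<int>/2R\<close> are the Fourier coefficients of a modulation
of \<open>f\<close> on \<open>[-R, R]\<close>.\<close>

lemma fourier_samples:
  "((\<lambda>k. (cmod (fourier (\<xi> + of_int k / (2 * R))))\<^sup>2) has_sum (2 * R * (LINT x|lborel. (cmod (f x))\<^sup>2))) UNIV"
proof -
  have "((\<lambda>k. (cmod (integral {- R..- R + 2 * R} (\<lambda>x. (f x * cis (- (2 * pi * x * \<xi>))) * cnj (trig_char (2 * R) k x))))\<^sup>2) has_sum
        (2 * R) * integral {- R..- R + 2 * R} (\<lambda>x. (cmod (f x * cis (- (2 * pi * x * \<xi>))))\<^sup>2)) UNIV"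
  proof (rule parseval)
    show "continuous_on {- R..- R + 2 * R} (\<lambda>x. f x * cis (- (2 * pi * x * \<xi>)))"
      by (intro continuous_intros continuous_on_subset[OF f]) auto
  qed (use R in \<open>auto simp: vanishes_outside\<close>)
  moreover have "(f x * cis (- (2 * pi * x * \<xi>))) * cnj (trig_char (2 * R) k x) = f x * cis (- (2 * pi * x * (\<xi> + of_int k / (2 * R))))" for k x
  proof -
    have "cis (- (2 * pi * x * \<xi>)) * cnj (trig_char (2 * R) k x) = cis (- (2 * pi * x * (\<xi> + of_int k / (2 * R))))"
    proof -
      have "- (2 * pi * x * \<xi>) + - (2 * pi * of_int k * x / (2 * R)) = - (2 * pi * x * (\<xi> + of_int k / (2 * R)))"
        using R by (simp add: field_simps)
      then show ?thesis by (simp only: trig_char_def cis_cnj cis_mult)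
    qed
    then show ?thesis by (simp add: mult.assoc)
  qed
  moreover have "(LINT x|lborel. (cmod (f x))\<^sup>2) = integral {- R..R} (\<lambda>x. (cmod (f x))\<^sup>2)"
    by (rule integrable_cutoff(2)) (auto intro!: continuous_intros f simp: vanishes_outside)
  ultimately show ?thesis by (simp add: fourier_eq norm_mult)
qed

text \<open>Integrating the sampled identity over all cosets, that is over one period \<open>[0, 1/2R)\<close>.\<close>

lemma plancherel: "(\<integral>\<^sup>+\<xi>. ennreal ((cmod (fourier \<xi>))\<^sup>2) \<partial>lborel) = ennreal (LINT x|lborel. (cmod (f x))\<^sup>2)"
proof -
  define N where "N = (LINT x|lborel. (cmod (f x))\<^sup>2)"
  define p where "p = 1 / (2 * R)"
  have p: "p > 0" using R by (simp add: p_def)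
  have "N \<ge> 0" unfolding N_def by (intro integral_nonneg_AE) auto
  have cont: "continuous_on UNIV (\<lambda>\<xi>. (cmod (fourier \<xi>))\<^sup>2)"
    by (intro continuous_intros continuous_on_fourier)
  have "(\<integral>\<^sup>+\<xi>. ennreal ((cmod (fourier \<xi>))\<^sup>2) \<partial>lborel)
     = (\<integral>\<^sup>+\<xi>. (\<Sum>\<^sup>+k. ennreal ((cmod (fourier (\<xi> + p * of_int k)))\<^sup>2)) * indicator {0..<p} \<xi> \<partial>lborel)"
    by (rule nn_integral_periodization[OF p]) (intro measurable_compose[OF _ measurable_ennreal] borel_measurable_continuous_onI cont)
  also have "\<dots> = (\<integral>\<^sup>+\<xi>. ennreal (2 * R * N) * indicator {0..<p} \<xi> \<partial>lborel)"
  proof (intro nn_integral_cong arg_cong2[where f = "(*)"] refl)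
    fix \<xi>
    have hs: "((\<lambda>k. (cmod (fourier (\<xi> + p * of_int k)))\<^sup>2) has_sum (2 * R * N)) UNIV"
      using fourier_samples[of \<xi>] by (simp add: p_def N_def)
    then show "(\<Sum>\<^sup>+k. ennreal ((cmod (fourier (\<xi> + p * of_int k)))\<^sup>2)) = ennreal (2 * R * N)"
      by (subst nn_integral_count_space_infsum) (auto simp: infsumI dest: has_sum_imp_summable)
  qed
  also have "\<dots> = ennreal (2 * R * N) * ennreal p"
    using p by (subst nn_integral_cmult_indicator) (auto simp: emeasure_lborel_Ico)
  also have "\<dots> = ennreal N"
    using R \<open>N \<ge> 0\<close> p by (subst ennreal_mult'[symmetric]) (auto simp: p_def)
  finally show ?thesis by (simp add: N_def)
qed

end

section \<open>Gabor coefficients on the Fourier side\<close>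

definition window :: "real \<Rightarrow> real" where
  "window x = (x\<^sup>2 - 1) / ((x\<^sup>2 + 1) * (x\<^sup>2 + 4) * (x\<^sup>2 + 9))"

abbreviation window_system :: "real \<Rightarrow> real \<Rightarrow> int \<times> int \<Rightarrow> real \<Rightarrow> complex" where
  "window_system \<equiv> gabor_system (\<lambda>x. of_real (window x))"

lemma continuous_on_window: "continuous_on S window"
proof -
  have "(x\<^sup>2 + 1) * (x\<^sup>2 + 4) * (x\<^sup>2 + 9) > 0" for x :: real
    by (intro mult_pos_pos add_nonneg_pos) auto
  then show ?thesis unfolding window_def[abs_def]
    by (intro continuous_intros) (metis less_irrefl)
qed

lemma window_eq_fourier_bump:
  "complex_of_real (window y) = - of_real (pi / 12) * (LINT x|lborel. of_real (bump (2 * pi) x) * cis (- (2 * pi * y) * x))"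
proof -
  have "window y = - (pi / 12) * (- (12 / pi) * window y)" by simp
  then have "complex_of_real (window y) = of_real (- (pi / 12) * (- (12 / pi) * window y))" by (rule arg_cong)
  then show ?thesis unfolding fourier_bump window_def[symmetric] of_real_mult[of "- (pi / 12)"] of_real_minus .
qed

lemma gabor_system_eq:
  "window_system \<alpha> \<beta> (k, m) x = cis (2 * pi * \<beta> * of_int m * x) * of_real (window (x - \<alpha> * of_int k))"
  by (simp add: gabor_system_def cis_conv_exp algebra_simps)

lemma cnj_gabor_system_eq:
  "cnj (window_system \<alpha> \<beta> (k, m) x) =
     - of_real (pi / 12) * cis (- (2 * pi * \<alpha> * \<beta> * of_int k * of_int m)) *
       (LINT \<xi>|lborel. of_real (bump (2 * pi) (\<xi> - \<beta> * of_int m)) * (cis (- (2 * pi * x * \<xi>)) * cis (2 * pi * \<alpha> * of_int k * \<xi>)))"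
proof -
  define y where "y = x - \<alpha> * of_int k"
  \<comment> \<open>The modulation \<open>exp(-2\<pi>i\<beta>mx)\<close> is absorbed by translating \<open>\<xi>\<close> by \<open>\<beta>m\<close>.\<close>
  have ph: "cis (- (2 * pi * \<beta> * of_int m * x)) * cis (- (2 * pi * y) * (\<xi> - \<beta> * of_int m))
      = cis (- (2 * pi * \<alpha> * \<beta> * of_int k * of_int m)) * (cis (- (2 * pi * x * \<xi>)) * cis (2 * pi * \<alpha> * of_int k * \<xi>))" for \<xi>
    unfolding cis_mult y_def by (intro arg_cong[where f = cis]) (simp add: algebra_simps)
  let ?J = "LINT \<xi>|lborel. of_real (bump (2 * pi) (\<xi> - \<beta> * of_int m)) * cis (- (2 * pi * y) * (\<xi> - \<beta> * of_int m))"
  have "(LINT \<xi>|lborel. of_real (bump (2 * pi) \<xi>) * cis (- (2 * pi * y) * \<xi>))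
      = ?J"
    using lborel_integral_real_affine[of 1 "\<lambda>\<xi>. of_real (bump (2 * pi) \<xi>) * cis (- (2 * pi * y) * \<xi>)" "- \<beta> * of_int m"]
    by (simp add: algebra_simps)
  with window_eq_fourier_bump[of y] have win: "complex_of_real (window y) = - of_real (pi / 12) *
       ?J"
    by (simp only:)
  have "cnj (window_system \<alpha> \<beta> (k, m) x) = cis (- (2 * pi * \<beta> * of_int m * x)) * of_real (window y)"
    by (simp add: gabor_system_eq cis_cnj y_def)
  also have "\<dots> = - of_real (pi / 12) * (cis (- (2 * pi * \<beta> * of_int m * x)) *
       ?J)"
    unfolding win by (rule mult.left_commute)
  also have "cis (- (2 * pi * \<beta> * of_int m * x)) *
       ?J
     = (LINT \<xi>|lborel. cis (- (2 * pi * \<alpha> * \<beta> * of_int k * of_int m)) * (of_real (bump (2 * pi) (\<xi> - \<beta> * of_int m)) * (cis (- (2 * pi * x * \<xi>)) * cis (2 * pi * \<alpha> * of_int k * \<xi>))))"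
    unfolding integral_mult_right_zero[symmetric] mult.left_commute[of _ "of_real _"] ph ..
  finally show ?thesis by (simp only: integral_mult_right_zero mult.assoc)
qed

text \<open>Exchange of the integrals over \<open>x\<close> and \<open>\<xi>\<close> after the window is written as a Fourier integral. The
translation of \<open>\<phi>\<close> by \<open>\<beta>m\<close> rather than of the transform of \<open>f\<close> is deliberate: it leaves the sequence
\<open>fourier f (\<xi> + pn)\<close> independent of \<open>m\<close>, at the cost of a phase.\<close>

lemma L2_inner_gabor:
  assumes R: "R > 0" and f: "continuous_on UNIV f" and supp: "\<forall>x. \<bar>x\<bar> \<ge> R \<longrightarrow> f x = 0"
  shows "L2_inner f (window_system \<alpha> \<beta> (k, m)) =
     - of_real (pi / 12) * cis (- (2 * pi * \<alpha> * \<beta> * of_int k * of_int m)) *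
       (LINT \<xi>|lborel. (fourier f \<xi> * of_real (bump (2 * pi) (\<xi> - \<beta> * of_int m))) * cis (2 * pi * \<alpha> * of_int k * \<xi>))"
proof -
  define c where "c = - of_real (pi / 12) * cis (- (2 * pi * \<alpha> * \<beta> * of_int k * of_int m))"
  define B where "B = (\<lambda>\<xi>. complex_of_real (bump (2 * pi) (\<xi> - \<beta> * of_int m)))"
  define G where "G = (\<lambda>\<xi>. cis (2 * pi * \<alpha> * of_int k * \<xi>))"
  define F where "F = (\<lambda>x \<xi>. f x * (B \<xi> * (cis (- (2 * pi * x * \<xi>)) * G \<xi>)))"
  have B_int: "integrable lborel (\<lambda>\<xi>. bump (2 * pi) (\<xi> - \<beta> * of_int m))"
    using lborel_integrable_real_affine[OF integrable_bump[of "2 * pi"], of 1 "- \<beta> * of_int m"] by simp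
  have norm_F: "cmod (F x \<xi>) = cmod (f x) * bump (2 * pi) (\<xi> - \<beta> * of_int m)" for x \<xi>
    by (simp add: F_def B_def G_def norm_mult bump_nonneg)
  have F_cont: "continuous_on UNIV (\<lambda>p. F (fst p) (snd p))"
    unfolding F_def B_def G_def by (intro continuous_intros continuous_on_compose2[OF f]) auto
  have F_int: "integrable (lborel \<Otimes>\<^sub>M lborel) (case_prod F)"
  proof (rule lborel_pair.Fubini_integrable)
    show "case_prod F \<in> borel_measurable (lborel \<Otimes>\<^sub>M lborel)"
      using borel_measurable_continuous_onI[OF F_cont] by (simp add: lborel_prod split_beta')
    have "integrable lborel (\<lambda>x. cmod (f x) * (LINT \<xi>|lborel. bump (2 * pi) (\<xi> - \<beta> * of_int m)))"
      using integrable_if_cutoff[OF R f supp] by (intro integrable_mult_left integrable_norm)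
    then show "integrable lborel (\<lambda>x. LINT \<xi>|lborel. norm (case_prod F (x, \<xi>)))"
      by (simp add: norm_F)
    show "AE x in lborel. integrable lborel (\<lambda>\<xi>. case_prod F (x, \<xi>))"
    proof (rule AE_I2)
      fix x
      have "continuous_on UNIV (F x)"
        unfolding F_def B_def G_def by (intro continuous_intros)
      then have meas: "F x \<in> borel_measurable lborel" by (simp add: borel_measurable_continuous_onI)
      have "integrable lborel (\<lambda>\<xi>. cmod (f x) * bump (2 * pi) (\<xi> - \<beta> * of_int m))"
        using B_int by (rule integrable_mult_right)
      then have "integrable lborel (F x)"
        by (rule Bochner_Integration.integrable_bound[OF _ meas]) (auto simp: norm_F bump_nonneg abs_mult)
      then show "integrable lborel (\<lambda>\<xi>. case_prod F (x, \<xi>))" by simp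
    qed
  qed
  have "L2_inner f (window_system \<alpha> \<beta> (k, m))
      = (LINT x|lborel. f x * cnj (window_system \<alpha> \<beta> (k, m) x))"
    unfolding L2_inner_def
  proof (rule integral_completion)
    have "continuous_on UNIV (\<lambda>x. f x * cnj (window_system \<alpha> \<beta> (k, m) x))"
      unfolding gabor_system_eq by (intro continuous_intros f continuous_on_compose2[OF continuous_on_window[of UNIV]]) auto
    then show "(\<lambda>x. f x * cnj (window_system \<alpha> \<beta> (k, m) x)) \<in> borel_measurable lborel"
      by (simp add: borel_measurable_continuous_onI)
  qed
  also have "\<dots> = (LINT x|lborel. c * (LINT \<xi>|lborel. F x \<xi>))"
    unfolding cnj_gabor_system_eq c_def[symmetric] F_def B_def G_def
    by (simp only: integral_mult_right_zero mult.left_commute[of "f _" c])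
  also have "\<dots> = c * (LINT x|lborel. (LINT \<xi>|lborel. F x \<xi>))"
    by (rule integral_mult_right_zero)
  also have "(LINT x|lborel. (LINT \<xi>|lborel. F x \<xi>)) = (LINT \<xi>|lborel. (LINT x|lborel. F x \<xi>))"
    by (rule lborel_pair.Fubini_integral[OF F_int, symmetric])
  also have "\<dots> = (LINT \<xi>|lborel. (fourier f \<xi> * B \<xi>) * G \<xi>)"
  proof (rule Bochner_Integration.integral_cong[OF refl])
    fix \<xi>
    have "F x \<xi> = (f x * cis (- (2 * pi * x * \<xi>))) * (B \<xi> * G \<xi>)" for x by (simp add: F_def)
    then have "(LINT x|lborel. F x \<xi>) = fourier f \<xi> * (B \<xi> * G \<xi>)"
      unfolding fourier_def[OF R f supp] by (simp only: integral_mult_left_zero)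
    then show "(LINT x|lborel. F x \<xi>) = (fourier f \<xi> * B \<xi>) * G \<xi>"
      by (simp only: mult.assoc)
  qed
  finally show ?thesis by (simp only: c_def B_def G_def)
qed

text \<open>For fixed \<open>m\<close> the coefficients are Fourier coefficients of a periodization with period \<open>p = 1/\<alpha>\<close>, and
rescaling \<open>\<xi>\<close> by \<open>p\<close> turns that periodization into a row of the matrix of \<open>bump_frame_bounds\<close>.\<close>

lemma gabor_coefficient_sum:
  fixes \<alpha> \<beta> :: real and m :: int
  assumes R: "R > 0" and f: "continuous_on UNIV f" and supp: "\<forall>x. \<bar>x\<bar> \<ge> R \<longrightarrow> f x = 0" and \<alpha>: "\<alpha> > 0"
  defines "p \<equiv> 1 / \<alpha>"
  defines "Q \<equiv> \<lambda>\<xi>. ennreal ((cmod (\<Sum>\<^sub>\<infinity>n. fourier f (\<xi> + p * of_int n) * of_real (bump (2 * pi * p) (\<xi> / p + of_int n - \<alpha> * \<beta> * of_int m))))\<^sup>2) * indicator {0..<p} \<xi>"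
  shows "(\<Sum>\<^sup>+k. ennreal ((cmod (L2_inner f (window_system \<alpha> \<beta> (k, m))))\<^sup>2))
     = ennreal ((pi / 12)\<^sup>2 * p) * (\<integral>\<^sup>+\<xi>. Q \<xi> \<partial>lborel)"
    and "Q \<in> borel_measurable borel"
proof -
  have p: "p > 0" using \<alpha> by (simp add: p_def)
  define h where "h = (\<lambda>\<xi>. fourier f \<xi> * of_real (bump (2 * pi) (\<xi> - \<beta> * of_int m)))"
  define C where "C = (LINT x|lborel. cmod (f x)) * exp (2 * pi * \<bar>\<beta> * of_int m\<bar>)"
  have h_cont: "continuous_on UNIV h"
    unfolding h_def by (intro continuous_intros continuous_on_fourier[OF R f supp])
  have decay: "cmod (h \<xi>) \<le> C * exp (- (2 * pi) * \<bar>\<xi>\<bar>)" for \<xi>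
  proof -
    have "2 * pi * \<bar>\<xi>\<bar> \<le> 2 * pi * (\<bar>\<xi> - \<beta> * of_int m\<bar> + \<bar>\<beta> * of_int m\<bar>)"
      by (intro mult_left_mono) auto
    then have "exp (- (2 * pi) * \<bar>\<xi> - \<beta> * of_int m\<bar>) \<le> exp (2 * pi * \<bar>\<beta> * of_int m\<bar>) * exp (- (2 * pi) * \<bar>\<xi>\<bar>)"
      by (simp add: mult_exp_exp algebra_simps)
    then have "bump (2 * pi) (\<xi> - \<beta> * of_int m) \<le> exp (2 * pi * \<bar>\<beta> * of_int m\<bar>) * exp (- (2 * pi) * \<bar>\<xi>\<bar>)"
      using bump_le[of "2 * pi" "\<xi> - \<beta> * of_int m"] by simp
    then have "cmod (h \<xi>) \<le> (LINT x|lborel. cmod (f x)) * (exp (2 * pi * \<bar>\<beta> * of_int m\<bar>) * exp (- (2 * pi) * \<bar>\<xi>\<bar>))"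
      unfolding h_def norm_mult norm_of_real abs_of_nonneg[OF bump_nonneg]
      by (intro mult_mono fourier_bounded[OF R f supp]) (auto simp: bump_nonneg intro!: integral_nonneg_AE)
    then show ?thesis by (simp add: C_def mult.assoc)
  qed
  define P where "P = (\<lambda>\<xi>. \<Sum>\<^sub>\<infinity>n. h (\<xi> + p * of_int n))"
  have P_eq: "P \<xi> = (\<Sum>\<^sub>\<infinity>n. fourier f (\<xi> + p * of_int n) * of_real (bump (2 * pi * p) (\<xi> / p + of_int n - \<alpha> * \<beta> * of_int m)))" for \<xi>
    unfolding P_def h_def
  proof (intro infsum_cong arg_cong2[where f = "(*)"] arg_cong[where f = of_real] refl)
    fix n :: int
    have "\<xi> + p * of_int n - \<beta> * of_int m = p * (\<xi> / p + of_int n - \<alpha> * \<beta> * of_int m)"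
      using \<alpha> by (simp add: p_def field_simps)
    then show "bump (2 * pi) (\<xi> + p * of_int n - \<beta> * of_int m) = bump (2 * pi * p) (\<xi> / p + of_int n - \<alpha> * \<beta> * of_int m)"
      using bump_scale[OF p] by simp
  qed
  have P_cont: "continuous_on {0..p} P"
    unfolding P_def by (rule continuous_on_periodization[OF p _ h_cont decay]) simp
  have Q_eq: "Q \<xi> = ennreal (indicator {0..<p} \<xi> *\<^sub>R (cmod (P \<xi>))\<^sup>2)" for \<xi>
    by (simp add: Q_def P_eq split: split_indicator)
  have "continuous_on {0..<p} (\<lambda>\<xi>. (cmod (P \<xi>))\<^sup>2)"
    by (intro continuous_intros continuous_on_subset[OF P_cont]) auto
  then have "(\<lambda>\<xi>. indicator {0..<p} \<xi> *\<^sub>R (cmod (P \<xi>))\<^sup>2) \<in> borel_measurable borel"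
    by (intro borel_measurable_continuous_on_indicator) auto
  then show Q_meas: "Q \<in> borel_measurable borel"
    unfolding Q_eq[abs_def] by measurable
  define I where "I = integral {0..p} (\<lambda>\<xi>. (cmod (P \<xi>))\<^sup>2)"
  have I_eq: "(\<integral>\<^sup>+\<xi>. Q \<xi> \<partial>lborel) = ennreal I"
  proof -
    have s: "set_integrable lborel {0..p} (\<lambda>\<xi>. (cmod (P \<xi>))\<^sup>2)"
      by (intro borel_integrable_atLeastAtMost' continuous_intros P_cont)
    have "AE \<xi> in lborel. \<xi> \<noteq> p" by (rule AE_lborel_singleton)
    then have "AE \<xi> in lborel. Q \<xi> = ennreal (indicator {0..p} \<xi> *\<^sub>R (cmod (P \<xi>))\<^sup>2)"
      by eventually_elim (auto simp: Q_eq split: split_indicator)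
    then have "(\<integral>\<^sup>+\<xi>. Q \<xi> \<partial>lborel) = (\<integral>\<^sup>+\<xi>. ennreal (indicator {0..p} \<xi> *\<^sub>R (cmod (P \<xi>))\<^sup>2) \<partial>lborel)"
      by (rule nn_integral_cong_AE)
    also have "\<dots> = ennreal (LINT \<xi>|lborel. indicator {0..p} \<xi> *\<^sub>R (cmod (P \<xi>))\<^sup>2)"
      using s unfolding set_integrable_def by (intro nn_integral_eq_integral) auto
    also have "(LINT \<xi>|lborel. indicator {0..p} \<xi> *\<^sub>R (cmod (P \<xi>))\<^sup>2) = I"
      using set_borel_integral_eq_integral(2)[OF s] by (simp add: set_lebesgue_integral_def I_def)
    finally show ?thesis .
  qed
  have coeff: "(cmod (L2_inner f (window_system \<alpha> \<beta> (k, m))))\<^sup>2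
     = (pi / 12)\<^sup>2 * (cmod (LINT \<xi>|lborel. h \<xi> * cnj (trig_char p (- k) \<xi>)))\<^sup>2" for k
  proof -
    have "cnj (trig_char p (- k) \<xi>) = cis (2 * pi * \<alpha> * of_int k * \<xi>)" for \<xi>
      by (simp add: trig_char_def cis_cnj p_def mult_ac)
    then show ?thesis unfolding L2_inner_gabor[OF R f supp] h_def
      by (simp add: norm_mult norm_divide power_mult_distrib power_divide)
  qed
  have "((\<lambda>k. (cmod (LINT \<xi>|lborel. h \<xi> * cnj (trig_char p k \<xi>)))\<^sup>2) has_sum p * I) UNIV"
    unfolding I_def P_def by (rule parseval_periodization[OF p _ h_cont decay]) simp
  then have "((\<lambda>k. (cmod (LINT \<xi>|lborel. h \<xi> * cnj (trig_char p (- k) \<xi>)))\<^sup>2) has_sum p * I) UNIV"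
    using has_sum_reindex_bij_betw[OF bij_uminus[where 'a = int], of "\<lambda>k. (cmod (LINT \<xi>|lborel. h \<xi> * cnj (trig_char p k \<xi>)))\<^sup>2"] by simp
  then have hs: "((\<lambda>k. (cmod (L2_inner f (window_system \<alpha> \<beta> (k, m))))\<^sup>2) has_sum (pi / 12)\<^sup>2 * (p * I)) UNIV"
    unfolding coeff by (rule has_sum_cmult_right)
  let ?S = "\<Sum>\<^sup>+k. ennreal ((cmod (L2_inner f (window_system \<alpha> \<beta> (k, m))))\<^sup>2)"
  have "?S
      = ennreal ((pi / 12)\<^sup>2 * (p * I))"
    using hs by (subst nn_integral_count_space_infsum) (auto simp: infsumI dest: has_sum_imp_summable)
  also have "\<dots> = ennreal ((pi / 12)\<^sup>2 * p) * ennreal I"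
    using p by (subst ennreal_mult'[symmetric]) (auto simp: mult.assoc)
  finally show "?S
     = ennreal ((pi / 12)\<^sup>2 * p) * (\<integral>\<^sup>+\<xi>. Q \<xi> \<partial>lborel)"
    unfolding I_eq .
qed

text \<open>Summing over \<open>m\<close> inside the integral over \<open>\<xi>\<close> allows the matrix bounds to be applied for each \<open>\<xi>\<close> to
\<open>c\<^sub>n = fourier f (\<xi> + pn)\<close>. The resulting integral of \<open>\<Sum>\<^sub>n \<bar>c\<^sub>n\<bar>\<^sup>2\<close> over a period is the squared norm of
\<open>f\<close> by Plancherel.\<close>

lemma gabor_frame_bounds_cutoff:
  fixes \<alpha> \<beta> :: real
  assumes \<alpha>: "\<alpha> > 0" and \<beta>: "\<beta> > 0" and \<alpha>\<beta>: "\<alpha> * \<beta> < 1 / 3"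
  defines "S \<equiv> \<lambda>f. \<integral>\<^sup>+i. ennreal ((cmod (L2_inner f (window_system \<alpha> \<beta> i)))\<^sup>2) \<partial>count_space UNIV"
  shows "\<exists>A>0. \<exists>B>0. \<forall>R f. R > 0 \<longrightarrow> continuous_on UNIV f \<longrightarrow> (\<forall>x. \<bar>x\<bar> \<ge> R \<longrightarrow> f x = 0) \<longrightarrow>
     ennreal (A * (LINT x|lborel. (cmod (f x))\<^sup>2)) \<le> S f \<and> S f \<le> ennreal (B * (LINT x|lborel. (cmod (f x))\<^sup>2))"
proof -
  define p where "p = 1 / \<alpha>"
  have p: "p > 0" using \<alpha> by (simp add: p_def)
  define K where "K = (pi / 12)\<^sup>2 * p"
  have K: "K > 0" using p by (simp add: K_def)
  define \<Phi> where "\<Phi> = (\<lambda>x (c :: int \<Rightarrow> complex) m. ennreal ((cmod (\<Sum>\<^sub>\<infinity>n. c n * of_real (bump (2 * pi * p) (x + of_int n - \<alpha> * \<beta> * of_int m))))\<^sup>2))"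
  have "2 * pi * p > 0" "0 < \<alpha> * \<beta>" using p \<alpha> \<beta> by simp_all
  from bump_frame_bounds[OF this \<alpha>\<beta>, folded \<Phi>_def]
  obtain A B where AB: "A > 0" "B > 0" and bounds: "\<forall>x (c :: int \<Rightarrow> complex) M. (\<forall>n. cmod (c n) \<le> M) \<longrightarrow>
     ennreal A * csquare_sum c \<le> (\<Sum>\<^sup>+m. \<Phi> x c m) \<and>
     (\<Sum>\<^sup>+m. \<Phi> x c m) \<le> ennreal B * csquare_sum c"
    unfolding \<Phi>_def by blast
  have main: "ennreal (K * A * (LINT x|lborel. (cmod (f x))\<^sup>2)) \<le> S f \<and> S f \<le> ennreal (K * B * (LINT x|lborel. (cmod (f x))\<^sup>2))"
    if R: "R > 0" and f: "continuous_on UNIV f" and supp: "\<forall>x. \<bar>x\<bar> \<ge> R \<longrightarrow> f x = 0" for R f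
  proof -
    define N where "N = (LINT x|lborel. (cmod (f x))\<^sup>2)"
    have "N \<ge> 0" unfolding N_def by (intro integral_nonneg_AE) auto
    define c where "c = (\<lambda>\<xi> n. fourier f (\<xi> + p * of_int n))"
    have c_bdd: "\<forall>n. cmod (c \<xi> n) \<le> (LINT x|lborel. cmod (f x))" for \<xi>
      unfolding c_def using fourier_bounded[OF R f supp] by blast
    note gcs = gabor_coefficient_sum[OF R f supp \<alpha>, folded p_def, folded K_def]
    let ?I = "\<integral>\<^sup>+\<xi>. (\<Sum>\<^sup>+m. \<Phi> (\<xi> / p) (c \<xi>) m) * indicator {0..<p} \<xi> \<partial>lborel"
    have "S f = (\<Sum>\<^sup>+m. (\<Sum>\<^sup>+k. ennreal ((cmod (L2_inner f (window_system \<alpha> \<beta> (k, m))))\<^sup>2)))"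
      unfolding S_def by (rule nn_integral_snd_count_space[symmetric])
    also have "\<dots> = (\<Sum>\<^sup>+m. ennreal K * (\<integral>\<^sup>+\<xi>. \<Phi> (\<xi> / p) (c \<xi>) m * indicator {0..<p} \<xi> \<partial>lborel))"
      unfolding gcs(1) \<Phi>_def c_def ..
    also have "\<dots> = ennreal K * (\<Sum>\<^sup>+m. (\<integral>\<^sup>+\<xi>. \<Phi> (\<xi> / p) (c \<xi>) m * indicator {0..<p} \<xi> \<partial>lborel))"
      by (rule nn_integral_cmult) auto
    also have "(\<Sum>\<^sup>+m. (\<integral>\<^sup>+\<xi>. \<Phi> (\<xi> / p) (c \<xi>) m * indicator {0..<p} \<xi> \<partial>lborel))
        = (\<integral>\<^sup>+\<xi>. (\<Sum>\<^sup>+m. \<Phi> (\<xi> / p) (c \<xi>) m * indicator {0..<p} \<xi>) \<partial>lborel)"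
      using gcs(2)[of \<beta>] by (intro nn_integral_count_space_nn_integral[symmetric]) (auto simp: \<Phi>_def c_def)
    also have "\<dots> = ?I"
      by (intro nn_integral_cong nn_integral_multc) auto
    finally have S_eq: "S f = ennreal K * ?I" .
    have F_meas: "(\<lambda>\<xi>. ennreal ((cmod (fourier f \<xi>))\<^sup>2)) \<in> borel_measurable borel"
      by (intro measurable_compose[OF _ measurable_ennreal] borel_measurable_continuous_onI continuous_intros continuous_on_fourier[OF R f supp])
    have c_meas: "(\<lambda>\<xi>. (\<Sum>\<^sup>+n. ennreal ((cmod (c \<xi> n))\<^sup>2)) * indicator {0..<p} \<xi>) \<in> borel_measurable lborel"
    proof -
      have c_n: "(\<lambda>\<xi>. ennreal ((cmod (c \<xi> n))\<^sup>2)) \<in> borel_measurable borel" for n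
        unfolding c_def
        by (intro measurable_compose[OF _ measurable_ennreal] borel_measurable_continuous_onI continuous_intros
            continuous_on_compose2[OF continuous_on_fourier[OF R f supp]]) auto
      have "(\<Sum>\<^sup>+n. ennreal ((cmod (c \<xi> n))\<^sup>2)) = (\<Sum>i. ennreal ((cmod (c \<xi> (int_decode i)))\<^sup>2))" for \<xi>
        using nn_integral_bij_count_space[OF bij_int_decode, of "\<lambda>n. ennreal ((cmod (c \<xi> n))\<^sup>2)"]
        by (simp add: nn_integral_count_space_nat[symmetric])
      then have [measurable]: "(\<lambda>\<xi>. (\<Sum>\<^sup>+n. ennreal ((cmod (c \<xi> n))\<^sup>2))) \<in> borel_measurable borel"
        using borel_measurable_suminf_order[of "\<lambda>i \<xi>. ennreal ((cmod (c \<xi> (int_decode i)))\<^sup>2)" borel, OF c_n] by simp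
      have "(\<lambda>\<xi>. indicator {0..<p} \<xi> :: ennreal) \<in> borel_measurable borel" by measurable
      then show ?thesis by (simp add: borel_measurable_times_ennreal)
    qed
    have "ennreal N = (\<integral>\<^sup>+\<xi>. ennreal ((cmod (fourier f \<xi>))\<^sup>2) \<partial>lborel)"
      unfolding N_def by (rule plancherel[OF R f supp, symmetric])
    also have "\<dots> = (\<integral>\<^sup>+\<xi>. (\<Sum>\<^sup>+n. ennreal ((cmod (c \<xi> n))\<^sup>2)) * indicator {0..<p} \<xi> \<partial>lborel)"
      unfolding c_def by (rule nn_integral_periodization[OF p F_meas])
    finally have N_eq: "ennreal N = (\<integral>\<^sup>+\<xi>. (\<Sum>\<^sup>+n. ennreal ((cmod (c \<xi> n))\<^sup>2)) * indicator {0..<p} \<xi> \<partial>lborel)" .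
    have "ennreal A * ennreal N \<le> ?I"
      unfolding N_eq nn_integral_cmult[OF c_meas, symmetric] mult.assoc[symmetric]
      by (intro nn_integral_mono mult_right_mono conjunct1[OF bounds[rule_format, OF c_bdd[rule_format]]]) auto
    then have "ennreal K * (ennreal A * ennreal N) \<le> S f" unfolding S_eq by (rule mult_left_mono) simp
    moreover have "?I \<le> ennreal B * ennreal N"
      unfolding N_eq nn_integral_cmult[OF c_meas, symmetric] mult.assoc[symmetric]
      by (intro nn_integral_mono mult_right_mono conjunct2[OF bounds[rule_format, OF c_bdd[rule_format]]]) auto
    then have "S f \<le> ennreal K * (ennreal B * ennreal N)" unfolding S_eq by (rule mult_left_mono) simp
    ultimately show ?thesis
      using K AB \<open>N \<ge> 0\<close> by (simp add: N_def[symmetric] ennreal_mult' mult.assoc)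
  qed
  show ?thesis
    using main K AB by (intro exI[of _ "K * A"] conjI exI[of _ "K * B"]) auto
qed

section \<open>Passage from a dense class to all square integrable functions\<close>

lemma L2_inner_cauchy_schwarz:
  assumes u: "u \<in> L2_fun" and v: "v \<in> L2_fun"
  shows "integrable lebesgue (\<lambda>x. u x * cnj (v x))"
    and "(cmod (L2_inner u v))\<^sup>2 \<le> (LINT x|lebesgue. (cmod (u x))\<^sup>2) * (LINT x|lebesgue. (cmod (v x))\<^sup>2)"
proof -
  have [measurable]: "u \<in> borel_measurable lebesgue" "v \<in> borel_measurable lebesgue"
    and int: "integrable lebesgue (\<lambda>x. (cmod (u x))\<^sup>2)" "integrable lebesgue (\<lambda>x. (cmod (v x))\<^sup>2)"
    using u v by (auto simp: L2_fun_def)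
  have [measurable]: "cnj \<in> borel_measurable borel"
    by (intro borel_measurable_continuous_onI continuous_intros)
  have sq: "(\<integral>\<^sup>+x. (ennreal (cmod (w x)))\<^sup>2 \<partial>lebesgue) = ennreal (LINT x|lebesgue. (cmod (w x))\<^sup>2)"
    if "integrable lebesgue (\<lambda>x. (cmod (w x))\<^sup>2)" for w :: "real \<Rightarrow> complex"
    using nn_integral_eq_integral[OF that] by (simp add: ennreal_power)
  have nonneg: "0 \<le> (LINT x|lebesgue. (cmod (w x))\<^sup>2)" for w :: "real \<Rightarrow> complex"
    by (intro integral_nonneg_AE) auto
  have cs: "(\<integral>\<^sup>+x. ennreal (cmod (u x * cnj (v x))) \<partial>lebesgue)\<^sup>2
      \<le> ennreal ((LINT x|lebesgue. (cmod (u x))\<^sup>2) * (LINT x|lebesgue. (cmod (v x))\<^sup>2))"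
    using Cauchy_Schwarz_nn_integral[of "\<lambda>x. ennreal (cmod (u x))" lebesgue "\<lambda>x. ennreal (cmod (v x))"]
    by (simp add: sq[OF int(1)] sq[OF int(2)] norm_mult ennreal_mult' nonneg)
  then have "(\<integral>\<^sup>+x. ennreal (cmod (u x * cnj (v x))) \<partial>lebesgue)\<^sup>2 < \<infinity>"
    by (rule order_le_less_trans) simp
  then have "(\<integral>\<^sup>+x. ennreal (cmod (u x * cnj (v x))) \<partial>lebesgue) < \<infinity>"
    by (simp add: power_less_top_ennreal)
  then show i: "integrable lebesgue (\<lambda>x. u x * cnj (v x))"
    by (intro integrableI_bounded) auto
  have "ennreal ((cmod (L2_inner u v))\<^sup>2) \<le> (ennreal (LINT x|lebesgue. cmod (u x * cnj (v x))))\<^sup>2"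
    unfolding L2_inner_def ennreal_power[OF norm_ge_zero, symmetric]
    by (intro power_mono ennreal_leI integral_norm_bound) auto
  also have "\<dots> = (\<integral>\<^sup>+x. ennreal (cmod (u x * cnj (v x))) \<partial>lebesgue)\<^sup>2"
    using i by (subst nn_integral_eq_integral) auto
  also note cs
  finally show "(cmod (L2_inner u v))\<^sup>2 \<le> (LINT x|lebesgue. (cmod (u x))\<^sup>2) * (LINT x|lebesgue. (cmod (v x))\<^sup>2)"
    using nonneg by (simp add: ennreal_le_iff)
qed

lemma norm_diff_square_le: "(cmod (a - b))\<^sup>2 \<le> 2 * (cmod a)\<^sup>2 + 2 * (cmod b)\<^sup>2"
proof -
  have "(cmod (a - b))\<^sup>2 \<le> (cmod a + cmod b)\<^sup>2" by (intro power_mono norm_triangle_ineq4) auto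
  also have "\<dots> \<le> 2 * (cmod a)\<^sup>2 + 2 * (cmod b)\<^sup>2"
    using sum_squares_bound[of "cmod a" "cmod b"] by (simp add: power2_sum)
  finally show ?thesis .
qed

lemma L2_fun_diff:
  assumes "u \<in> L2_fun" "v \<in> L2_fun"
  shows "(\<lambda>x. u x - v x) \<in> L2_fun"
    and "(LINT x|lebesgue. (cmod (u x - v x))\<^sup>2) \<le> 2 * (LINT x|lebesgue. (cmod (u x))\<^sup>2) + 2 * (LINT x|lebesgue. (cmod (v x))\<^sup>2)"
proof -
  have [measurable]: "u \<in> borel_measurable lebesgue" "v \<in> borel_measurable lebesgue"
    and int: "integrable lebesgue (\<lambda>x. (cmod (u x))\<^sup>2)" "integrable lebesgue (\<lambda>x. (cmod (v x))\<^sup>2)"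
    using assms by (auto simp: L2_fun_def)
  have int2: "integrable lebesgue (\<lambda>x. 2 * (cmod (u x))\<^sup>2 + 2 * (cmod (v x))\<^sup>2)"
    using int by simp
  have i: "integrable lebesgue (\<lambda>x. (cmod (u x - v x))\<^sup>2)"
    by (rule Bochner_Integration.integrable_bound[OF int2]) (use norm_diff_square_le in \<open>auto intro!: AE_I2\<close>)
  then show "(\<lambda>x. u x - v x) \<in> L2_fun" by (simp add: L2_fun_def)
  have "(LINT x|lebesgue. (cmod (u x - v x))\<^sup>2) \<le> (LINT x|lebesgue. 2 * (cmod (u x))\<^sup>2 + 2 * (cmod (v x))\<^sup>2)"
    by (intro integral_mono i int2 norm_diff_square_le)
  also have "\<dots> = 2 * (LINT x|lebesgue. (cmod (u x))\<^sup>2) + 2 * (LINT x|lebesgue. (cmod (v x))\<^sup>2)"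
    using int by simp
  finally show "(LINT x|lebesgue. (cmod (u x - v x))\<^sup>2) \<le> \<dots>" .
qed

text \<open>For finitely many frame elements the inner products are continuous in \<open>L\<^sup>2\<close>, which extends the
upper bound and thereby summability. With the upper bound in hand the whole coefficient
sum is continuous in \<open>L\<^sup>2\<close>, which extends the lower bound. Using \<open>\<bar>u + v\<bar>\<^sup>2 \<le> 2\<bar>u\<bar>\<^sup>2 + 2\<bar>v\<bar>\<^sup>2\<close> in place
of Minkowski's inequality costs a factor \<open>4\<close> in each constant.\<close>

lemma is_L2_frame_of_dense:
  fixes e :: "'i \<Rightarrow> real \<Rightarrow> complex"
  defines "N \<equiv> \<lambda>u. LINT x|lebesgue. (cmod (u x))\<^sup>2"
  assumes e: "\<And>i. e i \<in> L2_fun" and AB: "A > 0" "B > 0"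
    and D: "D \<subseteq> L2_fun"
    and dense: "\<And>f \<epsilon>. f \<in> L2_fun \<Longrightarrow> \<epsilon> > 0 \<Longrightarrow> \<exists>h\<in>D. N (\<lambda>x. f x - h x) < \<epsilon>"
    and bounds: "\<And>h. h \<in> D \<Longrightarrow> ennreal (A * N h) \<le> (\<Sum>\<^sup>+i. ennreal ((cmod (L2_inner h (e i)))\<^sup>2))"
      "\<And>h. h \<in> D \<Longrightarrow> (\<Sum>\<^sup>+i. ennreal ((cmod (L2_inner h (e i)))\<^sup>2)) \<le> ennreal (B * N h)"
  shows "is_L2_frame e"
proof -
  have N0: "N u \<ge> 0" for u unfolding N_def by (intro integral_nonneg_AE) auto
  have inner_diff: "L2_inner (\<lambda>x. u x - v x) (e i) = L2_inner u (e i) - L2_inner v (e i)" if "u \<in> L2_fun" "v \<in> L2_fun" for u v i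
    using L2_inner_cauchy_schwarz(1)[OF that(1) e[of i]] L2_inner_cauchy_schwarz(1)[OF that(2) e[of i]]
    by (simp add: L2_inner_def left_diff_distrib)
  have split: "(cmod (L2_inner u (e i)))\<^sup>2 \<le> 2 * (cmod (L2_inner v (e i)))\<^sup>2 + 2 * (cmod (L2_inner (\<lambda>x. v x - u x) (e i)))\<^sup>2"
    if "u \<in> L2_fun" "v \<in> L2_fun" for u v i
    using norm_diff_square_le[of "L2_inner v (e i)" "L2_inner (\<lambda>x. v x - u x) (e i)"] inner_diff[OF that(2,1)] by simp
  have N_split: "N u \<le> 2 * N v + 2 * N (\<lambda>x. v x - u x)" if "u \<in> L2_fun" "v \<in> L2_fun" for u v
    using L2_fun_diff(2)[OF that(2) L2_fun_diff(1)[OF that(2,1)]] by (simp add: N_def)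
  have N_sym: "N (\<lambda>x. u x - v x) = N (\<lambda>x. v x - u x)" for u v
    by (simp add: N_def norm_minus_commute)
  have fin: "(\<Sum>i\<in>X. (cmod (L2_inner h (e i)))\<^sup>2) \<le> B * N h" if "h \<in> D" "finite X" for h X
  proof -
    have "ennreal (\<Sum>i\<in>X. (cmod (L2_inner h (e i)))\<^sup>2) = (\<integral>\<^sup>+i. ennreal ((cmod (L2_inner h (e i)))\<^sup>2) \<partial>count_space X)"
      using that(2) by (simp add: nn_integral_count_space_finite)
    also have "\<dots> \<le> (\<Sum>\<^sup>+i. ennreal ((cmod (L2_inner h (e i)))\<^sup>2))"
      by (rule nn_integral_count_space_inj_le[of "\<lambda>i. i"]) simp
    also have "\<dots> \<le> ennreal (B * N h)" by (rule bounds(2)[OF that(1)])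
    finally show ?thesis using N0 AB by (simp add: ennreal_le_iff)
  qed
  have upper_fin: "(\<Sum>i\<in>X. (cmod (L2_inner f (e i)))\<^sup>2) \<le> 4 * B * N f" if f: "f \<in> L2_fun" and X: "finite X" for f X
  proof (rule field_le_epsilon)
    fix \<epsilon> :: real assume \<epsilon>: "\<epsilon> > 0"
    define C where "C = 4 * B + 2 * (\<Sum>i\<in>X. N (e i))"
    have C: "C > 0" unfolding C_def using AB N0 by (intro add_pos_nonneg mult_nonneg_nonneg sum_nonneg) auto
    obtain h where h: "h \<in> D" "N (\<lambda>x. f x - h x) < \<epsilon> / C" using dense[OF f, of "\<epsilon> / C"] \<epsilon> C by auto
    then have hL: "h \<in> L2_fun" using D by auto
    define \<eta> where "\<eta> = N (\<lambda>x. h x - f x)"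
    have \<eta>: "\<eta> < \<epsilon> / C" using h(2) N_sym[of f h] by (simp add: \<eta>_def)
    have "(\<Sum>i\<in>X. (cmod (L2_inner f (e i)))\<^sup>2) \<le> (\<Sum>i\<in>X. 2 * (cmod (L2_inner h (e i)))\<^sup>2 + 2 * (\<eta> * N (e i)))"
    proof (rule sum_mono)
      fix i
      have "(cmod (L2_inner (\<lambda>x. h x - f x) (e i)))\<^sup>2 \<le> \<eta> * N (e i)"
        unfolding \<eta>_def N_def by (rule L2_inner_cauchy_schwarz(2)[OF L2_fun_diff(1)[OF hL f] e])
      then show "(cmod (L2_inner f (e i)))\<^sup>2 \<le> 2 * (cmod (L2_inner h (e i)))\<^sup>2 + 2 * (\<eta> * N (e i))"
        using split[OF f hL, of i] by linarith
    qed
    also have "\<dots> = 2 * (\<Sum>i\<in>X. (cmod (L2_inner h (e i)))\<^sup>2) + \<eta> * (2 * (\<Sum>i\<in>X. N (e i)))"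
      by (simp add: sum.distrib sum_distrib_left mult_ac)
    also have "\<dots> \<le> 2 * (B * N h) + \<eta> * (2 * (\<Sum>i\<in>X. N (e i)))"
      using fin[OF h(1) X] by simp
    also have "\<dots> \<le> 2 * (B * (2 * N f + 2 * \<eta>)) + \<eta> * (2 * (\<Sum>i\<in>X. N (e i)))"
      using N_split[OF hL f] AB N_sym[of f h] by (simp add: \<eta>_def)
    also have "\<dots> = 4 * B * N f + \<eta> * C" by (simp add: C_def algebra_simps)
    also have "\<eta> * C \<le> \<epsilon>" using \<eta> C by (simp add: pos_less_divide_eq)
    finally show "(\<Sum>i\<in>X. (cmod (L2_inner f (e i)))\<^sup>2) \<le> 4 * B * N f + \<epsilon>" by simp
  qed
  have summable: "(\<lambda>i. (cmod (L2_inner f (e i)))\<^sup>2) summable_on UNIV" if "f \<in> L2_fun" for f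
    using upper_fin[OF that] by (intro nonneg_bdd_above_summable_on) (auto intro!: bdd_aboveI2)
  define S where "S = (\<lambda>f. \<Sum>\<^sub>\<infinity>i. (cmod (L2_inner f (e i)))\<^sup>2)"
  have upper: "S f \<le> 4 * B * N f" if "f \<in> L2_fun" for f
    unfolding S_def using upper_fin[OF that] by (intro infsum_le_finite_sums summable[OF that]) auto
  have lower: "A / 4 * N f \<le> S f" if f: "f \<in> L2_fun" for f
  proof (rule field_le_epsilon)
    fix \<epsilon> :: real assume \<epsilon>: "\<epsilon> > 0"
    define C where "C = A / 2 + 4 * B"
    have C: "C > 0" using AB by (simp add: C_def)
    obtain h where h: "h \<in> D" "N (\<lambda>x. f x - h x) < \<epsilon> / C" using dense[OF f, of "\<epsilon> / C"] \<epsilon> C by auto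
    then have hL: "h \<in> L2_fun" using D by auto
    define \<eta> where "\<eta> = N (\<lambda>x. f x - h x)"
    have dL: "(\<lambda>x. f x - h x) \<in> L2_fun" by (rule L2_fun_diff(1)[OF f hL])
    have "ennreal (A * N h) \<le> ennreal (S h)"
      using bounds(1)[OF h(1)] summable[OF hL] by (subst (asm) nn_integral_count_space_infsum) (auto simp: S_def)
    then have "A * N h \<le> S h"
      using infsum_nonneg[of UNIV "\<lambda>i. (cmod (L2_inner h (e i)))\<^sup>2"] by (simp add: ennreal_le_iff S_def)
    also have "S h \<le> (\<Sum>\<^sub>\<infinity>i. 2 * (cmod (L2_inner f (e i)))\<^sup>2 + 2 * (cmod (L2_inner (\<lambda>x. f x - h x) (e i)))\<^sup>2)"
      unfolding S_def by (intro infsum_mono summable hL summable_on_add summable_on_cmult_right f dL split)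
    also have "\<dots> = 2 * S f + 2 * S (\<lambda>x. f x - h x)"
      unfolding S_def using summable[OF f] summable[OF dL]
      by (subst infsum_add) (auto intro: summable_on_cmult_right simp: infsum_cmult_right')
    also have "\<dots> \<le> 2 * S f + 2 * (4 * B * \<eta>)" using upper[OF dL] by (simp add: \<eta>_def)
    finally have 1: "A * N h \<le> 2 * S f + 8 * B * \<eta>" by simp
    have "A * N f \<le> A * (2 * N h + 2 * \<eta>)"
      using N_split[OF f hL] AB N_sym[of f h] by (intro mult_left_mono) (auto simp: \<eta>_def)
    with 1 have "A / 4 * N f \<le> S f + \<eta> * C" by (simp add: C_def algebra_simps)
    moreover have "\<eta> * C \<le> \<epsilon>" using h(2) C by (simp add: \<eta>_def pos_less_divide_eq)
    ultimately show "A / 4 * N f \<le> S f + \<epsilon>" by simp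
  qed
  have norm_eq: "(L2_norm f)\<^sup>2 = N f" for f using N0[of f] by (simp add: L2_norm_def N_def)
  show ?thesis
    unfolding is_L2_frame_def norm_eq
    using e AB summable upper lower
    by (intro conjI allI exI[of _ "A / 4"] exI[of _ "4 * B"] ballI) (auto simp: S_def)
qed

text \<open>A measurable function is an almost everywhere limit of continuous ones. Clipping these at
height \<open>M\<close> and multiplying by a continuous cutoff provides the majorant for dominated convergence.\<close>

lemma bounded_approx_cutoff:
  fixes u :: "real \<Rightarrow> complex"
  assumes u: "u \<in> borel_measurable lebesgue" and M: "M > 0"
    and bdd: "\<And>x. cmod (u x) \<le> M" and supp: "\<And>x. \<bar>x\<bar> > M \<Longrightarrow> u x = 0" and \<epsilon>: "\<epsilon> > 0"
  obtains h where "continuous_on UNIV h" "\<And>x. \<bar>x\<bar> \<ge> M + 1 \<Longrightarrow> h x = 0"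
    "(LINT x|lebesgue. (cmod (u x - h x))\<^sup>2) < \<epsilon>"
proof -
  have "u measurable_on UNIV"
    using u by (simp add: measurable_on_iff_borel_measurable lebesgue_on_UNIV_eq)
  then obtain N g where N: "negligible N" and g: "\<And>n. continuous_on UNIV (g n)"
    and lim: "\<And>x. x \<notin> N \<Longrightarrow> (\<lambda>n. g n x) \<longlonglongrightarrow> u x"
    unfolding measurable_on_def by auto
  define clip where "clip = (\<lambda>z :: complex. of_real (1 / max 1 (cmod z / M)) * z)"
  define cut where "cut = (\<lambda>x :: real. max 0 (min 1 (M + 1 - \<bar>x\<bar>)))"
  define h where "h = (\<lambda>n x. of_real (cut x) * clip (g n x))"
  have clip_cont: "continuous_on UNIV clip"
    unfolding clip_def using M by (intro continuous_intros) (auto simp: max_def)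
  have clip_le: "cmod (clip z) \<le> M" for z
  proof -
    have "cmod z \<le> M * max 1 (cmod z / M)"
      using M by (cases "cmod z \<le> M") (auto simp: max_def field_simps)
    moreover have "cmod (clip z) = cmod z / max 1 (cmod z / M)"
      by (simp add: clip_def norm_mult norm_divide del: of_real_divide)
    ultimately show ?thesis by (simp add: pos_divide_le_eq)
  qed
  have clip_id: "clip z = z" if "cmod z \<le> M" for z
    using that M by (simp add: clip_def max_def)
  have cut: "0 \<le> cut x" "cut x \<le> 1" "\<bar>x\<bar> \<le> M \<Longrightarrow> cut x = 1" "\<bar>x\<bar> \<ge> M + 1 \<Longrightarrow> cut x = 0" for x
    by (auto simp: cut_def)
  have h_cont: "continuous_on UNIV (h n)" for n
    unfolding h_def cut_def by (intro continuous_intros continuous_on_compose2[OF clip_cont g]) auto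
  have h_supp: "h n x = 0" if "\<bar>x\<bar> \<ge> M + 1" for n x
    using cut(4)[OF that] by (simp add: h_def)
  have h_le: "cmod (h n x) \<le> M" for n x
    using mult_mono[OF cut(2)[of x] clip_le[of "g n x"]] cut(1)[of x] by (simp add: h_def norm_mult)
  have h_lim: "(\<lambda>n. h n x) \<longlonglongrightarrow> u x" if "x \<notin> N" for x
  proof -
    have "isCont clip (u x)" using clip_cont by (simp add: continuous_on_eq_continuous_at)
    then have "(\<lambda>n. clip (g n x)) \<longlonglongrightarrow> clip (u x)"
      using lim[OF that] by (rule isCont_tendsto_compose)
    then have "(\<lambda>n. h n x) \<longlonglongrightarrow> of_real (cut x) * clip (u x)"
      unfolding h_def by (intro tendsto_intros)
    moreover have "of_real (cut x) * clip (u x) = u x"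
      using clip_id[OF bdd[of x]] supp[of x] cut(3)[of x] by (cases "\<bar>x\<bar> \<le> M") auto
    ultimately show ?thesis by simp
  qed
  have [measurable]: "h n \<in> borel_measurable lebesgue" for n
    using borel_measurable_continuous_onI[OF h_cont] by (intro measurable_completion) simp
  note u[measurable]
  define w where "w = (\<lambda>x :: real. (2 * M)\<^sup>2 * indicator {- (M + 1)..M + 1} x)"
  have "(\<lambda>n. LINT x|lebesgue. (cmod (u x - h n x))\<^sup>2) \<longlonglongrightarrow> (LINT (x :: real)|lebesgue. 0)"
  proof (rule integral_dominated_convergence[where w = w])
    show "integrable lebesgue w"
      unfolding w_def by (intro integrable_mult_right integrable_real_indicator) (auto simp: emeasure_lborel_Icc_eq)
    have "AE x in lebesgue. x \<notin> N"
      using N by (simp add: negligible_iff_null_sets AE_not_in)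
    then show "AE x in lebesgue. (\<lambda>n. (cmod (u x - h n x))\<^sup>2) \<longlonglongrightarrow> 0"
    proof eventually_elim
      case (elim x)
      have "(\<lambda>n. (cmod (u x - h n x))\<^sup>2) \<longlonglongrightarrow> (cmod (u x - u x))\<^sup>2"
        by (intro tendsto_intros h_lim elim)
      then show ?case by simp
    qed
    show "AE x in lebesgue. norm ((cmod (u x - h n x))\<^sup>2) \<le> w x" for n
    proof (rule AE_I2)
      fix x
      show "norm ((cmod (u x - h n x))\<^sup>2) \<le> w x"
      proof (cases "\<bar>x\<bar> \<le> M + 1")
        case True
        have "cmod (u x - h n x) \<le> 2 * M"
          using norm_triangle_ineq4[of "u x" "h n x"] bdd[of x] h_le[of n x] by simp
        then have "(cmod (u x - h n x))\<^sup>2 \<le> (2 * M)\<^sup>2" by (intro power_mono) auto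
        moreover have "x \<in> {- (M + 1)..M + 1}" using True by (simp add: abs_le_iff)
        ultimately show ?thesis by (simp add: w_def del: atLeastAtMost_iff)
      next
        case False
        then show ?thesis using supp[of x] h_supp[of x n] by (simp add: w_def)
      qed
    qed
  qed measurable
  then have "\<forall>\<^sub>F n in sequentially. (LINT x|lebesgue. (cmod (u x - h n x))\<^sup>2) < \<epsilon>"
    using \<epsilon> by (intro order_tendstoD(2)) simp_all
  then obtain n where "(LINT x|lebesgue. (cmod (u x - h n x))\<^sup>2) < \<epsilon>"
    by (auto simp: eventually_sequentially)
  then show thesis using that[of "h n"] h_cont h_supp by blast
qed

lemma L2_cutoff_continuous:
  assumes h: "continuous_on UNIV h" "\<And>x. \<bar>x\<bar> \<ge> R \<Longrightarrow> h x = 0"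
  shows "h \<in> L2_fun" "(LINT x|lebesgue. (cmod (h x))\<^sup>2) = (LINT x|lborel. (cmod (h x))\<^sup>2)"
proof -
  have "h \<in> borel_measurable lborel" using borel_measurable_continuous_onI[OF h(1)] by simp
  then have 1: "h \<in> borel_measurable lebesgue" by (rule measurable_completion)
  have c: "continuous_on UNIV (\<lambda>x. (cmod (h x))\<^sup>2)" by (intro continuous_intros h)
  then have m: "(\<lambda>x. (cmod (h x))\<^sup>2) \<in> borel_measurable lborel" using borel_measurable_continuous_onI by simp
  have "set_integrable lborel {- R..R} (\<lambda>x. (cmod (h x))\<^sup>2)"
    by (rule borel_integrable_atLeastAtMost'[OF continuous_on_subset[OF c]]) simp
  moreover have "indicator {- R..R} x *\<^sub>R (cmod (h x))\<^sup>2 = (cmod (h x))\<^sup>2" for x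
    using h(2)[of x] by (auto split: split_indicator)
  ultimately have "integrable lborel (\<lambda>x. (cmod (h x))\<^sup>2)" by (simp only: set_integrable_def)
  then show "h \<in> L2_fun" using 1 integrable_completion[OF m] by (simp add: L2_fun_def)
  show "(LINT x|lebesgue. (cmod (h x))\<^sup>2) = (LINT x|lborel. (cmod (h x))\<^sup>2)"
    by (rule integral_completion[OF m])
qed

lemma L2_approx_cutoff:
  assumes f: "f \<in> L2_fun" and \<epsilon>: "\<epsilon> > 0"
  obtains R h where "R > 0" "continuous_on UNIV h" "\<And>x. \<bar>x\<bar> \<ge> R \<Longrightarrow> h x = 0"
    "(LINT x|lebesgue. (cmod (f x - h x))\<^sup>2) < \<epsilon>"
proof -
  have [measurable]: "f \<in> borel_measurable lebesgue" and int: "integrable lebesgue (\<lambda>x. (cmod (f x))\<^sup>2)"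
    using f by (auto simp: L2_fun_def)
  define E where "E = (\<lambda>j::nat. {x. \<bar>x\<bar> \<le> real j} \<inter> {x. cmod (f x) \<le> real j})"
  define t where "t = (\<lambda>j x. indicator (E j) x *\<^sub>R f x)"
  have E_meas: "E j \<in> sets lebesgue" for j
  proof -
    have "{x \<in> space lebesgue. cmod (f x) \<le> real j} \<in> sets lebesgue" by measurable
    moreover have "{x :: real. \<bar>x\<bar> \<le> real j} = {- real j..real j}" by auto
    then have "{x :: real. \<bar>x\<bar> \<le> real j} \<in> sets lebesgue" by simp
    ultimately show ?thesis unfolding E_def by (intro sets.Int) simp_all
  qed
  then have t_meas [measurable]: "t j \<in> borel_measurable lebesgue" for j
    unfolding t_def by measurable
  have "(\<lambda>j. LINT x|lebesgue. (cmod (f x - t j x))\<^sup>2) \<longlonglongrightarrow> (LINT (x :: real)|lebesgue. 0)"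
  proof (rule integral_dominated_convergence[where w = "\<lambda>x. (cmod (f x))\<^sup>2"])
    show "integrable lebesgue (\<lambda>x. (cmod (f x))\<^sup>2)" by (rule int)
    show "AE x in lebesgue. (\<lambda>j. (cmod (f x - t j x))\<^sup>2) \<longlonglongrightarrow> 0"
    proof (rule AE_I2)
      fix x
      obtain j0 :: nat where j0: "max \<bar>x\<bar> (cmod (f x)) \<le> real j0" using real_arch_simple by blast
      have "\<forall>\<^sub>F j in sequentially. (cmod (f x - t j x))\<^sup>2 = 0"
      proof (rule eventually_sequentiallyI[of j0])
        fix j assume "j0 \<le> j"
        then have "max \<bar>x\<bar> (cmod (f x)) \<le> real j" using j0 by (meson of_nat_le_iff order_trans)
        then show "(cmod (f x - t j x))\<^sup>2 = 0" by (simp add: t_def E_def)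
      qed
      then show "(\<lambda>j. (cmod (f x - t j x))\<^sup>2) \<longlonglongrightarrow> 0" by (rule tendsto_eventually)
    qed
    show "AE x in lebesgue. norm ((cmod (f x - t j x))\<^sup>2) \<le> (cmod (f x))\<^sup>2" for j
      by (rule AE_I2) (simp add: t_def split: split_indicator)
  qed measurable
  then have "\<forall>\<^sub>F j in sequentially. (LINT x|lebesgue. (cmod (f x - t j x))\<^sup>2) < \<epsilon> / 4"
    by (rule order_tendstoD(2)) (use \<epsilon> in simp)
  moreover have "\<forall>\<^sub>F j in sequentially. (1::nat) \<le> j" by (rule eventually_ge_at_top)
  ultimately have "\<forall>\<^sub>F j in sequentially. (LINT x|lebesgue. (cmod (f x - t j x))\<^sup>2) < \<epsilon> / 4 \<and> 1 \<le> j"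
    by (rule eventually_conj)
  then obtain j where j: "(LINT x|lebesgue. (cmod (f x - t j x))\<^sup>2) < \<epsilon> / 4" "1 \<le> j"
    by (auto simp: eventually_sequentially)
  obtain h where h: "continuous_on UNIV h" "\<And>x. \<bar>x\<bar> \<ge> real j + 1 \<Longrightarrow> h x = 0"
    "(LINT x|lebesgue. (cmod (t j x - h x))\<^sup>2) < \<epsilon> / 4"
  proof (rule bounded_approx_cutoff[OF t_meas[of j], of "real j" "\<epsilon> / 4"])
    show "cmod (t j x) \<le> real j" for x by (simp add: t_def E_def split: split_indicator)
    show "t j x = 0" if "\<bar>x\<bar> > real j" for x using that by (simp add: t_def E_def)
  qed (use j \<epsilon> in auto)
  have tL: "t j \<in> L2_fun"
  proof -
    have "(\<lambda>x. (cmod (t j x))\<^sup>2) \<in> borel_measurable lebesgue" by measurable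
    then have "integrable lebesgue (\<lambda>x. (cmod (t j x))\<^sup>2)"
      by (rule Bochner_Integration.integrable_bound[OF int]) (simp add: t_def split: split_indicator)
    then show ?thesis by (simp add: L2_fun_def)
  qed
  have hL: "h \<in> L2_fun" by (rule L2_cutoff_continuous(1)[OF h(1,2)])
  have "(LINT x|lebesgue. (cmod (f x - h x))\<^sup>2) = (LINT x|lebesgue. (cmod ((f x - t j x) - (h x - t j x)))\<^sup>2)"
    by simp
  also have "\<dots> \<le> 2 * (LINT x|lebesgue. (cmod (f x - t j x))\<^sup>2) + 2 * (LINT x|lebesgue. (cmod (h x - t j x))\<^sup>2)"
    by (rule L2_fun_diff(2)[OF L2_fun_diff(1)[OF f tL] L2_fun_diff(1)[OF hL tL]])
  also have "\<dots> < \<epsilon>" using j(1) h(3) by (simp add: norm_minus_commute)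
  finally show thesis using that[of "real j + 1" h] h(1,2) by simp
qed

section \<open>The Gabor frame\<close>

lemma integrable_inverse_1_plus_square: "integrable lborel (\<lambda>x::real. 1 / (1 + x\<^sup>2))"
proof (rule integrable_even)
  have "(\<integral>\<^sup>+x. ennreal (1 / (1 + x\<^sup>2)) * indicator {0..} x \<partial>lborel) = ennreal (pi / 2 - arctan 0)"
    by (rule nn_integral_FTC_atLeast)
       (auto intro!: derivative_eq_intros tendsto_arctan_at_top simp: field_simps)
  moreover have "(\<integral>\<^sup>+x. ennreal (norm (indicator {0..} x *\<^sub>R (1 / (1 + x\<^sup>2)))) \<partial>(lborel :: real measure))
      = (\<integral>\<^sup>+x. ennreal (1 / (1 + x\<^sup>2)) * indicator {0..} x \<partial>(lborel :: real measure))"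
    by (intro nn_integral_cong) (auto split: split_indicator)
  ultimately have "(\<integral>\<^sup>+x. ennreal (norm (indicator {0..} x *\<^sub>R (1 / (1 + x\<^sup>2)))) \<partial>(lborel :: real measure)) < \<infinity>"
    by simp
  then show "set_integrable lborel {0..} (\<lambda>x::real. 1 / (1 + x\<^sup>2))"
    unfolding set_integrable_def by (intro integrableI_bounded) auto
qed simp

text \<open>A crude bound that makes the window square integrable.\<close>

lemma window_square_le: "(window x)\<^sup>2 \<le> 1 / (1 + x\<^sup>2)"
proof -
  define Y where "Y = x\<^sup>2"
  have Y: "Y \<ge> 0" by (simp add: Y_def)
  have "\<bar>window x\<bar> = \<bar>Y - 1\<bar> / ((Y + 1) * (Y + 4) * (Y + 9))"
    using Y by (simp add: window_def Y_def abs_mult)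
  also have "\<dots> \<le> (Y + 1) / ((Y + 1) * (Y + 4) * (Y + 9))"
    using Y by (intro divide_right_mono) auto
  also have "\<dots> = 1 / ((Y + 4) * (Y + 9))" using Y by simp
  also have "\<dots> \<le> 1 / (1 + Y)"
    using Y by (intro divide_left_mono mult_pos_pos) (auto simp: algebra_simps)
  finally have 1: "\<bar>window x\<bar> \<le> 1 / (1 + Y)" .
  also have "1 / (1 + Y) \<le> 1" using Y by simp
  finally have "\<bar>window x\<bar> * \<bar>window x\<bar> \<le> 1 / (1 + Y) * 1" using 1 Y by (intro mult_mono) auto
  then show ?thesis by (simp add: power2_eq_square Y_def)
qed

lemma gabor_system_L2: "window_system \<alpha> \<beta> i \<in> L2_fun"
proof -
  obtain k m where i: "i = (k, m)" by (cases i)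
  let ?e = "window_system \<alpha> \<beta> (k, m)"
  have cont: "continuous_on UNIV ?e"
    unfolding gabor_system_eq[abs_def]
    by (intro continuous_intros continuous_on_compose2[OF continuous_on_window[of UNIV]]) auto
  then have meas: "?e \<in> borel_measurable lborel" using borel_measurable_continuous_onI by simp
  have sq_meas: "(\<lambda>x. (cmod (?e x))\<^sup>2) \<in> borel_measurable lborel"
    using borel_measurable_continuous_onI[of "\<lambda>x. (cmod (?e x))\<^sup>2"] cont by (simp add: continuous_intros)
  have "integrable lborel (\<lambda>x. 1 / (1 + (- (\<alpha> * of_int k) + 1 * x)\<^sup>2))"
    by (rule lborel_integrable_real_affine[OF integrable_inverse_1_plus_square]) simp
  then have "integrable lborel (\<lambda>x. (cmod (?e x))\<^sup>2)"
  proof (rule Bochner_Integration.integrable_bound[OF _ sq_meas])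
    show "AE x in lborel. norm ((cmod (?e x))\<^sup>2) \<le> norm (1 / (1 + (- (\<alpha> * of_int k) + 1 * x)\<^sup>2))"
      using window_square_le[of "_ - \<alpha> * of_int k"]
      by (intro AE_I2) (simp add: gabor_system_eq norm_mult)
  qed
  then show ?thesis
    using integrable_completion[OF sq_meas] measurable_completion[OF meas] by (simp add: L2_fun_def i)
qed

theorem theorem1p1:
  fixes g :: "real \<Rightarrow> complex" and \<alpha> \<beta> :: real
  assumes "g = (\<lambda>x. of_real ((x\<^sup>2 - 1) / ((x\<^sup>2 + 1) * (x\<^sup>2 + 4) * (x\<^sup>2 + 9))))"
    and "\<alpha> > 0" and "\<beta> > 0"
    and "0 < \<alpha> * \<beta>" and "\<alpha> * \<beta> < 1 / 3"
  shows "is_L2_frame (gabor_system g \<alpha> \<beta>)"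
proof -
  have g: "g = (\<lambda>x. of_real (window x))"
    unfolding assms(1) window_def ..
  define D where "D = {h :: real \<Rightarrow> complex. continuous_on UNIV h \<and> (\<exists>R>0. \<forall>x. \<bar>x\<bar> \<ge> R \<longrightarrow> h x = 0)}"
  obtain A B where AB: "A > 0" "B > 0" and bounds: "\<forall>R f. R > 0 \<longrightarrow> continuous_on UNIV f \<longrightarrow> (\<forall>x. \<bar>x\<bar> \<ge> R \<longrightarrow> f x = 0) \<longrightarrow>
     ennreal (A * (LINT x|lborel. (cmod (f x))\<^sup>2)) \<le> (\<Sum>\<^sup>+i. ennreal ((cmod (L2_inner f (gabor_system g \<alpha> \<beta> i)))\<^sup>2)) \<and>
     (\<Sum>\<^sup>+i. ennreal ((cmod (L2_inner f (gabor_system g \<alpha> \<beta> i)))\<^sup>2)) \<le> ennreal (B * (LINT x|lborel. (cmod (f x))\<^sup>2))"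
    using gabor_frame_bounds_cutoff[OF assms(2,3,5)] unfolding g by blast
  show ?thesis
  proof (rule is_L2_frame_of_dense[OF _ AB, of _ D])
    show "gabor_system g \<alpha> \<beta> i \<in> L2_fun" for i
      unfolding g by (rule gabor_system_L2)
    show "D \<subseteq> L2_fun"
      using L2_cutoff_continuous(1) unfolding D_def by blast
    show "\<exists>h\<in>D. (LINT x|lebesgue. (cmod (f x - h x))\<^sup>2) < \<epsilon>" if "f \<in> L2_fun" "\<epsilon> > 0" for f \<epsilon>
      by (rule L2_approx_cutoff[OF that]) (auto simp: D_def)
    fix h assume "h \<in> D"
    then obtain R where R: "R > 0" "continuous_on UNIV h" "\<forall>x. \<bar>x\<bar> \<ge> R \<longrightarrow> h x = 0"
      unfolding D_def by blast
    have eq: "(LINT x|lebesgue. (cmod (h x))\<^sup>2) = (LINT x|lborel. (cmod (h x))\<^sup>2)"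
      by (rule L2_cutoff_continuous(2)[OF R(2) R(3)[rule_format]])
    show "ennreal (A * (LINT x|lebesgue. (cmod (h x))\<^sup>2)) \<le> (\<Sum>\<^sup>+i. ennreal ((cmod (L2_inner h (gabor_system g \<alpha> \<beta> i)))\<^sup>2))"
      "(\<Sum>\<^sup>+i. ennreal ((cmod (L2_inner h (gabor_system g \<alpha> \<beta> i)))\<^sup>2)) \<le> ennreal (B * (LINT x|lebesgue. (cmod (h x))\<^sup>2))"
      unfolding eq using bounds R by blast+
  qed
qed

end
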